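(* Let $\Omega\subset\mathbb{R}^d$ be a bounded Lipschitz domain and let $\{T_t\}_{|t|<\varepsilon}$ be a differentiable family of deformations of $\Omega$, with $\Omega_t=T_t(\Omega)$. Put $Q=\bigcup_{|t|<\varepsilon}\Omega_t\times\{t\}\subset\mathbb{R}^{d+1}$. If $c\in C^{0,1}(\overline{Q})$ and $c_t=\partial c/\partial t$ is continuous on $\overline{Q}$, then $$\frac{d}{dt}\int_{\Omega_t}c\,dx\,\Big|_{t=0}=\int_\Omega \dot c\,dx+\langle c_0,\delta\rho\rangle_{\partial\Omega},$$ where $c_0=c(\cdot,0)$ and $\dot c=c_t(\cdot,0)$.
   Context: $d\ge 2$. A Lipschitz domain is one whose boundary is locally a graph of Lipschitz functions; $\boldsymbol{\nu}$ is the unit outer normal on $\partial\Omega$ (defined a.e.). $T_t:\Omega\to\Omega_t=T_t(\Omega)$, $|t|<\varepsilon$, is a family of bi-Lipschitz homeomorphisms with $T_0=I$ (extended to $\overline\Omega$ by continuity), and $DT_t$ is the Jacobi matrix of $T_t$. The family is called differentiable if $T_tx$ is continuously differentiable in $t$ for every $x\in\Omega$ and the (matrix-valued) mappings $\frac{\partial}{\partial t}DT_t$, $\frac{\partial}{\partial t}(DT_t)^{-1}$ on $\Omega$ are uniformly bounded. $S=\frac{\partial T_t}{\partial t}\big|_{t=0}$ (a Lipschitz vector field on $\overline\Omega$) and $\delta\rho=S\cdot\boldsymbol{\nu}$ on $\partial\Omega$. $\langle\cdot,\cdot\rangle_{\partial\Omega}$ is the inner product in $L^2(\partial\Omega)$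 (or the pairing of $H^{1/2}(\partial\Omega)$ and $H^{-1/2}(\partial\Omega)$). $C^{0,1}$ denotes Lipschitz continuous functions. *)

theory Defs
  imports "HOL-Analysis.Analysis"
begin

definition gradient :: "('a::real_inner \<Rightarrow> real) \<Rightarrow> 'a \<Rightarrow> 'a" where
  "gradient \<phi> x = (THE D. GDERIV \<phi> x :> D)"

text \<open>
  A Lipschitz function on the hyperplane orthogonal to the unit vector \<open>e\<close> is encoded as a
  Lipschitz function \<open>\<phi>\<close> on the whole space that is invariant under translations along \<open>e\<close>.
  Inside the open set \<open>U\<close>, the set \<open>\<Omega>\<close> is the part strictly below the graph
  \<open>x \<bullet> e = \<phi> x\<close>; hence \<open>frontier \<Omega> \<inter> U\<close> is the part of the graph lying in \<open>U\<close>, and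
  \<open>\<Omega>\<close> lies on one side of it.
\<close>

definition lipschitz_chart ::
  "'a::euclidean_space set \<Rightarrow> 'a set \<Rightarrow> 'a \<Rightarrow> ('a \<Rightarrow> real) \<Rightarrow> bool" where
  "lipschitz_chart \<Omega> U e \<phi> \<longleftrightarrow>
     open U \<and> norm e = 1 \<and>
     (\<exists>L. L-lipschitz_on UNIV \<phi>) \<and>
     (\<forall>x s. \<phi> (x + s *\<^sub>R e) = \<phi> x) \<and>
     \<Omega> \<inter> U = {x \<in> U. x \<bullet> e < \<phi> x}"

definition lipschitz_domain :: "'a::euclidean_space set \<Rightarrow> bool" where
  "lipschitz_domain \<Omega> \<longleftrightarrow>
     open \<Omega> \<and> connected \<Omega> \<and> \<Omega> \<noteq> {} \<and>
     (\<forall>p \<in> frontier \<Omega>. \<exists>U e \<phi>. p \<in> U \<and> lipschitz_chart \<Omega> U e \<phi>)"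

text \<open>
  The surface measure is the Borel measure carried by the boundary which in every chart is
  \<open>sqrt (1 + \<bar>\<nabla>\<phi>\<bar>\<^sup>2) dx'\<close>, with \<open>dx'\<close> the \<open>(d-1)\<close>-dimensional Lebesgue measure on the
  hyperplane \<open>e\<^sup>\<bottom>\<close>.  Integration against \<open>dx'\<close> is written as integration over the slab
  \<open>0 \<le> x \<bullet> e \<le> 1\<close> of unit thickness, the integrand being constant along \<open>e\<close>; the point
  of the graph over (the projection of) \<open>x\<close> is \<open>x + (\<phi> x - x \<bullet> e) *\<^sub>R e\<close>.  Where \<open>\<phi>\<close> is not
  differentiable, \<open>gradient \<phi> x\<close> is unspecified; this is a null set.
\<close>

definition is_surface_measure :: "'a::euclidean_space set \<Rightarrow> 'a measure \<Rightarrow> bool" where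
  "is_surface_measure \<Omega> \<sigma> \<longleftrightarrow>
     sets \<sigma> = sets borel \<and>
     emeasure \<sigma> (- frontier \<Omega>) = 0 \<and>
     (\<forall>U e \<phi>. lipschitz_chart \<Omega> U e \<phi> \<longrightarrow>
        (\<forall>A \<in> sets borel. A \<subseteq> frontier \<Omega> \<inter> U \<longrightarrow>
           emeasure \<sigma> A =
             (\<integral>\<^sup>+ x \<in> {x. 0 \<le> x \<bullet> e \<and> x \<bullet> e \<le> 1}.
                indicator A (x + (\<phi> x - x \<bullet> e) *\<^sub>R e)
                  * ennreal (sqrt (1 + (norm (gradient \<phi> x))\<^sup>2)) \<partial>lebesgue)))"

text \<open>Completed, so that functions defined almost everywhere, such as the normal, are measurable.\<close>

definition surface_measure :: "'a::euclidean_space set \<Rightarrow> 'a measure" where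
  "surface_measure \<Omega> = completion (THE \<sigma>. is_surface_measure \<Omega> \<sigma>)"

text \<open>
  \<open>n\<close> is the unit outer normal at \<open>x\<close> if, up to a cone of arbitrarily small opening around the
  hyperplane orthogonal to \<open>n\<close>, the set \<open>\<Omega>\<close> coincides near \<open>x\<close> with the half-space
  \<open>(y - x) \<bullet> n < 0\<close>.  For the region below the graph of \<open>\<phi>\<close> this is
  \<open>n = (e - \<nabla>\<phi>) / sqrt (1 + \<bar>\<nabla>\<phi>\<bar>\<^sup>2)\<close> at every point of differentiability.
\<close>

definition is_outer_normal :: "'a::euclidean_space set \<Rightarrow> 'a \<Rightarrow> 'a \<Rightarrow> bool" where
  "is_outer_normal \<Omega> x n \<longleftrightarrow>
     norm n = 1 \<and>
     (\<forall>\<eta>>0. \<forall>\<^sub>F y in at x.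
        ((y - x) \<bullet> n < - \<eta> * norm (y - x) \<longrightarrow> y \<in> \<Omega>) \<and>
        ((y - x) \<bullet> n > \<eta> * norm (y - x) \<longrightarrow> y \<notin> \<Omega>))"

definition outer_normal :: "'a::euclidean_space set \<Rightarrow> 'a \<Rightarrow> 'a" where
  "outer_normal \<Omega> x =
     (if \<exists>n. is_outer_normal \<Omega> x n then THE n. is_outer_normal \<Omega> x n else 0)"

definition bi_lipschitz_on :: "'a::metric_space set \<Rightarrow> ('a \<Rightarrow> 'b::metric_space) \<Rightarrow> bool" where
  "bi_lipschitz_on X f \<longleftrightarrow>
     (\<exists>L>0. \<forall>x\<in>X. \<forall>y\<in>X. dist x y / L \<le> dist (f x) (f y) \<and> dist (f x) (f y) \<le> L * dist x y)"

text \<open>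
  \<open>T t\<close> is the deformation already extended to the closure of \<open>\<Omega>\<close>, whence the continuity
  requirement there; its values elsewhere and for \<open>\<bar>t\<bar> \<ge> \<epsilon>\<close> play no role.  The Jacobi matrices
  of Lipschitz maps exist only almost everywhere, so the conditions on them are imposed for all
  \<open>x\<close> outside a null set (not depending on \<open>t\<close>).
\<close>

definition differentiable_deformations ::
  "(real^'n) set \<Rightarrow> real \<Rightarrow> (real \<Rightarrow> real^'n \<Rightarrow> real^'n) \<Rightarrow> bool" where
  "differentiable_deformations \<Omega> \<epsilon> T \<longleftrightarrow>
     \<epsilon> > 0 \<and>
     (\<forall>t. \<bar>t\<bar> < \<epsilon> \<longrightarrow> bi_lipschitz_on \<Omega> (T t) \<and> continuous_on (closure \<Omega>) (T t)) \<and>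
     (\<forall>x \<in> \<Omega>. T 0 x = x) \<and>
     (\<forall>x \<in> \<Omega>. (\<lambda>t. T t x) C1_differentiable_on {-\<epsilon><..<\<epsilon>}) \<and>
     (\<exists>M. AE x in lebesgue. x \<in> \<Omega> \<longrightarrow>
        (\<forall>t. \<bar>t\<bar> < \<epsilon> \<longrightarrow>
           T t differentiable (at x) \<and>
           (\<lambda>s. jacobian (T s) (at x)) differentiable (at t) \<and>
           norm (vector_derivative (\<lambda>s. jacobian (T s) (at x)) (at t)) \<le> M \<and>
           (\<lambda>s. matrix_inv (jacobian (T s) (at x))) differentiable (at t) \<and>
           norm (vector_derivative (\<lambda>s. matrix_inv (jacobian (T s) (at x))) (at t)) \<le> M))"

definition deformation_tube ::
  "'a set \<Rightarrow> real \<Rightarrow> (real \<Rightarrow> 'a \<Rightarrow> 'b) \<Rightarrow> ('b \<times> real) set" where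
  "deformation_tube \<Omega> \<epsilon> T = (\<Union>t \<in> {-\<epsilon><..<\<epsilon>}. (T t ` \<Omega>) \<times> {t})"

definition deformation_field ::
  "(real \<Rightarrow> 'a \<Rightarrow> 'b::real_normed_vector) \<Rightarrow> 'a \<Rightarrow> 'b" where
  "deformation_field T x = vector_derivative (\<lambda>t. T t x) (at 0)"

definition normal_displacement ::
  "'a::euclidean_space set \<Rightarrow> (real \<Rightarrow> 'a \<Rightarrow> 'a) \<Rightarrow> 'a \<Rightarrow> real" where
  "normal_displacement \<Omega> T x = deformation_field T x \<bullet> outer_normal \<Omega> x"

definition boundary_inner ::
  "'a::euclidean_space set \<Rightarrow> ('a \<Rightarrow> real) \<Rightarrow> ('a \<Rightarrow> real) \<Rightarrow> real" where
  "boundary_inner \<Omega> f g = (LINT x : frontier \<Omega> | surface_measure \<Omega>. f x * g x)"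

end

theory Submission
  imports Defs
begin

text \<open>
  Neither a change of variables nor the divergence theorem is used.  After replacing \<open>c\<close> by a
  Lipschitz extension, the difference quotient splits into
  \<open>\<integral>\<^bsub>\<Omega>\<^sub>t\<^esub> (c(x,t) - c(x,0)) / t\<close>, which tends to \<open>\<integral>\<^bsub>\<Omega>\<^esub> c\<^sub>t(x,0)\<close> by dominated convergence, and
  \<open>1/t\<close> times the integral of \<open>c(x,0)\<close> over the thin layer between \<open>\<Omega>\<close> and \<open>\<Omega>\<^sub>t\<close>.  In a chart the
  points of that layer are \<open>p + t r e\<close> with \<open>p\<close> on the graph of \<open>\<phi>\<close> and \<open>r\<close> bounded, and where
  \<open>\<phi>\<close> is differentiable (almost everywhere, by Rademacher's theorem) such a point eventually
  belongs to \<open>\<Omega>\<^sub>t\<close> if \<open>r < S \<bullet> (e - \<nabla>\<phi>)\<close> and eventually does not if \<open>r > S \<bullet> (e - \<nabla>\<phi>)\<close>.  Hence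
  dominated convergence yields \<open>\<integral> c\<^sub>0 S \<bullet> (e - \<nabla>\<phi>) dx'\<close>, the flux of \<open>c\<^sub>0 S\<close> through the boundary.

  The same limit, taken for translations, is intrinsic to \<open>\<Omega>\<close>; comparing it in two charts shows
  that the surface measure does not depend on the charts, so that it exists.
\<close>

section \<open>Almost everywhere differentiability of Lipschitz functions\<close>

text \<open>Two gaps separate the hypotheses from what a boundary layer requires. The Jacobi
  matrices are controlled only outside a null set, while the boundary and the segments along which
  increments are estimated are themselves null sets. Averages over small balls convert the
  almost-everywhere bound into a genuine Lipschitz bound for \<open>T t x - x\<close> with constant
  proportional to \<open>\<bar>t\<bar>\<close>; it holds only locally, since \<Omega> need not be
  convex. This bound also carries the velocity field to the boundary, where differentiability in
  time is not assumed. The second gap is that \<open>c\<close> is known only on the closed tube,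
  whereas the layer needs \<open>c (x, 0)\<close> at points outside \<Omega>; hence the extension.
  Limits are taken along sequences of positive numbers, the form in which dominated convergence
  applies, and the sign of the time is kept as a separate factor \<open>s\<close>.\<close>

text \<open>Serves twice: for a pair of Stieltjes measures on the line and for gluing the surface
  measure from chart pieces.\<close>

lemma ex_sum_measure:
  fixes M :: "'i \<Rightarrow> 'a::topological_space measure"
  assumes "finite I" and sets: "\<And>i. i \<in> I \<Longrightarrow> sets (M i) = sets borel"
  shows "\<exists>\<sigma>. sets \<sigma> = sets borel \<and> (\<forall>A\<in>sets borel. emeasure \<sigma> A = (\<Sum>i\<in>I. emeasure (M i) A))"
proof (intro exI conjI ballI)
  let ?\<sigma> = "measure_of UNIV (sets borel) (\<lambda>A. \<Sum>i\<in>I. emeasure (M i) A)"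
  show "sets ?\<sigma> = sets borel"
    by (simp add: sets.sigma_sets_eq[of borel, simplified])
  fix A :: "'a set" assume A: "A \<in> sets borel"
  have "countably_additive (sets borel) (\<lambda>A. \<Sum>i\<in>I. emeasure (M i) A)"
  proof (rule countably_additiveI)
    fix X :: "nat \<Rightarrow> 'a set"
    assume X: "range X \<subseteq> sets borel" "disjoint_family X"
    have "(\<Sum>n. \<Sum>i\<in>I. emeasure (M i) (X n)) = (\<Sum>i\<in>I. \<Sum>n. emeasure (M i) (X n))"
      by (rule suminf_sum) auto
    also have "\<dots> = (\<Sum>i\<in>I. emeasure (M i) (\<Union>n. X n))"
      using X sets by (intro sum.cong suminf_emeasure) auto
    finally show "(\<Sum>n. \<Sum>i\<in>I. emeasure (M i) (X n)) = (\<Sum>i\<in>I. emeasure (M i) (\<Union>n. X n))" .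
  qed
  moreover have "positive (sets borel) (\<lambda>A. \<Sum>i\<in>I. emeasure (M i) A)"
    by (simp add: positive_def)
  moreover have "sigma_algebra UNIV (sets (borel::'a measure))"
    using sets.sigma_algebra_axioms[of "borel::'a measure"] by simp
  ultimately show "emeasure ?\<sigma> A = (\<Sum>i\<in>I. emeasure (M i) A)"
    using A by (intro emeasure_measure_of_sigma)
qed

text \<open>Both sides agree on half-open intervals, a generating system closed under intersection.
  Each of the two Stieltjes measures is therefore absolutely continuous, and bounds for both of them
  turn into a bound for Lebesgue measure.\<close>

lemma emeasure_interval_measure_add:
  fixes F G :: "real \<Rightarrow> real"
  assumes F: "mono F" "continuous_on UNIV F" and G: "mono G" "continuous_on UNIV G"
    and FG: "\<And>x. F x + G x = K * x" and K: "0 \<le> K" and A: "A \<in> sets borel"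
  shows "emeasure (interval_measure F) A + emeasure (interval_measure G) A = ennreal K * emeasure lborel A"
proof -
  let ?M = "\<lambda>i. if i then interval_measure F else interval_measure G"
  have M_sets: "sets (?M i) = sets borel" for i by simp
  obtain M where setsM: "sets M = sets borel"
    and M: "\<forall>A\<in>sets borel. emeasure M A = (\<Sum>i\<in>UNIV. emeasure (?M i) A)"
    using ex_sum_measure[of UNIV ?M, OF finite M_sets] by blast
  have eM: "emeasure M B = emeasure (interval_measure F) B + emeasure (interval_measure G) B"
    if "B \<in> sets borel" for B
    using M that by (simp add: UNIV_bool add.commute)
  have Ioc: "emeasure M {a<..b} = emeasure (density lborel (\<lambda>_. ennreal K)) {a<..b}" for a b
  proof (cases "a \<le> b")
    case True
    have 1: "emeasure (interval_measure F) {a<..b} = F b - F a"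
      by (rule emeasure_interval_measure_Ioc[OF True])
        (use F in \<open>auto simp: mono_def continuous_on_eq_continuous_within intro: continuous_at_imp_continuous_at_within\<close>)
    have 2: "emeasure (interval_measure G) {a<..b} = G b - G a"
      by (rule emeasure_interval_measure_Ioc[OF True])
        (use G in \<open>auto simp: mono_def continuous_on_eq_continuous_within intro: continuous_at_imp_continuous_at_within\<close>)
    have "F b - F a \<ge> 0" "G b - G a \<ge> 0"
      using True F(1) G(1) by (auto simp: mono_def)
    moreover have "F b - F a + (G b - G a) = K * (b - a)"
      using FG[of a] FG[of b] by (simp add: algebra_simps)
    ultimately show ?thesis
      using True K by (simp add: eM 1 2 emeasure_density ennreal_plus[symmetric] ennreal_mult nn_integral_cmult_indicator del: ennreal_plus)
  qed (simp add: eM)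
  have "M = density lborel (\<lambda>_. ennreal K)"
  proof (rule measure_eqI_generator_eq[where E="range (\<lambda>(a, b). {a <.. b::real})" and \<Omega>=UNIV and A="\<lambda>n. {- real n<..real n}"])
    show "Int_stable (range (\<lambda>(a, b). {a <.. b::real}))"
      by (auto simp: Int_stable_def)
    show "(\<Union>i. {- real i<..real i}) = UNIV"
    proof -
      have "\<exists>i. - real i < x \<and> x \<le> real i" for x
        using reals_Archimedean2[of "\<bar>x\<bar>"] by (metis abs_less_iff less_imp_le minus_less_iff)
      then show ?thesis by auto
    qed
    show "emeasure M {- real i<..real i} \<noteq> \<infinity>" for i
      unfolding Ioc by (auto simp: emeasure_density nn_integral_cmult_indicator ennreal_mult_eq_top_iff)
  qed (use Ioc in \<open>auto simp: setsM borel_sigma_sets_Ioc\<close>)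
  then show ?thesis
    using eM[OF A] A by (simp add: emeasure_density nn_integral_cmult)
qed

text \<open>The short intervals of slope at most \<open>a\<close> form a Vitali cover of
  \<open>E\<close>, so disjoint ones inside an open set barely larger than \<open>E\<close> exhaust
  \<open>E\<close> up to a Lebesgue null set. \<open>ac\<close> makes this remainder invisible to
  the Stieltjes measure, and on each interval that measure is at most \<open>a\<close> times the
  length. The point need not be the centre of its interval, so intervals straddling it
  suffice.\<close>

lemma interval_measure_le_Vitali:
  fixes h :: "real \<Rightarrow> real"
  assumes h: "mono h" "continuous_on UNIV h"
    and ac: "\<And>N. N \<in> null_sets lborel \<Longrightarrow> emeasure (interval_measure h) N = 0"
    and E: "E \<in> sets borel" and a: "0 \<le> a"
    and small: "\<And>x d. x \<in> E \<Longrightarrow> 0 < d \<Longrightarrow> \<exists>u v. u < x \<and> x < v \<and> v - u < d \<and> h v - h u \<le> a * (v - u)"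
  shows "emeasure (interval_measure h) E \<le> ennreal a * emeasure lborel E"
proof (rule ennreal_le_epsilon)
  fix \<epsilon> :: real assume e: "0 < \<epsilon>"
  \<comment> \<open>Dividing by \<open>a + 1\<close> rather than \<open>a\<close> gives
    \<open>a * \<epsilon>' \<le> \<epsilon>\<close> also when \<open>a = 0\<close>.\<close>
  define \<epsilon>' where "\<epsilon>' = \<epsilon> / (a + 1)"
  have e': "0 < \<epsilon>'" "a * \<epsilon>' \<le> \<epsilon>" using e a by (auto simp: \<epsilon>'_def field_simps)
  obtain O' where O': "open O'" "E \<subseteq> O'" "emeasure lborel (O' - E) < \<epsilon>'"
    using outer_regular_lborel[OF E e'(1)] by blast
  \<comment> \<open>Intervals are coded by midpoint and radius, as closed balls of the line, the
    form in which the covering theorem takes them.\<close>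
  define K where "K = {(m, r). r > 0 \<and> cball m r \<subseteq> O' \<and> h (m + r) - h (m - r) \<le> a * (2 * r)}"
  have cov: "\<exists>i. i \<in> K \<and> x \<in> cball (fst i) (snd i) \<and> snd i < d" if "x \<in> E" "0 < d" for x d
  proof -
    obtain \<rho> where \<rho>: "\<rho> > 0" "ball x \<rho> \<subseteq> O'"
      using O' \<open>x \<in> E\<close> by (meson open_contains_ball subsetD)
    obtain u v where uv: "u < x" "x < v" "v - u < min d \<rho>" "h v - h u \<le> a * (v - u)"
      using small[OF \<open>x \<in> E\<close>, of "min d \<rho>"] \<rho> \<open>0 < d\<close> by (metis min_less_iff_conj)
    have "cball ((u+v)/2) ((v-u)/2) \<subseteq> ball x \<rho>"
    proof
      fix y assume "y \<in> cball ((u+v)/2) ((v-u)/2)"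
      then have "u \<le> y" "y \<le> v" by (auto simp: cball_eq_atLeastAtMost field_simps)
      with uv show "y \<in> ball x \<rho>" by (auto simp: dist_real_def)
    qed
    moreover have eqs: "(u+v)/2 + (v-u)/2 = v" "(u+v)/2 - (v-u)/2 = u" "2 * ((v - u) / 2) = v - u"
      by (auto simp: field_simps)
    ultimately have "((u+v)/2, (v-u)/2) \<in> K"
      using uv \<rho> unfolding K_def mem_Collect_eq case_prod_conv eqs by auto
    then show ?thesis
      using uv by (intro exI[of _ "((u+v)/2, (v-u)/2)"]) (auto simp: cball_eq_atLeastAtMost field_simps)
  qed
  have rK: "0 < snd i" if "i \<in> K" for i using that by (auto simp: K_def)
  obtain C where C: "countable C" "C \<subseteq> K"
     "pairwise (\<lambda>i j. disjnt (cball (fst i) (snd i)) (cball (fst j) (snd j))) C"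
     "negligible (E - (\<Union>i \<in> C. cball (fst i) (snd i)))"
    by (rule Vitali_covering_theorem_cballs[of K snd E fst, OF rK cov])
  define B where "B i = cball (fst i) (snd i)" for i :: "real \<times> real"
  let ?\<mu> = "interval_measure h"
  have djf: "disjoint_family_on B C"
    using C(3) by (auto simp: disjoint_family_on_def pairwise_def disjnt_def B_def)
  have Bm: "B ` C \<subseteq> sets borel" by (auto simp: B_def)
  have UB: "(\<Union>i\<in>C. B i) \<in> sets borel"
    using C(1) by (intro sets.countable_UN') (auto simp: B_def)
  have N0: "E - (\<Union>i\<in>C. B i) \<in> null_sets lborel"
    using C(4) UB E by (auto simp: B_def negligible_iff_null_sets null_sets_completion_iff)
  have Bi: "emeasure ?\<mu> (B i) \<le> ennreal a * emeasure lborel (B i)" if "i \<in> C" for i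
  proof -
    have i: "snd i > 0" "h (fst i + snd i) - h (fst i - snd i) \<le> a * (2 * snd i)"
      using that C(2) by (auto simp: K_def)
    have "emeasure ?\<mu> (B i) = h (fst i + snd i) - h (fst i - snd i)"
      unfolding B_def cball_eq_atLeastAtMost
      by (rule emeasure_interval_measure_Icc)
        (use h i in \<open>auto simp: mono_def\<close>)
    also have "\<dots> \<le> ennreal (a * (2 * snd i))" using i by (intro ennreal_leI) auto
    also have "\<dots> = ennreal a * emeasure lborel (B i)"
      using i a by (auto simp: B_def cball_eq_atLeastAtMost ennreal_mult)
    finally show ?thesis .
  qed
  have "emeasure ?\<mu> E \<le> emeasure ?\<mu> ((E - (\<Union>i\<in>C. B i)) \<union> (\<Union>i\<in>C. B i))"
    using E UB by (intro emeasure_mono) auto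
  also have "\<dots> \<le> emeasure ?\<mu> (E - (\<Union>i\<in>C. B i)) + emeasure ?\<mu> (\<Union>i\<in>C. B i)"
    using E UB by (intro emeasure_subadditive) auto
  also have "\<dots> = emeasure ?\<mu> (\<Union>i\<in>C. B i)" using ac[OF N0] by simp
  also have "\<dots> = (\<integral>\<^sup>+i. emeasure ?\<mu> (B i) \<partial>count_space C)"
    using C(1) djf Bm by (intro emeasure_UN_countable) auto
  also have "\<dots> \<le> (\<integral>\<^sup>+i. ennreal a * emeasure lborel (B i) \<partial>count_space C)"
    using Bi by (intro nn_integral_mono) auto
  also have "\<dots> = ennreal a * (\<integral>\<^sup>+i. emeasure lborel (B i) \<partial>count_space C)"
    by (simp add: nn_integral_cmult)
  also have "(\<integral>\<^sup>+i. emeasure lborel (B i) \<partial>count_space C) = emeasure lborel (\<Union>i\<in>C. B i)"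
    using C(1) djf Bm by (intro emeasure_UN_countable[symmetric]) auto
  also have "\<dots> \<le> emeasure lborel O'"
  proof (rule emeasure_mono)
    have "B i \<subseteq> O'" if "i \<in> C" for i
    proof -
      have "i \<in> K" using C(2) that by blast
      then show ?thesis by (simp add: K_def B_def case_prod_beta)
    qed
    then show "(\<Union>i\<in>C. B i) \<subseteq> O'" by blast
  qed (use O'(1) in auto)
  also have "emeasure lborel O' = emeasure lborel (E \<union> (O' - E))"
    using O'(2) by (simp add: Un_absorb1)
  also have "\<dots> \<le> emeasure lborel E + emeasure lborel (O' - E)"
    using E O'(1) by (intro emeasure_subadditive) auto
  also have "ennreal a * \<dots> \<le> ennreal a * (emeasure lborel E + ennreal \<epsilon>')"
    using O'(3) by (intro mult_left_mono add_left_mono) auto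
  also have "\<dots> = ennreal a * emeasure lborel E + ennreal (a * \<epsilon>')"
    using a e' by (simp add: distrib_left ennreal_mult)
  also have "\<dots> \<le> ennreal a * emeasure lborel E + ennreal \<epsilon>"
    using e' by (intro add_left_mono ennreal_leI) auto
  finally show "emeasure ?\<mu> E \<le> ennreal a * emeasure lborel E + ennreal \<epsilon>"
    by (simp add: mult_left_mono)
qed

text \<open>Letting the interval straddle the point, instead of starting at it, makes this a countable
  intersection of open sets.\<close>

definition small_slope_set :: "('a::real_normed_vector \<Rightarrow> real) \<Rightarrow> 'a \<Rightarrow> real \<Rightarrow> 'a set" where
  "small_slope_set f v a =
    (\<Inter>n::nat. \<Union>(s, t) \<in> {(s, t). s < 0 \<and> 0 < t \<and> t - s < 1 / (real n + 1)}.
       {x. f (x + t *\<^sub>R v) - f (x + s *\<^sub>R v) < a * (t - s)})"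

lemma small_slope_set_iff:
  "x \<in> small_slope_set f v a \<longleftrightarrow>
     (\<forall>d>0. \<exists>s t. s < 0 \<and> 0 < t \<and> t - s < d \<and> f (x + t *\<^sub>R v) - f (x + s *\<^sub>R v) < a * (t - s))"
proof
  assume L: "x \<in> small_slope_set f v a"
  show "\<forall>d>0. \<exists>s t. s < 0 \<and> 0 < t \<and> t - s < d \<and> f (x + t *\<^sub>R v) - f (x + s *\<^sub>R v) < a * (t - s)"
  proof (intro allI impI)
    fix d :: real assume "0 < d"
    then obtain n :: nat where "1 / (real n + 1) < d"
      by (metis add.commute nat_approx_posE of_nat_Suc)
    moreover have "\<exists>s t. s < 0 \<and> 0 < t \<and> t - s < 1 / (real n + 1) \<and> f (x + t *\<^sub>R v) - f (x + s *\<^sub>R v) < a * (t - s)"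
      using L unfolding small_slope_set_def by auto
    ultimately show "\<exists>s t. s < 0 \<and> 0 < t \<and> t - s < d \<and> f (x + t *\<^sub>R v) - f (x + s *\<^sub>R v) < a * (t - s)"
      by (meson order_less_trans)
  qed
next
  assume R: "\<forall>d>0. \<exists>s t. s < 0 \<and> 0 < t \<and> t - s < d \<and> f (x + t *\<^sub>R v) - f (x + s *\<^sub>R v) < a * (t - s)"
  have "\<exists>s t. s < 0 \<and> 0 < t \<and> t - s < 1 / (real n + 1) \<and> f (x + t *\<^sub>R v) - f (x + s *\<^sub>R v) < a * (t - s)" for n :: nat
    using R[rule_format, of "1 / (real n + 1)"] by auto
  then show "x \<in> small_slope_set f v a"
    unfolding small_slope_set_def by auto
qed

lemma borel_small_slope_set:
  assumes "continuous_on UNIV f"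
  shows "small_slope_set f v a \<in> sets borel"
proof -
  have "open {x. f (x + t *\<^sub>R v) - f (x + s *\<^sub>R v) < a * (t - s)}" for s t
    by (intro open_Collect_less continuous_intros continuous_on_compose2[OF assms]) auto
  then show ?thesis
    unfolding small_slope_set_def
    by (intro sets.countable_INT'' borel_open open_UN) auto
qed

text \<open>On this set \<open>f\<close> has slopes below \<open>a\<close> and slopes above
  \<open>b\<close> at all small scales. The increasing functions \<open>L * x + f x\<close> and
  \<open>L * x - f x\<close> therefore give it measure at most \<open>L + a\<close> and
  \<open>L - b\<close> times its length, yet the two measures add up to \<open>2 * L\<close> times
  its length. Hence \<open>b - a\<close> times the length is at most zero.\<close>

lemma lipschitz_null_slopes:
  fixes f :: "real \<Rightarrow> real"
  assumes f: "L-lipschitz_on UNIV f" and ab: "a < b"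
  shows "small_slope_set f 1 a \<inter> small_slope_set (\<lambda>x. - f x) 1 (- b) \<in> null_sets lborel" (is "?E \<in> _")
proof -
  have L: "L \<ge> 0" using f lipschitz_on_nonneg by blast
  have contf: "continuous_on UNIV f"
    using f lipschitz_on_continuous_on by blast
  have fl: "\<bar>f x - f y\<bar> \<le> L * \<bar>x - y\<bar>" for x y
    using lipschitz_onD[OF f, of x y] by (simp add: dist_real_def)
  define F where "F x = L * x + f x" for x
  define G where "G x = L * x - f x" for x
  have F: "mono F" "continuous_on UNIV F"
  proof -
    show "mono F"
    proof (rule monoI)
      fix x y :: real assume "x \<le> y"
      then show "F x \<le> F y"
        using fl[of x y] by (simp add: F_def abs_le_iff algebra_simps)
    qed
    show "continuous_on UNIV F"
      unfolding F_def by (intro continuous_intros contf)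
  qed
  have G: "mono G" "continuous_on UNIV G"
  proof -
    show "mono G"
    proof (rule monoI)
      fix x y :: real assume "x \<le> y"
      then show "G x \<le> G y"
        using fl[of x y] by (simp add: G_def abs_le_iff algebra_simps)
    qed
    show "continuous_on UNIV G"
      unfolding G_def by (intro continuous_intros contf)
  qed
  have FG: "F x + G x = (2 * L) * x" for x by (simp add: F_def G_def)
  note add = emeasure_interval_measure_add[OF F G FG, OF mult_nonneg_nonneg[OF _ L]]
  have acF: "emeasure (interval_measure F) N = 0" if "N \<in> null_sets lborel" for N
    using add[of N] that by (auto simp: null_sets_def)
  have acG: "emeasure (interval_measure G) N = 0" if "N \<in> null_sets lborel" for N
    using add[of N] that by (auto simp: null_sets_def)
  have Eb: "?E \<in> sets borel"
    by (intro sets.Int borel_small_slope_set continuous_intros contf)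
  \<comment> \<open>A bounded window makes the length finite, so that the final inequality can be
    read in the reals.\<close>
  have null: "?E \<inter> {-real n<..<real n} \<in> null_sets lborel" for n
  proof -
    define E where "E = ?E \<inter> {-real n<..<real n}"
    have E: "E \<in> sets borel" using Eb by (simp add: E_def)
    have fin: "emeasure lborel E < \<infinity>"
    proof -
      have "emeasure lborel E \<le> emeasure lborel {-real n<..<real n}"
        unfolding E_def by (intro emeasure_mono) auto
      then show ?thesis by (simp add: le_less_trans)
    qed
    \<comment> \<open>The Vitali estimate asks for a nonnegative constant; \<open>max 0\<close>
      provides one before the sign of \<open>L + a\<close> is known.\<close>
    have 1: "emeasure (interval_measure F) E \<le> ennreal (max 0 (L + a)) * emeasure lborel E"
    proof (rule interval_measure_le_Vitali[OF F acF E])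
      fix x d :: real assume "x \<in> E" "0 < d"
      then obtain s t where "s < 0 \<and> 0 < t \<and> t - s < d \<and> f (x + t) - f (x + s) < a * (t - s)"
        unfolding E_def by (auto simp: small_slope_set_iff)
      moreover from this have "(L + a) * (t - s) \<le> max 0 (L + a) * (t - s)" by (intro mult_right_mono) auto
      ultimately show "\<exists>u v. u < x \<and> x < v \<and> v - u < d \<and> F v - F u \<le> max 0 (L + a) * (v - u)"
        by (intro exI[of _ "x+s"] exI[of _ "x+t"]) (auto simp: F_def algebra_simps)
    qed auto
    have 2: "emeasure (interval_measure G) E \<le> ennreal (max 0 (L - b)) * emeasure lborel E"
    proof (rule interval_measure_le_Vitali[OF G acG E])
      fix x d :: real assume "x \<in> E" "0 < d"
      then obtain s t where "s < 0 \<and> 0 < t \<and> t - s < d \<and> - f (x + t) + f (x + s) < -b * (t - s)"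
        unfolding E_def by (auto simp: small_slope_set_iff)
      moreover from this have "(L - b) * (t - s) \<le> max 0 (L - b) * (t - s)" by (intro mult_right_mono) auto
      ultimately show "\<exists>u v. u < x \<and> x < v \<and> v - u < d \<and> G v - G u \<le> max 0 (L - b) * (v - u)"
        by (intro exI[of _ "x+s"] exI[of _ "x+t"]) (auto simp: G_def algebra_simps)
    qed auto
    \<comment> \<open>A single point of \<open>E\<close> exhibits a slope below \<open>a\<close> and
      one above \<open>b\<close>. Slopes lie between \<open>- L\<close> and \<open>L\<close>, so
      both constants are nonnegative and the maxima disappear.\<close>
    have ab': "L + a \<ge> 0 \<and> L - b \<ge> 0" if "x \<in> E" for x
    proof -
      have "x \<in> small_slope_set f 1 a" using that by (simp add: E_def)
      from this[unfolded small_slope_set_iff, rule_format, OF zero_less_one]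
      obtain s t where st: "s < 0" "0 < t" "f (x + t) - f (x + s) < a * (t - s)" by auto
      then have "-L * (t - s) < a * (t - s)" using fl[of "x+t" "x+s"] by auto
      then have A: "L + a \<ge> 0" using st by (subst (asm) mult_less_cancel_right_pos) auto
      have "x \<in> small_slope_set (\<lambda>x. - f x) 1 (- b)" using that by (simp add: E_def)
      from this[unfolded small_slope_set_iff, rule_format, OF zero_less_one]
      obtain s t where st: "s < 0" "0 < t" "- f (x + t) + f (x + s) < -b * (t - s)" by auto
      have "\<bar>f (x + t) - f (x + s)\<bar> \<le> L * (t - s)" using fl[of "x+t" "x+s"] st by simp
      then have "b * (t - s) < L * (t - s)" using st(3) by linarith
      then have "L - b \<ge> 0" using st by (subst (asm) mult_less_cancel_right_pos) auto
      with A show ?thesis by simp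
    qed
    have "emeasure lborel E = 0"
    proof (cases "E = {}")
      case False
      then have nn: "L + a \<ge> 0" "L - b \<ge> 0" using ab' by auto
      define m where "m = measure lborel E"
      have m: "emeasure lborel E = ennreal m" "m \<ge> 0"
        using fin by (auto simp: m_def emeasure_eq_ennreal_measure)
      have "ennreal (2 * L * m) = emeasure (interval_measure F) E + emeasure (interval_measure G) E"
        using add[OF _ E] m L by (simp add: ennreal_mult)
      also have "\<dots> \<le> ennreal ((L + a) * m) + ennreal ((L - b) * m)"
        using 1 2 nn m by (intro add_mono) (auto simp: ennreal_mult max_def split: if_splits)
      also have "\<dots> = ennreal ((L + a) * m + (L - b) * m)"
        using nn m by (intro ennreal_plus[symmetric]) auto
      finally have "2 * L * m \<le> (L + a) * m + (L - b) * m"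
        using nn m by (subst (asm) ennreal_le_iff) auto
      then have "(b - a) * m \<le> 0" by (simp add: algebra_simps)
      then have "m = 0" using ab m(2) by (simp add: mult_le_0_iff)
      then show ?thesis using m by simp
    qed simp
    then show ?thesis using E by (auto simp: E_def)
  qed
  have "?E = (\<Union>n. ?E \<inter> {-real n<..<real n})"
  proof -
    have "\<exists>n. - real n < x \<and> x < real n" for x
      using reals_Archimedean2[of "\<bar>x\<bar>"] by (metis abs_less_iff minus_less_iff)
    then show ?thesis by auto
  qed
  also have "\<dots> \<in> null_sets lborel" using null by (intro null_sets_UN) auto
  finally show ?thesis .
qed

text \<open>Outside the set every short interval straddling \<open>x\<close> has slope at least
  \<open>a\<close>. Letting one end tend to \<open>x\<close>, by continuity of \<open>f\<close>,
  leaves the quotient on either side of \<open>x\<close>.\<close>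

lemma eventually_slope_ge:
  fixes f :: "'a::real_normed_vector \<Rightarrow> real"
  assumes f: "continuous_on UNIV f" and x: "x \<notin> small_slope_set f v a"
  shows "\<forall>\<^sub>F h in at 0. a \<le> (f (x + h *\<^sub>R v) - f x) / h"
proof -
  obtain d where d: "d > 0"
    "\<And>s t. s < 0 \<Longrightarrow> 0 < t \<Longrightarrow> t - s < d \<Longrightarrow> a * (t - s) \<le> f (x + t *\<^sub>R v) - f (x + s *\<^sub>R v)"
    using x unfolding small_slope_set_iff by (meson not_le)
  have cont: "((\<lambda>s. f (x + s *\<^sub>R v)) \<longlongrightarrow> f x) (at 0 within A)" for A
  proof -
    have "isCont (\<lambda>s. f (x + s *\<^sub>R v)) 0"
      by (intro continuous_on_interior[of UNIV] continuous_on_compose2[OF f] continuous_intros) auto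
    then show ?thesis by (auto simp: isCont_def intro: tendsto_within_subset)
  qed
  have "a \<le> (f (x + h *\<^sub>R v) - f x) / h" if h: "h \<noteq> 0" "dist h 0 < d / 2" for h
  proof (cases "h > 0")
    case True
    have "a * (h - 0) \<le> f (x + h *\<^sub>R v) - f x"
    proof (rule tendsto_le[of "at_left (0::real)"])
      show "((\<lambda>s. f (x + h *\<^sub>R v) - f (x + s *\<^sub>R v)) \<longlongrightarrow> f (x + h *\<^sub>R v) - f x) (at_left 0)"
        by (intro tendsto_intros cont)
      show "((\<lambda>s. a * (h - s)) \<longlongrightarrow> a * (h - 0)) (at_left 0)"
        by (intro tendsto_intros)
      have "\<forall>\<^sub>F s in at_left 0. s \<in> {- d / 2<..<0}"
        using d by (intro eventually_at_left_real) auto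
      then show "\<forall>\<^sub>F s in at_left 0. a * (h - s) \<le> f (x + h *\<^sub>R v) - f (x + s *\<^sub>R v)"
        by eventually_elim (use d h True in auto)
    qed auto
    with True show ?thesis by (simp add: field_simps)
  next
    case False
    have "a * (0 - h) \<le> f x - f (x + h *\<^sub>R v)"
    proof (rule tendsto_le[of "at_right (0::real)"])
      show "((\<lambda>s. f (x + s *\<^sub>R v) - f (x + h *\<^sub>R v)) \<longlongrightarrow> f x - f (x + h *\<^sub>R v)) (at_right 0)"
        by (intro tendsto_intros cont)
      show "((\<lambda>s. a * (s - h)) \<longlongrightarrow> a * (0 - h)) (at_right 0)"
        by (intro tendsto_intros)
      have "\<forall>\<^sub>F s in at_right 0. s \<in> {0<..<d / 2}"
        using d by (intro eventually_at_right_real) auto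
      then show "\<forall>\<^sub>F s in at_right 0. a * (s - h) \<le> f (x + s *\<^sub>R v) - f (x + h *\<^sub>R v)"
        by eventually_elim (use d h False in auto)
    qed auto
    with False h show ?thesis by (simp add: field_simps)
  qed
  then show ?thesis
    unfolding eventually_at using d by (intro exI[of _ "d/2"]) auto
qed

text \<open>The derivative is the supremum of the set \<open>A\<close> of rationals that bound all
  sufficiently short straddling slopes from below. Quotients eventually exceed anything below
  \<open>Sup A\<close>. For rationals \<open>a < b\<close> between \<open>Sup A\<close> and
  \<open>y\<close>, the number \<open>a\<close> is not in \<open>A\<close>, so the hypothesis
  excludes arbitrarily short slopes above \<open>b\<close>, and quotients are eventually at most
  \<open>b\<close>.\<close>

lemma slope_convergent:
  fixes f :: "'a::real_normed_vector \<Rightarrow> real"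
  assumes f: "L-lipschitz_on UNIV f"
    and x: "\<And>a b. a \<in> \<rat> \<Longrightarrow> b \<in> \<rat> \<Longrightarrow> a < b \<Longrightarrow>
      x \<notin> small_slope_set f v a \<inter> small_slope_set (\<lambda>x. - f x) v (- b)"
  shows "\<exists>D. ((\<lambda>h. (f (x + h *\<^sub>R v) - f x) / h) \<longlongrightarrow> D) (at 0)"
proof -
  have cont: "continuous_on UNIV f" using f lipschitz_on_continuous_on by blast
  have cont': "continuous_on UNIV (\<lambda>x. - f x)" using cont by (intro continuous_intros)
  define K where "K = L * norm v"
  have K: "\<bar>f (x + t *\<^sub>R v) - f (x + s *\<^sub>R v)\<bar> \<le> K * \<bar>t - s\<bar>" for s t
    using lipschitz_onD[OF f, of "x + t *\<^sub>R v" "x + s *\<^sub>R v"]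
    by (simp add: dist_real_def dist_norm K_def scaleR_diff_left[symmetric] mult_ac del: scaleR_diff_left)
  define A where "A = {a \<in> \<rat>. x \<notin> small_slope_set f v a}"
  have lowA: "a \<in> A" if "a \<in> \<rat>" "a < - K" for a
  proof -
    have "a * (t - s) \<le> f (x + t *\<^sub>R v) - f (x + s *\<^sub>R v)" if "s < 0" "0 < t" for s t
    proof -
      have "a * (t - s) \<le> - K * (t - s)" using that \<open>a < - K\<close> by (intro mult_right_mono) auto
      also have "\<dots> \<le> f (x + t *\<^sub>R v) - f (x + s *\<^sub>R v)" using K[of t s] that by auto
      finally show ?thesis .
    qed
    then have "x \<notin> small_slope_set f v a"
      unfolding small_slope_set_iff by (meson not_le zero_less_one)
    with that show ?thesis by (simp add: A_def)
  qed
  have upA: "a \<le> K" if "a \<in> A" for a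
  proof (rule ccontr)
    assume "\<not> a \<le> K"
    have "\<exists>s t. s < 0 \<and> 0 < t \<and> t - s < d \<and> f (x + t *\<^sub>R v) - f (x + s *\<^sub>R v) < a * (t - s)" if "d > 0" for d
    proof (intro exI conjI)
      show "f (x + (d/4) *\<^sub>R v) - f (x + (-d/4) *\<^sub>R v) < a * (d/4 - (-d/4))"
      proof -
        have "f (x + (d/4) *\<^sub>R v) - f (x + (-d/4) *\<^sub>R v) \<le> K * (d/4 - (-d/4))"
          using K[of "d/4" "-d/4"] that by (simp only: abs_le_iff) auto
        also have "\<dots> < a * (d/4 - (-d/4))"
          using \<open>\<not> a \<le> K\<close> that by (intro mult_strict_right_mono) auto
        finally show ?thesis .
      qed
    qed (use that in auto)
    then have "x \<in> small_slope_set f v a" by (simp add: small_slope_set_iff)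
    with that show False by (simp add: A_def)
  qed
  obtain a0 :: real where "a0 \<in> \<rat>" "a0 < - K"
    using Rats_no_bot_less by blast
  then have Ane: "A \<noteq> {}" using lowA by blast
  have bdd: "bdd_above A" using upA by (meson bdd_above.I)
  have "((\<lambda>h. (f (x + h *\<^sub>R v) - f x) / h) \<longlongrightarrow> Sup A) (at 0)"
  proof (rule order_tendstoI)
    fix y assume "y < Sup A"
    then obtain a where a: "a \<in> A" "y < a" using less_cSup_iff[OF Ane bdd] by blast
    have "\<forall>\<^sub>F h in at 0. a \<le> (f (x + h *\<^sub>R v) - f x) / h"
      using a cont by (intro eventually_slope_ge) (auto simp: A_def)
    then show "\<forall>\<^sub>F h in at 0. y < (f (x + h *\<^sub>R v) - f x) / h"
      by eventually_elim (use a in auto)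
  next
    fix y assume "Sup A < y"
    then obtain a where a: "a \<in> \<rat>" "Sup A < a" "a < y" using Rats_dense_in_real by blast
    obtain b where b: "b \<in> \<rat>" "a < b" "b < y" using a Rats_dense_in_real by blast
    have "a \<notin> A" using a(2) bdd by (meson cSup_upper not_le)
    then have "x \<notin> small_slope_set (\<lambda>x. - f x) v (- b)"
      using x[OF a(1) b(1,2)] a(1) by (auto simp: A_def)
    then have "\<forall>\<^sub>F h in at 0. - b \<le> (- f (x + h *\<^sub>R v) - - f x) / h"
      by (intro eventually_slope_ge cont')
    then show "\<forall>\<^sub>F h in at 0. (f (x + h *\<^sub>R v) - f x) / h < y"
      by eventually_elim (use b in \<open>auto simp: diff_divide_distrib\<close>)
  qed
  then show ?thesis ..
qed

text \<open>Tonelli for a shear: averaging the measures of the translates of \<open>N\<close> along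
  \<open>v\<close> over the unit interval gives the measure of \<open>N\<close>, and after
  exchanging the integrals the inner one vanishes. This avoids coordinates adapted to
  \<open>v\<close>.\<close>

lemma null_sets_along_lines:
  fixes N :: "'a::euclidean_space set"
  assumes N: "N \<in> sets borel" and lines: "\<And>x. {s. x + s *\<^sub>R v \<in> N} \<in> null_sets lborel"
  shows "N \<in> null_sets lborel"
proof -
  note [measurable] = N
  have shift: "(\<integral>\<^sup>+y. indicator N (y + s *\<^sub>R v) \<partial>lborel) = emeasure lborel N" for s
  proof -
    have "(\<integral>\<^sup>+y. indicator N y \<partial>lborel) = (\<integral>\<^sup>+y. indicator N (s *\<^sub>R v + y) \<partial>lborel)"
      by (subst lborel_distr_plus[of "s *\<^sub>R v", symmetric], subst nn_integral_distr) simp_all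
    then show ?thesis by (simp add: add.commute)
  qed
  have "emeasure lborel N = (\<integral>\<^sup>+s. indicator {0..1::real} s * emeasure lborel N \<partial>lborel)"
    by (simp add: nn_integral_multc)
  also have "\<dots> = (\<integral>\<^sup>+s. (\<integral>\<^sup>+y. indicator {0..1} s * indicator N (y + s *\<^sub>R v) \<partial>lborel) \<partial>lborel)"
    by (simp add: shift nn_integral_cmult)
  also have "\<dots> = (\<integral>\<^sup>+y. (\<integral>\<^sup>+s. indicator {0..1} s * indicator N (y + s *\<^sub>R v) \<partial>lborel) \<partial>lborel)"
    by (rule lborel_pair.Fubini') measurable
  also have "\<dots> = (\<integral>\<^sup>+y. 0 \<partial>(lborel :: 'a measure))"
  proof (rule nn_integral_cong)
    fix y :: 'a
    have "AE s in lborel. s \<notin> {s. y + s *\<^sub>R v \<in> N}" using lines by (rule AE_not_in)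
    then have "(\<integral>\<^sup>+s. indicator {0..1} s * indicator N (y + s *\<^sub>R v) \<partial>lborel) = (\<integral>\<^sup>+s. 0 \<partial>(lborel :: real measure))"
      by (intro nn_integral_cong_AE) (auto elim!: eventually_mono)
    then show "(\<integral>\<^sup>+s. indicator {0..1} s * indicator N (y + s *\<^sub>R v) \<partial>lborel) = 0" by simp
  qed
  finally show ?thesis using N by auto
qed

section \<open>Directional derivatives and their linearity in the direction\<close>

text \<open>The limit runs along \<open>1 / (real n + 1)\<close> only, so that
  \<open>dir_deriv\<close> is Borel for every Borel \<open>f\<close>; it agrees with the two-sided
  limit wherever that exists.\<close>

definition dir_deriv :: "('a::real_normed_vector \<Rightarrow> real) \<Rightarrow> 'a \<Rightarrow> 'a \<Rightarrow> real" where
  "dir_deriv f v x = lim (\<lambda>n. (f (x + (1 / (real n + 1)) *\<^sub>R v) - f x) * (real n + 1))"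

lemma tendsto_harmonic: "(\<lambda>n. 1 / (real n + 1)) \<longlonglongrightarrow> 0"
  using LIMSEQ_inverse_real_of_nat by (simp add: inverse_eq_divide add.commute)

lemma dir_deriv_tendsto:
  assumes "((\<lambda>h. (f (x + h *\<^sub>R v) - f x) / h) \<longlongrightarrow> D) (at 0)"
  shows "(\<lambda>n. (f (x + (1 / (real n + 1)) *\<^sub>R v) - f x) * (real n + 1)) \<longlonglongrightarrow> D"
    and "dir_deriv f v x = D"
proof -
  have "filterlim (\<lambda>n. 1 / (real n + 1)) (at 0) sequentially"
    using tendsto_harmonic by (auto simp: filterlim_at)
  from filterlim_compose[OF assms this]
  show *: "(\<lambda>n. (f (x + (1 / (real n + 1)) *\<^sub>R v) - f x) * (real n + 1)) \<longlonglongrightarrow> D"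
    by simp
  then show "dir_deriv f v x = D" unfolding dir_deriv_def by (rule limI)
qed

lemma borel_dir_deriv [measurable]:
  fixes f :: "'a::euclidean_space \<Rightarrow> real"
  assumes [measurable]: "f \<in> borel_measurable borel"
  shows "dir_deriv f v \<in> borel_measurable borel"
  unfolding dir_deriv_def by measurable

lemma AE_dir_deriv:
  fixes f :: "'a::euclidean_space \<Rightarrow> real"
  assumes f: "L-lipschitz_on UNIV f"
  shows "AE x in lborel. ((\<lambda>h. (f (x + h *\<^sub>R v) - f x) / h) \<longlongrightarrow> dir_deriv f v x) (at 0)"
proof -
  have cont: "continuous_on UNIV f" using f lipschitz_on_continuous_on by blast
  have cont': "continuous_on UNIV (\<lambda>x. - f x)" using cont by (intro continuous_intros)
  have L: "L \<ge> 0" using f lipschitz_on_nonneg by blast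
  define N where "N = (\<lambda>(a, b). small_slope_set f v a \<inter> small_slope_set (\<lambda>x. - f x) v (- b))"
  have null: "N (a, b) \<in> null_sets lborel" if "a < b" for a b
  proof (rule null_sets_along_lines)
    show "N (a, b) \<in> sets borel"
      unfolding N_def using borel_small_slope_set[OF cont] borel_small_slope_set[OF cont'] by auto
    fix x :: 'a
    have lip: "(L * norm v)-lipschitz_on UNIV (\<lambda>s. f (x + s *\<^sub>R v))"
    proof (rule lipschitz_onI)
      fix s t :: real
      show "dist (f (x + s *\<^sub>R v)) (f (x + t *\<^sub>R v)) \<le> L * norm v * dist s t"
        using lipschitz_onD[OF f, of "x + s *\<^sub>R v" "x + t *\<^sub>R v"]
        by (simp add: dist_real_def dist_norm scaleR_diff_left[symmetric] mult_ac del: scaleR_diff_left)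
    qed (use L in auto)
    have "{s. x + s *\<^sub>R v \<in> N (a, b)} = small_slope_set (\<lambda>s. f (x + s *\<^sub>R v)) 1 a \<inter>
      small_slope_set (\<lambda>s. - f (x + s *\<^sub>R v)) 1 (- b)"
      unfolding N_def by (auto simp: small_slope_set_iff scaleR_add_left add.assoc)
    then show "{s. x + s *\<^sub>R v \<in> N (a, b)} \<in> null_sets lborel"
      using lipschitz_null_slopes[OF lip that] by simp
  qed
  define Q where "Q = {(a, b). a \<in> \<rat> \<and> b \<in> \<rat> \<and> a < (b::real)}"
  have "countable Q"
    by (rule countable_subset[of _ "\<rat> \<times> \<rat>"]) (auto simp: Q_def countable_rat)
  then have "(\<Union>p\<in>Q. N p) \<in> null_sets lborel"
    using null by (intro null_sets_UN') (auto simp: Q_def)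
  then have "AE x in lborel. x \<notin> (\<Union>p\<in>Q. N p)" by (rule AE_not_in)
  then show ?thesis
  proof eventually_elim
    case (elim x)
    then have "\<exists>D. ((\<lambda>h. (f (x + h *\<^sub>R v) - f x) / h) \<longlongrightarrow> D) (at 0)"
      by (intro slope_convergent[OF f]) (auto simp: Q_def N_def)
    then show ?case using dir_deriv_tendsto(2) by metis
  qed
qed

text \<open>Adding \<open>K\<close> makes both functions nonnegative, hence densities of measures.
  Boxes generate the Borel sets and are closed under intersection, so equal box integrals give equal
  measures, and densities are unique almost everywhere.\<close>

lemma AE_eq_box_integrals:
  fixes g1 g2 :: "'a::euclidean_space \<Rightarrow> real"
  assumes [measurable]: "g1 \<in> borel_measurable borel" "g2 \<in> borel_measurable borel"
    and bd: "\<And>x. \<bar>g1 x\<bar> \<le> K" "\<And>x. \<bar>g2 x\<bar> \<le> K"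
    and eq: "\<And>a b. (\<integral>x. indicator (box a b) x * g1 x \<partial>lborel) = (\<integral>x. indicator (box a b) x * g2 x \<partial>lborel)"
  shows "AE x in lborel. g1 x = g2 x"
proof -
  define D where "D g = density lborel (\<lambda>x. ennreal (g x + K))" for g :: "'a \<Rightarrow> real"
  have intb: "integrable lborel (\<lambda>x. indicator (box a b) x * c)" for a b :: 'a and c :: real
    by (intro integrable_mult_left integrable_real_indicator emeasure_lborel_box_finite) auto
  have ii: "integrable lborel (\<lambda>x. indicator (box a b) x * g x)"
    if [measurable]: "g \<in> borel_measurable borel" and "\<And>x. \<bar>g x\<bar> \<le> K" for g and a b :: 'a
    by (rule Bochner_Integration.integrable_bound[OF intb[of a b K]])
       (use that(2)[THEN order_trans, OF abs_ge_self] in \<open>auto simp: indicator_def intro!: AE_I2\<close>)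
  have ebox: "emeasure (D g) (box a b) = ennreal ((\<integral>x. indicator (box a b) x * g x \<partial>lborel) + (\<integral>x. indicator (box a b) x * K \<partial>lborel))"
    if [measurable]: "g \<in> borel_measurable borel" and b: "\<And>x. \<bar>g x\<bar> \<le> K" for g and a b :: 'a
  proof -
    have nn: "0 \<le> g x + K" for x using b[of x] by simp
    have "emeasure (D g) (box a b) = (\<integral>\<^sup>+x. ennreal (indicator (box a b) x * g x + indicator (box a b) x * K) \<partial>lborel)"
      unfolding D_def by (subst emeasure_density) (auto intro!: nn_integral_cong simp: indicator_def)
    also have "\<dots> = ennreal (\<integral>x. indicator (box a b) x * g x + indicator (box a b) x * K \<partial>lborel)"
      using ii[OF that] intb nn by (intro nn_integral_eq_integral) (auto simp: indicator_def)
    finally show ?thesis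
      using ii[OF that] intb by (simp add: Bochner_Integration.integral_add)
  qed
  have "D g1 = D g2"
  proof (rule measure_eqI_generator_eq[where E="range (\<lambda>(a, b). box a b)" and \<Omega>=UNIV
        and A="\<lambda>n. box (- (real n *\<^sub>R One)) (real n *\<^sub>R One)"])
    show "Int_stable (range (\<lambda>(a, b). box a b :: 'a set))"
      by (force simp: Int_stable_def box_Int_box)
    show "\<And>X. X \<in> range (\<lambda>(a, b). box a b) \<Longrightarrow> emeasure (D g1) X = emeasure (D g2) X"
      using bd by (auto simp: ebox eq)
    show "(\<Union>i::nat. box (- (real i *\<^sub>R One)) (real i *\<^sub>R One :: 'a)) = UNIV"
      by (rule UN_box_eq_UNIV)
    show "emeasure (D g1) (box (- (real i *\<^sub>R One)) (real i *\<^sub>R One)) \<noteq> \<infinity>" for i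
      using bd by (simp add: ebox)
  qed (auto simp: D_def borel_eq_box)
  then have "AE x in lborel. ennreal (g1 x + K) = ennreal (g2 x + K)"
    unfolding D_def by (intro sigma_finite_measure.density_unique_iff[OF sigma_finite_lborel, THEN iffD1]) auto
  then show ?thesis
  proof eventually_elim
    case (elim x)
    then show ?case using bd[of x] by (subst (asm) ennreal_inj) auto
  qed
qed

lemma lborel_integral_shift:
  fixes f :: "'a::euclidean_space \<Rightarrow> 'b::{banach, second_countable_topology}"
  assumes [measurable]: "f \<in> borel_measurable borel"
  shows "(\<integral>x. f (x + c) \<partial>lborel) = (\<integral>x. f x \<partial>lborel)"
proof -
  have "(\<integral>x. f x \<partial>lborel) = (\<integral>x. f x \<partial>distr lborel borel ((+) c))"
    by (simp add: lborel_distr_plus)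
  also have "\<dots> = (\<integral>x. f (c + x) \<partial>lborel)"
    by (rule integral_distr) auto
  finally show ?thesis by (simp add: add.commute)
qed

lemma slope_bound:
  assumes f: "L-lipschitz_on UNIV f"
  shows "\<bar>(f (x + (1 / (real n + 1)) *\<^sub>R v) - f x) * (real n + 1)\<bar> \<le> L * norm (v::'a::real_normed_vector)"
proof -
  have "\<bar>f (x + (1 / (real n + 1)) *\<^sub>R v) - f x\<bar> \<le> L * (norm v / (real n + 1))"
    using lipschitz_onD[OF f, of "x + (1 / (real n + 1)) *\<^sub>R v" x]
    by (simp add: dist_real_def dist_norm)
  then have "\<bar>f (x + (1 / (real n + 1)) *\<^sub>R v) - f x\<bar> * (real n + 1) \<le> L * (norm v / (real n + 1)) * (real n + 1)"
    by (intro mult_right_mono) auto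
  then show ?thesis
    by (simp add: abs_mult)
qed

lemma dir_deriv_bound:
  fixes f :: "'a::real_normed_vector \<Rightarrow> real"
  assumes f: "L-lipschitz_on UNIV f"
    and x: "((\<lambda>h. (f (x + h *\<^sub>R v) - f x) / h) \<longlongrightarrow> dir_deriv f v x) (at 0)"
  shows "\<bar>dir_deriv f v x\<bar> \<le> L * norm v"
proof (rule tendsto_upperbound)
  show "(\<lambda>n. \<bar>(f (x + (1 / (real n + 1)) *\<^sub>R v) - f x) * (real n + 1)\<bar>) \<longlonglongrightarrow> \<bar>dir_deriv f v x\<bar>"
    by (intro tendsto_intros dir_deriv_tendsto(1)[OF x])
qed (use slope_bound[OF f] in auto)

text \<open>The difference quotient along \<open>v + w\<close> is one along \<open>v\<close> plus one along \<open>w\<close> at a shifted point;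
  integrated over a box, the shift disappears in the limit.\<close>

lemma dir_deriv_add_AE:
  fixes f :: "'a::euclidean_space \<Rightarrow> real"
  assumes f: "L-lipschitz_on UNIV f"
  shows "AE x in lborel. dir_deriv f (v + w) x = dir_deriv f v x + dir_deriv f w x"
proof -
  have cont: "continuous_on UNIV f" using f lipschitz_on_continuous_on by blast
  then have [measurable]: "f \<in> borel_measurable borel" by (rule borel_measurable_continuous_onI)
  have L: "L \<ge> 0" using f lipschitz_on_nonneg by blast
  define q where "q v n x = (f (x + (1 / (real n + 1)) *\<^sub>R v) - f x) * (real n + 1)" for v n x
  have [measurable]: "q v n \<in> borel_measurable borel" for v n unfolding q_def by measurable
  have qb: "\<bar>q v n x\<bar> \<le> L * norm v" for v n x using slope_bound[OF f] by (simp add: q_def)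
  have qlim: "AE x in lborel. (\<lambda>n. q v n x) \<longlonglongrightarrow> dir_deriv f v x" for v
    using AE_dir_deriv[OF f, of v] unfolding q_def by eventually_elim (rule dir_deriv_tendsto(1))
  \<comment> \<open>\<open>dir_deriv\<close> has unspecified values on an exceptional null set.
    Truncation at the Lipschitz bound gives a Borel function that is bounded everywhere and
    unchanged almost everywhere.\<close>
  define D where "D v x = max (- (L * norm v)) (min (L * norm v) (dir_deriv f v x))" for v x
  have [measurable]: "D v \<in> borel_measurable borel" for v unfolding D_def by measurable
  have Db: "\<bar>D v x\<bar> \<le> L * norm v" for v x
    using mult_nonneg_nonneg[OF L norm_ge_zero[of v]] by (auto simp: D_def abs_le_iff)
  have D: "AE x in lborel. dir_deriv f v x = D v x" for v
    using AE_dir_deriv[OF f, of v]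
  proof eventually_elim
    case (elim x)
    from dir_deriv_bound[OF f elim] show ?case by (simp add: D_def abs_le_iff)
  qed
  have Dlim: "AE x in lborel. (\<lambda>n. q v n x) \<longlonglongrightarrow> D v x" for v
    using qlim[of v] D[of v] by eventually_elim auto
  define C where "C = L * norm v + L * norm w + L * norm (v + w)"
  have C: "L * norm v + L * norm w \<le> C" "L * norm v \<le> C" "L * norm w \<le> C" "L * norm (v + w) \<le> C" "C \<ge> 0"
    using L by (auto simp: C_def)
  have "AE x in lborel. D (v + w) x = D v x + D w x"
  proof (rule AE_eq_box_integrals[where K=C])
    show "\<bar>D (v + w) x\<bar> \<le> C" for x using Db[of "v+w" x] C by linarith
    show "\<bar>D v x + D w x\<bar> \<le> C" for x using Db[of v x] Db[of w x] C by linarith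
    fix a b :: 'a
    let ?B = "\<lambda>x. indicator (box a b) x :: real"
    have intB: "integrable lborel (\<lambda>x. C * indicator A x)" if "bounded A" "A \<in> sets borel" for A :: "'a set"
      using that by (intro integrable_mult_right integrable_real_indicator emeasure_bounded_finite) auto
    have lim1: "(\<lambda>n. \<integral>x. ?B x * q u n x \<partial>lborel) \<longlonglongrightarrow> (\<integral>x. ?B x * D u x \<partial>lborel)" if u: "L * norm u \<le> C" for u
    proof (rule integral_dominated_convergence[OF _ _ intB[of "box a b"]])
      show "AE x in lborel. (\<lambda>n. ?B x * q u n x) \<longlonglongrightarrow> ?B x * D u x"
        using Dlim[of u] by eventually_elim (intro tendsto_intros)
      show "AE x in lborel. norm (?B x * q u n x) \<le> C * ?B x" for n
        using qb[of u n] u by (intro AE_I2) (auto simp: indicator_def intro: order_trans)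
    qed (auto simp: bounded_box)
    obtain R0 where R0: "\<forall>x\<in>box a b. norm x \<le> R0"
      using bounded_box[of a b] unfolding bounded_iff by blast
    \<comment> \<open>The translated box stays in the ball of this radius, since the shift has
      length at most \<open>norm v\<close>.\<close>
    define R where "R = norm v + R0"
    have R: "y + x \<in> cball 0 R" if "norm y \<le> norm v" "x \<in> box a b" for x y
    proof -
      have "norm x \<le> R0" using R0 that(2) by blast
      then show ?thesis using norm_triangle_ineq[of y x] that(1) by (simp add: R_def)
    qed
    have lim2: "(\<lambda>n. \<integral>x. ?B (x - (1 / (real n + 1)) *\<^sub>R v) * q w n x \<partial>lborel) \<longlonglongrightarrow> (\<integral>x. ?B x * D w x \<partial>lborel)"
    proof (rule integral_dominated_convergence[OF _ _ intB[of "cball 0 R"]])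
      \<comment> \<open>Away from the frontier of the box its indicator is locally constant, so
        evaluating it at the shifted points makes no difference in the limit.\<close>
      have "frontier (box a b) \<in> null_sets lborel"
        using negligible_convex_frontier[of "box a b"]
        by (auto simp: negligible_iff_null_sets null_sets_completion_iff)
      then have "AE x in lborel. x \<notin> frontier (box a b)" by (rule AE_not_in)
      with Dlim[of w] show "AE x in lborel. (\<lambda>n. ?B (x - (1 / (real n + 1)) *\<^sub>R v) * q w n x) \<longlonglongrightarrow> ?B x * D w x"
      proof eventually_elim
        case (elim x)
        have "(\<lambda>n. x - (1 / (real n + 1)) *\<^sub>R v) \<longlonglongrightarrow> x - 0 *\<^sub>R v"
          by (intro tendsto_intros tendsto_harmonic)
        then have t: "(\<lambda>n. x - (1 / (real n + 1)) *\<^sub>R v) \<longlonglongrightarrow> x" by simp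
        have "isCont ?B x" using elim isCont_indicator by blast
        then have "(\<lambda>n. ?B (x - (1 / (real n + 1)) *\<^sub>R v)) \<longlonglongrightarrow> ?B x"
          using t by (rule isCont_tendsto_compose)
        with elim show ?case by (intro tendsto_intros)
      qed
      show "AE x in lborel. norm (?B (x - (1 / (real n + 1)) *\<^sub>R v) * q w n x) \<le> C * indicator (cball 0 R) x" for n
      proof (intro AE_I2)
        fix x
        have "x \<in> cball 0 R" if "x - (1 / (real n + 1)) *\<^sub>R v \<in> box a b"
        proof -
          have "norm ((1 / (real n + 1)) *\<^sub>R v) \<le> norm v" by (simp add: divide_le_eq mult_le_cancel_left1)
          then have "(1 / (real n + 1)) *\<^sub>R v + (x - (1 / (real n + 1)) *\<^sub>R v) \<in> cball 0 R"
            using that by (intro R)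
          then show ?thesis by simp
        qed
        then show "norm (?B (x - (1 / (real n + 1)) *\<^sub>R v) * q w n x) \<le> C * indicator (cball 0 R) x"
          using qb[of w n x] C by (auto simp: indicator_def split: if_splits)
      qed
    qed auto
    have int1: "integrable lborel (\<lambda>x. ?B x * g x)" if "g \<in> borel_measurable borel" "\<And>x. \<bar>g x\<bar> \<le> C" for g
      using that that(2)[THEN order_trans, OF abs_ge_self]
      by (intro Bochner_Integration.integrable_bound[OF intB[of "box a b"]])
        (auto simp: indicator_def bounded_box)
    \<comment> \<open>Translation invariance moves the shift from the quotient along
      \<open>w\<close> to the indicator of the box.\<close>
    have eq: "(\<integral>x. ?B x * q (v + w) n x \<partial>lborel) =
        (\<integral>x. ?B x * q v n x \<partial>lborel) + (\<integral>x. ?B (x - (1 / (real n + 1)) *\<^sub>R v) * q w n x \<partial>lborel)" for n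
    proof -
      define h where "h = 1 / (real n + 1)"
      have "(\<integral>x. ?B (x - h *\<^sub>R v) * q w n x \<partial>lborel) = (\<integral>x. ?B (x + h *\<^sub>R v - h *\<^sub>R v) * q w n (x + h *\<^sub>R v) \<partial>lborel)"
        by (rule lborel_integral_shift[symmetric]) simp
      also have "\<dots> = (\<integral>x. ?B x * q w n (x + h *\<^sub>R v) \<partial>lborel)" by simp
      finally have "(\<integral>x. ?B x * q v n x \<partial>lborel) + (\<integral>x. ?B (x - h *\<^sub>R v) * q w n x \<partial>lborel)
         = (\<integral>x. ?B x * q v n x + ?B x * q w n (x + h *\<^sub>R v) \<partial>lborel)"
        using qb C by (subst Bochner_Integration.integral_add) (auto intro!: int1 intro: order_trans)
      also have "\<dots> = (\<integral>x. ?B x * q (v + w) n x \<partial>lborel)"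
        by (intro Bochner_Integration.integral_cong) (auto simp: q_def h_def algebra_simps)
      finally show ?thesis by (simp add: h_def)
    qed
    have "(\<integral>x. ?B x * D (v + w) x \<partial>lborel) = (\<integral>x. ?B x * D v x \<partial>lborel) + (\<integral>x. ?B x * D w x \<partial>lborel)"
      by (rule LIMSEQ_unique[OF lim1[OF C(4), unfolded eq] tendsto_add[OF lim1[OF C(2)] lim2]])
    also have "\<dots> = (\<integral>x. ?B x * D v x + ?B x * D w x \<partial>lborel)"
      using Db C by (subst Bochner_Integration.integral_add) (auto intro!: int1 intro: order_trans)
    finally show "(\<integral>x. ?B x * D (v + w) x \<partial>lborel) = (\<integral>x. ?B x * (D v x + D w x) \<partial>lborel)"
      by (simp add: distrib_left)
  qed auto
  with D[of v] D[of w] D[of "v + w"] show ?thesis by eventually_elim auto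
qed

lemma dir_deriv_scale:
  fixes f :: "'a::real_vector \<Rightarrow> real"
  assumes x: "((\<lambda>h. (f (x + h *\<^sub>R v) - f x) / h) \<longlongrightarrow> D) (at 0)"
  shows "((\<lambda>h. (f (x + h *\<^sub>R (c *\<^sub>R v)) - f x) / h) \<longlongrightarrow> c * D) (at 0)"
proof (cases "c = 0")
  case False
  have "filterlim (\<lambda>h. h * c) (at 0) (at 0)"
  proof (unfold filterlim_at, intro conjI)
    show "\<forall>\<^sub>F h in at 0. h * c \<in> UNIV \<and> h * c \<noteq> 0"
      using False by (auto simp: eventually_at_filter)
    have "((\<lambda>h. h * c) \<longlongrightarrow> 0 * c) (at 0)" by (intro tendsto_intros)
    then show "((\<lambda>h. h * c) \<longlongrightarrow> 0) (at 0)" by simp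
  qed
  from tendsto_mult_left[OF filterlim_compose[OF x this], of c]
  show ?thesis using False by simp
qed simp

text \<open>Additivity is applied once per basis vector, so that only finitely many exceptional sets
  accumulate for a given \<open>v\<close>.\<close>

lemma dir_deriv_linear_AE:
  fixes f :: "'a::euclidean_space \<Rightarrow> real"
  assumes f: "L-lipschitz_on UNIV f"
  shows "AE x in lborel. dir_deriv f v x = v \<bullet> (\<Sum>b\<in>Basis. dir_deriv f b x *\<^sub>R b)"
proof -
  have "AE x in lborel. dir_deriv f (\<Sum>b\<in>B. (v \<bullet> b) *\<^sub>R b) x = (\<Sum>b\<in>B. (v \<bullet> b) * dir_deriv f b x)"
    if "finite B" for B :: "'a set"
    using that
  proof (induction B)
    case empty
    then show ?case by (simp add: dir_deriv_def)
  next
    case (insert c B)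
    have "AE x in lborel. dir_deriv f ((v \<bullet> c) *\<^sub>R c) x = (v \<bullet> c) * dir_deriv f c x"
      using AE_dir_deriv[OF f, of c] by eventually_elim (intro dir_deriv_tendsto dir_deriv_scale)
    with insert.IH dir_deriv_add_AE[OF f, of "(v \<bullet> c) *\<^sub>R c" "\<Sum>b\<in>B. (v \<bullet> b) *\<^sub>R b"]
    show ?case
      by eventually_elim (use insert.hyps in simp)
  qed
  from this[OF finite_Basis] show ?thesis
    by eventually_elim (simp add: euclidean_representation inner_sum_right mult.commute)
qed

text \<open>The directions of a countable dense set share one exceptional null set. At a remaining
  point compactness of the unit sphere selects finitely many of them close to every unit vector,
  which makes the convergence uniform, and the Lipschitz bound carries it to all other
  directions.\<close>

theorem Rademacher:
  fixes f :: "'a::euclidean_space \<Rightarrow> real"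
  assumes f: "L-lipschitz_on UNIV f"
  shows "AE x in lborel. GDERIV f x :> (\<Sum>b\<in>Basis. dir_deriv f b x *\<^sub>R b)"
proof -
  have L: "L \<ge> 0" using f lipschitz_on_nonneg by blast
  obtain W :: "'a set" where W: "countable W" "\<And>X. open X \<Longrightarrow> X \<noteq> {} \<Longrightarrow> \<exists>d\<in>W. d \<in> X"
    using countable_dense_setE by blast
  let ?G = "\<lambda>x. \<Sum>b\<in>Basis. dir_deriv f b x *\<^sub>R b"
  have "AE x in lborel. ((\<lambda>h. (f (x + h *\<^sub>R w) - f x) / h) \<longlongrightarrow> w \<bullet> ?G x) (at 0)" for w
    using AE_dir_deriv[OF f, of w] dir_deriv_linear_AE[OF f, of w] by eventually_elim simp
  then have "AE x in lborel. \<forall>w\<in>W. ((\<lambda>h. (f (x + h *\<^sub>R w) - f x) / h) \<longlongrightarrow> w \<bullet> ?G x) (at 0)"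
    using W(1) by (simp add: AE_ball_countable)
  then show ?thesis
  proof eventually_elim
    case (elim x)
    define G where "G = ?G x"
    have "\<exists>d>0. \<forall>y. norm (y - x) < d \<longrightarrow> norm (f y - f x - (y - x) \<bullet> G) \<le> e * norm (y - x)" if "e > 0" for e
    proof -
      \<comment> \<open>Replacing the direction \<open>u\<close> by a nearby \<open>w\<close> costs
        \<open>L * e'\<close> in \<open>f\<close> and \<open>norm G * e'\<close> in the linear term,
        and the quotient along \<open>w\<close> costs \<open>e'\<close>; relative to
        \<open>h\<close> these add up to \<open>e\<close>.\<close>
      define e' where "e' = e / (L + 1 + norm G)"
      have pos: "L + 1 + norm G > 0" using L norm_ge_zero[of G] by linarith
      have e': "e' > 0" using that pos by (simp add: e'_def)
      have e'e: "(L + 1 + norm G) * e' = e" using pos by (simp add: e'_def)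
      have "sphere (0::'a) 1 \<subseteq> (\<Union>w\<in>W. ball w e')"
      proof
        fix u :: 'a
        obtain d where "d \<in> W" "d \<in> ball u e'" using W(2)[of "ball u e'"] e' by force
        then show "u \<in> (\<Union>w\<in>W. ball w e')" by (auto simp: dist_commute)
      qed
      then obtain F where F: "F \<subseteq> W" "finite F" "sphere (0::'a) 1 \<subseteq> (\<Union>w\<in>F. ball w e')"
        using compactE_image[OF compact_sphere, of W "\<lambda>w. ball w e'" 0 1] by auto
      have "\<forall>\<^sub>F h in at 0. \<forall>w\<in>F. \<bar>(f (x + h *\<^sub>R w) - f x) / h - w \<bullet> G\<bar> < e'"
      proof (intro eventually_ball_finite[OF F(2)] ballI)
        fix w assume "w \<in> F"
        then have "((\<lambda>h. (f (x + h *\<^sub>R w) - f x) / h) \<longlongrightarrow> w \<bullet> G) (at 0)" using elim F(1) by (auto simp: G_def)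
        from tendstoD[OF this e'] show "\<forall>\<^sub>F h in at 0. \<bar>(f (x + h *\<^sub>R w) - f x) / h - w \<bullet> G\<bar> < e'"
          by (simp add: dist_real_def)
      qed
      then obtain d where d: "d > 0"
        "\<And>h w. h \<noteq> 0 \<Longrightarrow> \<bar>h\<bar> < d \<Longrightarrow> w \<in> F \<Longrightarrow> \<bar>(f (x + h *\<^sub>R w) - f x) / h - w \<bullet> G\<bar> < e'"
        unfolding eventually_at by (auto simp: dist_real_def)
      show ?thesis
      proof (intro exI conjI allI impI)
        fix y assume y: "norm (y - x) < d"
        show "norm (f y - f x - (y - x) \<bullet> G) \<le> e * norm (y - x)"
        proof (cases "y = x")
          case False
          define h where "h = norm (y - x)"
          define u where "u = (y - x) /\<^sub>R h"
          have h: "h > 0" "h < d" using False y by (auto simp: h_def)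
          have u: "norm u = 1" "y = x + h *\<^sub>R u" using h by (auto simp: u_def h_def)
          then have "u \<in> sphere 0 1" by simp
          then have "u \<in> (\<Union>w\<in>F. ball w e')" using F(3) by blast
          then obtain w where w: "w \<in> F" "norm (u - w) < e'"
            by (auto simp: dist_norm norm_minus_commute)
          have "\<bar>(f (x + h *\<^sub>R w) - f x) / h - w \<bullet> G\<bar> < e'" using d(2)[of h w] h w by simp
          then have "\<bar>(f (x + h *\<^sub>R w) - f x) / h - w \<bullet> G\<bar> * h \<le> e' * h"
            using h by (intro mult_right_mono) auto
          also have "\<bar>(f (x + h *\<^sub>R w) - f x) / h - w \<bullet> G\<bar> * h = \<bar>f (x + h *\<^sub>R w) - f x - h * (w \<bullet> G)\<bar>"
          proof -
            have "((f (x + h *\<^sub>R w) - f x) / h - w \<bullet> G) * h = f (x + h *\<^sub>R w) - f x - h * (w \<bullet> G)"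
              using h by (simp add: field_simps)
            then show ?thesis using h by (metis abs_mult abs_of_pos)
          qed
          finally have 1: "\<bar>f (x + h *\<^sub>R w) - f x - h * (w \<bullet> G)\<bar> \<le> e' * h" .
          have "\<bar>f (x + h *\<^sub>R u) - f (x + h *\<^sub>R w)\<bar> \<le> L * (h * norm (u - w))"
            using lipschitz_onD[OF f, of "x + h *\<^sub>R u" "x + h *\<^sub>R w"] h
            by (simp add: dist_real_def dist_norm scaleR_diff_right[symmetric] del: scaleR_diff_right)
          also have "\<dots> \<le> L * (h * e')" using L h w by (intro mult_left_mono) auto
          finally have 2: "\<bar>f (x + h *\<^sub>R u) - f (x + h *\<^sub>R w)\<bar> \<le> L * (h * e')" .
          have "\<bar>h * ((u - w) \<bullet> G)\<bar> \<le> h * (norm (u - w) * norm G)"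
            using h Cauchy_Schwarz_ineq2[of "u - w" G] by (simp add: abs_mult)
          also have "\<dots> \<le> h * (e' * norm G)" using h w by (intro mult_left_mono mult_right_mono) auto
          finally have 3: "\<bar>h * (u \<bullet> G) - h * (w \<bullet> G)\<bar> \<le> h * (e' * norm G)"
            by (simp add: inner_diff_left right_diff_distrib)
          have "\<bar>f y - f x - h * (u \<bullet> G)\<bar> \<le> L * (h * e') + e' * h + h * (e' * norm G)"
            using 1 2 3 unfolding u(2) by linarith
          also have "\<dots> = ((L + 1 + norm G) * e') * h" by (simp add: algebra_simps)
          also have "\<dots> = e * h" by (simp only: e'e)
          finally show ?thesis using u h by simp
        qed simp
      qed (rule d(1))
    qed
    then show ?case
      unfolding gderiv_def has_derivative_at_alt G_def[symmetric]
      by (auto intro: bounded_linear_inner_left)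
  qed
qed

section \<open>Integration along graphs\<close>

lemma GDERIV_unique:
  assumes "GDERIV f x :> D" "GDERIV f x :> D'"
  shows "D = D'"
proof -
  have "(\<lambda>h. h \<bullet> D) = (\<lambda>h. h \<bullet> D')"
    using assms unfolding gderiv_def by (rule has_derivative_unique)
  then have "(D - D') \<bullet> D = (D - D') \<bullet> D'" by metis
  then have "(D - D') \<bullet> (D - D') = 0" by (simp add: inner_diff_right)
  then show ?thesis by simp
qed

lemma gradient_eq: "GDERIV f x :> D \<Longrightarrow> gradient f x = D"
  unfolding gradient_def by (rule the_equality) (auto intro: GDERIV_unique)

lemma GDERIV_directional:
  assumes "GDERIV f x :> D"
  shows "((\<lambda>h. (f (x + h *\<^sub>R v) - f x) / h) \<longlongrightarrow> v \<bullet> D) (at 0)"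
proof -
  have "((\<lambda>h. f (x + h *\<^sub>R v)) has_derivative (\<lambda>h. (h *\<^sub>R v) \<bullet> D)) (at 0)"
  proof (rule has_derivative_compose[where f="\<lambda>h. x + h *\<^sub>R v" and g=f and g'="\<lambda>h. h \<bullet> D"])
    show "((\<lambda>h. x + h *\<^sub>R v) has_derivative (\<lambda>h. h *\<^sub>R v)) (at 0)"
      by (auto intro!: derivative_eq_intros)
  qed (use assms in \<open>simp add: gderiv_def\<close>)
  then have "((\<lambda>h. f (x + h *\<^sub>R v)) has_field_derivative (v \<bullet> D)) (at 0)"
    by (rule has_derivative_imp_has_field_derivative) simp
  then show ?thesis by (simp add: DERIV_def)
qed

lemma GDERIV_eq_sum_dir_deriv:
  fixes f :: "'a::euclidean_space \<Rightarrow> real"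
  assumes "GDERIV f x :> D"
  shows "D = (\<Sum>b\<in>Basis. dir_deriv f b x *\<^sub>R b)"
proof -
  have "dir_deriv f b x = b \<bullet> D" for b
    using GDERIV_directional[OF assms] by (rule dir_deriv_tendsto)
  then show ?thesis using euclidean_representation[of D] by (simp add: inner_commute)
qed

section \<open>Measurability of the gradient\<close>

definition gdiff_set :: "('a::real_inner \<Rightarrow> real) \<Rightarrow> 'a set" where
  "gdiff_set f = {x. GDERIV f x :> gradient f x}"

lemma gdiff_setI: "GDERIV f x :> D \<Longrightarrow> x \<in> gdiff_set f"
  by (simp add: gdiff_set_def gradient_eq)

lemma AE_gdiff_set:
  fixes f :: "'a::euclidean_space \<Rightarrow> real"
  assumes "L-lipschitz_on UNIV f"
  shows "AE x in lborel. x \<in> gdiff_set f"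
  using Rademacher[OF assms] by eventually_elim (rule gdiff_setI)

text \<open>Differentiability becomes a countable condition: the only candidate gradient is the
  Borel function \<open>G\<close>, tolerance and radius run through reciprocals of integers, and the
  increment \<open>w\<close> through a countable dense set. Continuity of \<open>f\<close> extends
  the estimate from dense increments to all.\<close>

lemma borel_gdiff_set:
  fixes f :: "'a::euclidean_space \<Rightarrow> real"
  assumes f: "continuous_on UNIV f"
  shows "gdiff_set f \<in> sets borel"
proof -
  have [measurable]: "f \<in> borel_measurable borel" by (rule borel_measurable_continuous_onI[OF f])
  obtain W :: "'a set" where W: "countable W" "\<And>X. open X \<Longrightarrow> X \<noteq> {} \<Longrightarrow> \<exists>d\<in>W. d \<in> X"
    using countable_dense_setE by blast
  define G where "G x = (\<Sum>b\<in>Basis. dir_deriv f b x *\<^sub>R b)" for x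
  have [measurable]: "G \<in> borel_measurable borel" unfolding G_def by measurable
  define A where "A = {x. \<forall>k::nat. \<exists>j::nat. \<forall>w\<in>W. norm w < 1 / (real j + 1) \<longrightarrow>
      \<bar>f (x + w) - f x - w \<bullet> G x\<bar> \<le> norm w / (real k + 1)}"
  have ex_nat: "\<exists>j::nat. 1 / (real j + 1) < e" if "e > 0" for e :: real
    using nat_approx_posE[OF that] by (metis add.commute of_nat_Suc)
  have "gdiff_set f = A"
  proof (intro set_eqI iffI)
    fix x assume "x \<in> gdiff_set f"
    then have "GDERIV f x :> gradient f x" by (simp add: gdiff_set_def)
    with GDERIV_eq_sum_dir_deriv[OF this] have D: "GDERIV f x :> G x" by (simp add: G_def)
    show "x \<in> A"
      unfolding A_def
    proof (intro CollectI allI)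
      fix k :: nat
      obtain d where d: "d > 0" "\<And>y. norm (y - x) < d \<Longrightarrow> norm (f y - f x - (y - x) \<bullet> G x) \<le> 1 / (real k + 1) * norm (y - x)"
        using D[unfolded gderiv_def has_derivative_at_alt, THEN conjunct2, rule_format, of "1 / (real k + 1)"]
        by auto
      obtain j :: nat where j: "1 / (real j + 1) < d" using ex_nat[OF d(1)] by blast
      have "\<bar>f (x + w) - f x - w \<bullet> G x\<bar> \<le> norm w / (real k + 1)" if "norm w < 1 / (real j + 1)" for w
        using d(2)[of "x + w"] that j by simp
      then show "\<exists>j::nat. \<forall>w\<in>W. norm w < 1 / (real j + 1) \<longrightarrow> \<bar>f (x + w) - f x - w \<bullet> G x\<bar> \<le> norm w / (real k + 1)"
        by blast
    qed
  next
    fix x assume x: "x \<in> A"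
    have "GDERIV f x :> G x"
      unfolding gderiv_def has_derivative_at_alt
    proof (intro conjI allI impI)
      fix e :: real assume "e > 0"
      then obtain k :: nat where k: "1 / (real k + 1) < e" using ex_nat by blast
      obtain j :: nat where j: "\<And>w. w \<in> W \<Longrightarrow> norm w < 1 / (real j + 1) \<Longrightarrow>
          \<bar>f (x + w) - f x - w \<bullet> G x\<bar> \<le> norm w / (real k + 1)"
        using x unfolding A_def by blast
      have j': "\<bar>f (x + w) - f x - w \<bullet> G x\<bar> \<le> norm w / (real k + 1)" if "norm w < 1 / (real j + 1)" for w
      proof (rule ccontr)
        assume w: "\<not> \<bar>f (x + w) - f x - w \<bullet> G x\<bar> \<le> norm w / (real k + 1)"
        have "open {w. norm w < 1 / (real j + 1) \<and> norm w / (real k + 1) < \<bar>f (x + w) - f x - w \<bullet> G x\<bar>}"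
          by (intro open_Collect_conj open_Collect_less continuous_intros continuous_on_compose2[OF f]) auto
        moreover have "w \<in> {w. norm w < 1 / (real j + 1) \<and> norm w / (real k + 1) < \<bar>f (x + w) - f x - w \<bullet> G x\<bar>}"
          using w that by simp
        ultimately obtain d where "d \<in> W" "norm d < 1 / (real j + 1) \<and> norm d / (real k + 1) < \<bar>f (x + d) - f x - d \<bullet> G x\<bar>"
          using W(2)[of "{w. norm w < 1 / (real j + 1) \<and> norm w / (real k + 1) < \<bar>f (x + w) - f x - w \<bullet> G x\<bar>}"] by blast
        with j[of d] show False by simp
      qed
      show "\<exists>d>0. \<forall>y. norm (y - x) < d \<longrightarrow> norm (f y - f x - (y - x) \<bullet> G x) \<le> e * norm (y - x)"
      proof (intro exI[of _ "1 / (real j + 1)"] conjI allI impI)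
        fix y assume "norm (y - x) < 1 / (real j + 1)"
        then have "norm (f y - f x - (y - x) \<bullet> G x) \<le> norm (y - x) / (real k + 1)"
          using j'[of "y - x"] by simp
        also have "\<dots> \<le> e * norm (y - x)"
          using mult_right_mono[OF less_imp_le[OF k] norm_ge_zero[of "y - x"]] by simp
        finally show "norm (f y - f x - (y - x) \<bullet> G x) \<le> e * norm (y - x)" .
      qed auto
    qed (rule bounded_linear_inner_left)
    then show "x \<in> gdiff_set f" by (rule gdiff_setI)
  qed
  moreover have "A = {x \<in> space borel. \<forall>k::nat. \<exists>j::nat. \<forall>w\<in>W. norm w < 1 / (real j + 1) \<longrightarrow>
      \<bar>f (x + w) - f x - w \<bullet> G x\<bar> \<le> norm w / (real k + 1)}"
    by (simp add: A_def)
  moreover have "\<dots> \<in> sets borel"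
    using W(1) by measurable
  ultimately show ?thesis by simp
qed

lemma borel_measurable_gradient:
  fixes f :: "'a::euclidean_space \<Rightarrow> real"
  assumes f: "continuous_on UNIV f"
  shows "gradient f \<in> borel_measurable borel"
proof -
  have [measurable]: "f \<in> borel_measurable borel" by (rule borel_measurable_continuous_onI[OF f])
  note [measurable] = borel_gdiff_set[OF f]
  \<comment> \<open>At points of non-differentiability the description has no witness and equals the
    same constant everywhere.\<close>
  have "gradient f = (\<lambda>x. if x \<in> gdiff_set f then (\<Sum>b\<in>Basis. dir_deriv f b x *\<^sub>R b) else (THE D. False))"
  proof
    fix x
    show "gradient f x = (if x \<in> gdiff_set f then (\<Sum>b\<in>Basis. dir_deriv f b x *\<^sub>R b) else (THE D. False))"
    proof (cases "x \<in> gdiff_set f")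
      case True
      then show ?thesis using GDERIV_eq_sum_dir_deriv[of f x "gradient f x"] by (simp add: gdiff_set_def)
    next
      case False
      then have "\<not> GDERIV f x :> D" for D using gdiff_setI by blast
      with False show ?thesis by (simp add: gradient_def)
    qed
  qed
  also have "\<dots> \<in> borel_measurable borel" by measurable
  finally show ?thesis .
qed

lemma GDERIV_translate:
  assumes inv: "\<And>x s. \<phi> (x + s *\<^sub>R e) = \<phi> x" and "GDERIV \<phi> x :> D"
  shows "GDERIV \<phi> (x + s *\<^sub>R e) :> D"
proof -
  have "((\<lambda>y. \<phi> (y + (- s) *\<^sub>R e)) has_derivative (\<lambda>h. h \<bullet> D)) (at (x + s *\<^sub>R e))"
  proof (rule has_derivative_compose[where f="\<lambda>y. y + (- s) *\<^sub>R e" and f'="\<lambda>h. h" and g=\<phi>])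
    show "((\<lambda>y. y + (- s) *\<^sub>R e) has_derivative (\<lambda>h. h)) (at (x + s *\<^sub>R e))"
      by (auto intro!: derivative_eq_intros)
  qed (use assms(2) in \<open>simp add: gderiv_def\<close>)
  then show ?thesis by (simp add: gderiv_def inv del: scaleR_minus_left)
qed

lemma gradient_translate:
  assumes inv: "\<And>x s. \<phi> (x + s *\<^sub>R e) = \<phi> x"
  shows "gradient \<phi> (x + s *\<^sub>R e) = gradient \<phi> x"
    and "x + s *\<^sub>R e \<in> gdiff_set \<phi> \<longleftrightarrow> x \<in> gdiff_set \<phi>"
proof -
  have "GDERIV \<phi> (x + s *\<^sub>R e) :> D \<longleftrightarrow> GDERIV \<phi> x :> D" for D
    using GDERIV_translate[of \<phi> e x D s, OF inv] GDERIV_translate[of \<phi> e "x + s *\<^sub>R e" D "- s", OF inv] by auto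
  note eq = this
  show *: "gradient \<phi> (x + s *\<^sub>R e) = gradient \<phi> x"
    unfolding gradient_def eq ..
  show "x + s *\<^sub>R e \<in> gdiff_set \<phi> \<longleftrightarrow> x \<in> gdiff_set \<phi>"
    unfolding gdiff_set_def mem_Collect_eq * eq ..
qed

lemma gradient_orthogonal:
  assumes inv: "\<And>x s. \<phi> (x + s *\<^sub>R e) = \<phi> x" and x: "x \<in> gdiff_set \<phi>"
  shows "e \<bullet> gradient \<phi> x = 0"
proof -
  have "((\<lambda>h. (\<phi> (x + h *\<^sub>R e) - \<phi> x) / h) \<longlongrightarrow> e \<bullet> gradient \<phi> x) (at 0)"
    using x by (intro GDERIV_directional) (simp add: gdiff_set_def)
  then show ?thesis by (simp add: inv tendsto_const_iff)
qed

text \<open>The derivative in the direction of the gradient is its squared norm, and it is at most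
  \<open>L\<close> times its norm.\<close>

lemma norm_gradient_le:
  fixes f :: "'a::euclidean_space \<Rightarrow> real"
  assumes f: "L-lipschitz_on UNIV f" and x: "x \<in> gdiff_set f"
  shows "norm (gradient f x) \<le> L"
proof -
  let ?D = "gradient f x"
  have *: "((\<lambda>h. (f (x + h *\<^sub>R ?D) - f x) / h) \<longlongrightarrow> ?D \<bullet> ?D) (at 0)"
    using x by (intro GDERIV_directional) (simp add: gdiff_set_def)
  have "?D \<bullet> ?D \<le> L * norm ?D"
    using dir_deriv_bound[OF f, of x ?D] * dir_deriv_tendsto(2)[OF *] by simp
  then have "norm ?D * norm ?D \<le> L * norm ?D"
    by (simp add: power2_norm_eq_inner[symmetric] power2_eq_square)
  then show ?thesis
    using lipschitz_on_nonneg[OF f] by (cases "?D = 0") (auto simp: mult_le_cancel_right)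
qed

section \<open>Coordinates along a direction\<close>

definition slab :: "'a::euclidean_space \<Rightarrow> 'a set" where
  "slab e = {x. 0 \<le> x \<bullet> e \<and> x \<bullet> e \<le> 1}"

definition graph_point :: "'a::euclidean_space \<Rightarrow> ('a \<Rightarrow> real) \<Rightarrow> 'a \<Rightarrow> 'a" where
  "graph_point e \<phi> x = x + (\<phi> x - x \<bullet> e) *\<^sub>R e"

lemma borel_slab [measurable]: "slab e \<in> sets borel"
  unfolding slab_def by measurable

lemma borel_graph_point [measurable]:
  assumes [measurable]: "\<phi> \<in> borel_measurable borel"
  shows "graph_point e \<phi> \<in> borel_measurable borel"
  unfolding graph_point_def by measurable

text \<open>\<open>x\<close> and its graph point differ only along \<open>e\<close>, and the slab
  bounds that component of \<open>x\<close>. Bounded sets of graph points thus come from bounded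
  parts of the slab, which supplies integrable majorants. \<open>\<psi>\<close> is arbitrary, so
  that heights such as \<open>\<phi> x + t n * r\<close> are covered.\<close>

lemma norm_le_graph_point:
  assumes e: "norm e = 1" and x: "x \<in> slab e"
  shows "norm x \<le> 2 * norm (graph_point e \<psi> x) + 1"
proof -
  define y where "y = graph_point e \<psi> x"
  have ee: "e \<bullet> e = 1" using e by (simp add: power2_norm_eq_inner[symmetric])
  have "x = y - (y \<bullet> e) *\<^sub>R e + (x \<bullet> e) *\<^sub>R e"
    unfolding y_def graph_point_def by (simp add: inner_add_left ee algebra_simps)
  from arg_cong[OF this, of norm] have "norm x \<le> norm y + norm ((y \<bullet> e) *\<^sub>R e) + norm ((x \<bullet> e) *\<^sub>R e)"
    using norm_triangle_ineq[of "y - (y \<bullet> e) *\<^sub>R e" "(x \<bullet> e) *\<^sub>R e"]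
      norm_triangle_ineq4[of y "(y \<bullet> e) *\<^sub>R e"] by linarith
  moreover have "\<bar>y \<bullet> e\<bar> \<le> norm y" using Cauchy_Schwarz_ineq2[of y e] e by simp
  moreover have "\<bar>x \<bullet> e\<bar> \<le> 1" using x by (simp add: slab_def)
  ultimately show ?thesis using e by (simp add: y_def)
qed

text \<open>Translations and Tonelli replace an orthogonal change of variables: a point
  \<open>y\<close> lies in the slab shifted by \<open>s\<close> for a set of \<open>s\<close> of
  length one. The coordinate on the line is recentred at the graph and stretched by
  \<open>t\<close>, whence the factor \<open>t\<close>.\<close>

lemma nn_integral_slab:
  fixes F :: "'a::euclidean_space \<Rightarrow> ennreal"
  assumes [measurable]: "F \<in> borel_measurable borel" "\<phi> \<in> borel_measurable borel"
    and e: "norm e = 1" and t: "t > 0"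
  shows "(\<integral>\<^sup>+y. F y \<partial>lborel) =
    (\<integral>\<^sup>+x. (\<integral>\<^sup>+r. ennreal t * indicator (slab e) x * F (graph_point e \<phi> x + (t * r) *\<^sub>R e) \<partial>lborel) \<partial>lborel)"
proof -
  have ee: "e \<bullet> e = 1" using e by (simp add: power2_norm_eq_inner[symmetric])
  have shift: "(\<integral>\<^sup>+y. H (y + s *\<^sub>R e) \<partial>lborel) = (\<integral>\<^sup>+y. H y \<partial>lborel)"
    if [measurable]: "H \<in> borel_measurable borel" for s and H :: "'a \<Rightarrow> ennreal"
  proof -
    have "(\<integral>\<^sup>+y. H y \<partial>lborel) = (\<integral>\<^sup>+y. H (s *\<^sub>R e + y) \<partial>lborel)"
      by (subst lborel_distr_plus[of "s *\<^sub>R e", symmetric], subst nn_integral_distr) simp_all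
    then show ?thesis by (simp add: add.commute)
  qed
  have "(\<integral>\<^sup>+x. (\<integral>\<^sup>+r. ennreal t * indicator (slab e) x * F (graph_point e \<phi> x + (t * r) *\<^sub>R e) \<partial>lborel) \<partial>lborel)
    = (\<integral>\<^sup>+x. (\<integral>\<^sup>+s. indicator (slab e) x * F (x + s *\<^sub>R e) \<partial>lborel) \<partial>lborel)"
  proof (rule nn_integral_cong)
    fix x :: 'a
    have "(\<integral>\<^sup>+s. indicator (slab e) x * F (x + s *\<^sub>R e) \<partial>lborel) =
      ennreal \<bar>t\<bar> * (\<integral>\<^sup>+r. indicator (slab e) x * F (x + ((\<phi> x - x \<bullet> e) + t * r) *\<^sub>R e) \<partial>lborel)"
      using t by (intro nn_integral_real_affine) auto
    also have "\<dots> = (\<integral>\<^sup>+r. ennreal t * (indicator (slab e) x * F (x + ((\<phi> x - x \<bullet> e) + t * r) *\<^sub>R e)) \<partial>lborel)"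
      using t by (subst nn_integral_cmult) auto
    finally show "(\<integral>\<^sup>+r. ennreal t * indicator (slab e) x * F (graph_point e \<phi> x + (t * r) *\<^sub>R e) \<partial>lborel)
      = (\<integral>\<^sup>+s. indicator (slab e) x * F (x + s *\<^sub>R e) \<partial>lborel)"
      by (simp add: graph_point_def scaleR_add_left mult.assoc add.assoc)
  qed
  also have "\<dots> = (\<integral>\<^sup>+s. (\<integral>\<^sup>+x. indicator (slab e) x * F (x + s *\<^sub>R e) \<partial>lborel) \<partial>lborel)"
    by (rule lborel_pair.Fubini'[symmetric]) measurable
  also have "\<dots> = (\<integral>\<^sup>+s. (\<integral>\<^sup>+y. indicator (slab e) (y - s *\<^sub>R e) * F y \<partial>lborel) \<partial>lborel)"
  proof (rule nn_integral_cong)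
    fix s :: real
    show "(\<integral>\<^sup>+x. indicator (slab e) x * F (x + s *\<^sub>R e) \<partial>lborel) = (\<integral>\<^sup>+y. indicator (slab e) (y - s *\<^sub>R e) * F y \<partial>lborel)"
      using shift[of "\<lambda>y. indicator (slab e) (y - s *\<^sub>R e) * F y" s] by simp
  qed
  also have "\<dots> = (\<integral>\<^sup>+y. (\<integral>\<^sup>+s. indicator (slab e) (y - s *\<^sub>R e) * F y \<partial>lborel) \<partial>lborel)"
    by (rule lborel_pair.Fubini') measurable
  also have "\<dots> = (\<integral>\<^sup>+y. F y \<partial>lborel)"
  proof (rule nn_integral_cong)
    fix y :: 'a
    have "(\<integral>\<^sup>+s. indicator (slab e) (y - s *\<^sub>R e) * F y \<partial>lborel) = (\<integral>\<^sup>+s. indicator {y \<bullet> e - 1..y \<bullet> e} s * F y \<partial>lborel)"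
      by (intro nn_integral_cong) (auto simp: indicator_def slab_def inner_diff_left ee)
    also have "\<dots> = F y" by (simp add: nn_integral_multc)
    finally show "(\<integral>\<^sup>+s. indicator (slab e) (y - s *\<^sub>R e) * F y \<partial>lborel) = F y" .
  qed
  finally show ?thesis ..
qed

text \<open>The nonnegative case says that \<open>P\<close> pushes a weighted product measure to
  Lebesgue measure; in this form it serves signed integrands.\<close>

lemma integral_slab:
  fixes F :: "'a::euclidean_space \<Rightarrow> real"
  assumes F: "integrable lborel F" and [measurable]: "F \<in> borel_measurable borel" "\<phi> \<in> borel_measurable borel"
    and e: "norm e = 1" and t: "t > 0"
  shows "(\<integral>y. F y \<partial>lborel) =
    t * (\<integral>x. indicator (slab e) x * (\<integral>r. F (graph_point e \<phi> x + (t * r) *\<^sub>R e) \<partial>lborel) \<partial>lborel)"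
proof -
  define M where "M = density (lborel \<Otimes>\<^sub>M lborel) (\<lambda>z::'a \<times> real. ennreal (t * indicator (slab e) (fst z)))"
  define P where "P z = graph_point e \<phi> (fst z) + (t * snd z) *\<^sub>R e" for z
  have [measurable]: "P \<in> borel_measurable (lborel \<Otimes>\<^sub>M lborel)" unfolding P_def by measurable
  have d: "distr M borel P = lborel"
  proof (rule measure_eqI)
    fix A :: "'a set" assume "A \<in> sets (distr M borel P)"
    then have [measurable]: "A \<in> sets borel" by simp
    have "emeasure (distr M borel P) A = (\<integral>\<^sup>+z. indicator A z \<partial>distr M borel P)" by simp
    also have "\<dots> = (\<integral>\<^sup>+z. indicator A (P z) \<partial>M)"
      by (rule nn_integral_distr) (auto simp: M_def)
    also have "\<dots> = (\<integral>\<^sup>+z. ennreal (t * indicator (slab e) (fst z)) * indicator A (P z) \<partial>(lborel \<Otimes>\<^sub>M lborel))"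
      unfolding M_def by (subst nn_integral_density) auto
    also have "\<dots> = (\<integral>\<^sup>+x. (\<integral>\<^sup>+r. ennreal (t * indicator (slab e) x) * indicator A (graph_point e \<phi> x + (t * r) *\<^sub>R e) \<partial>lborel) \<partial>lborel)"
      by (subst lborel.nn_integral_fst[symmetric]) (auto simp: P_def)
    also have "\<dots> = emeasure lborel A"
      using t by (subst nn_integral_indicator[symmetric], simp, subst nn_integral_slab[OF _ _ e t, of _ \<phi>])
        (auto simp: ennreal_mult ennreal_indicator)
    finally show "emeasure (distr M borel P) A = emeasure lborel A" .
  qed simp
  have i1: "integrable M (\<lambda>z. F (P z))"
    using F unfolding d[symmetric] by (subst (asm) integrable_distr_eq) (auto simp: M_def)
  then have i2: "integrable (lborel \<Otimes>\<^sub>M lborel) (\<lambda>(x, r). t * indicator (slab e) x * F (graph_point e \<phi> x + (t * r) *\<^sub>R e))"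
    using t unfolding M_def by (subst (asm) integrable_density) (auto simp: P_def case_prod_unfold)
  have "(\<integral>y. F y \<partial>lborel) = (\<integral>z. F (P z) \<partial>M)"
    unfolding d[symmetric] by (rule integral_distr) (auto simp: M_def)
  also have "\<dots> = (\<integral>z. (case z of (x, r) \<Rightarrow> t * indicator (slab e) x * F (graph_point e \<phi> x + (t * r) *\<^sub>R e)) \<partial>(lborel \<Otimes>\<^sub>M lborel))"
    using t unfolding M_def by (subst integral_density) (auto simp: P_def case_prod_unfold)
  also have "\<dots> = (\<integral>x. (\<integral>r. t * indicator (slab e) x * F (graph_point e \<phi> x + (t * r) *\<^sub>R e) \<partial>lborel) \<partial>lborel)"
    by (rule lborel_pair.integral_fst'[OF i2, symmetric, unfolded case_prod_conv])
  finally show ?thesis by (simp add: mult.assoc)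
qed

section \<open>The boundary layer of a perturbed domain\<close>

lemma lipschitz_chartD:
  assumes "lipschitz_chart \<Omega> U e \<phi>"
  obtains L where "L-lipschitz_on UNIV \<phi>" "continuous_on UNIV \<phi>"
    "open U" "norm e = 1" "e \<bullet> e = 1" "\<And>x s. \<phi> (x + s *\<^sub>R e) = \<phi> x"
    "\<And>x. x \<in> U \<Longrightarrow> x \<in> \<Omega> \<longleftrightarrow> x \<bullet> e < \<phi> x"
proof -
  obtain L where L: "L-lipschitz_on UNIV \<phi>" using assms by (auto simp: lipschitz_chart_def)
  have "norm e = 1" using assms by (auto simp: lipschitz_chart_def)
  then have ee: "e \<bullet> e = 1" by (simp add: power2_norm_eq_inner[symmetric])
  show ?thesis
    by (rule that[OF L lipschitz_on_continuous_on[OF L] _ \<open>norm e = 1\<close> ee])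
       (use assms in \<open>auto simp: lipschitz_chart_def\<close>)
qed

lemma graph_point_inner:
  assumes "e \<bullet> e = 1" "\<And>x s. \<phi> (x + s *\<^sub>R e) = \<phi> x"
  shows "graph_point e \<phi> x \<bullet> e = \<phi> x" "\<phi> (graph_point e \<phi> x) = \<phi> x"
    "graph_point e \<phi> (x + s *\<^sub>R e) = graph_point e \<phi> x"
    "graph_point e \<phi> x = x + (\<phi> x - x \<bullet> e) *\<^sub>R e"
proof -
  show "graph_point e \<phi> x \<bullet> e = \<phi> x"
    by (simp add: graph_point_def inner_add_left assms(1))
  show "\<phi> (graph_point e \<phi> x) = \<phi> x"
    by (simp add: graph_point_def assms(2))
  show "graph_point e \<phi> (x + s *\<^sub>R e) = graph_point e \<phi> x"
    by (simp add: graph_point_def assms inner_add_left algebra_simps)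
qed (simp add: graph_point_def)

text \<open>The part of \<open>U\<close> above the graph is open and misses \<Omega>; from a point
  of the graph an arbitrarily small step along \<open>- e\<close> enters \<Omega>.\<close>

lemma frontier_chart_iff:
  assumes chart: "lipschitz_chart \<Omega> U e \<phi>" and x: "x \<in> U" and \<Omega>: "open \<Omega>"
  shows "x \<in> frontier \<Omega> \<longleftrightarrow> x \<bullet> e = \<phi> x"
proof -
  obtain L where L: "continuous_on UNIV \<phi>" "open U" "norm e = 1" "e \<bullet> e = 1" "\<And>x s. \<phi> (x + s *\<^sub>R e) = \<phi> x"
    and iff: "\<And>x. x \<in> U \<Longrightarrow> x \<in> \<Omega> \<longleftrightarrow> x \<bullet> e < \<phi> x"
    by (rule lipschitz_chartD[OF chart]) blast
  have front: "x \<in> frontier \<Omega> \<longleftrightarrow> x \<in> closure \<Omega> \<and> x \<notin> \<Omega>"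
    using \<Omega> by (simp add: frontier_def interior_open)
  show ?thesis
  proof
    assume "x \<in> frontier \<Omega>"
    then have cl: "x \<in> closure \<Omega>" "\<not> x \<bullet> e < \<phi> x" using front iff x by auto
    have "\<not> \<phi> x < x \<bullet> e"
    proof
      assume "\<phi> x < x \<bullet> e"
      then have "x \<in> U \<inter> {y. \<phi> y < y \<bullet> e}" using x by simp
      moreover have "open (U \<inter> {y. \<phi> y < y \<bullet> e})"
        by (intro open_Int L open_Collect_less continuous_intros)
      ultimately have "U \<inter> {y. \<phi> y < y \<bullet> e} \<inter> \<Omega> \<noteq> {}"
        using cl(1) open_Int_closure_eq_empty[of "U \<inter> {y. \<phi> y < y \<bullet> e}" \<Omega>] by blast
      then show False using iff by fastforce
    qed
    with cl(2) show "x \<bullet> e = \<phi> x" by simp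
  next
    assume eq: "x \<bullet> e = \<phi> x"
    have "x \<in> closure \<Omega>"
      unfolding closure_approachable
    proof (intro allI impI)
      fix \<epsilon> :: real assume "0 < \<epsilon>"
      obtain \<rho> where \<rho>: "\<rho> > 0" "ball x \<rho> \<subseteq> U" using L(2) x open_contains_ball by blast
      define s where "s = min \<epsilon> \<rho> / 2"
      have s: "0 < s" "s < \<epsilon>" "s < \<rho>" using \<open>0 < \<epsilon>\<close> \<rho>(1) by (auto simp: s_def min_def)
      define y where "y = x + (- s) *\<^sub>R e"
      have d: "dist y x = s" using s L(3) by (simp add: y_def dist_norm)
      then have "y \<in> U" using \<rho> s by (auto simp: dist_commute subset_eq)
      moreover have "y \<bullet> e < \<phi> y"
        using s L(4) eq unfolding y_def L(5) by (simp add: inner_diff_left inner_add_left)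
      ultimately have "y \<in> \<Omega>" using iff by blast
      with d s show "\<exists>y\<in>\<Omega>. dist y x < \<epsilon>" by auto
    qed
    with iff[OF x] eq front show "x \<in> frontier \<Omega>" by simp
  qed
qed

text \<open>A Brouwer argument replaces the inverse of \<open>V\<close>.\<close>

lemma mem_image_perturbation:
  fixes V :: "'a::euclidean_space \<Rightarrow> 'a"
  assumes "continuous_on S V" "cball z r \<subseteq> S" "0 \<le> r"
    and close: "\<And>x. x \<in> cball z r \<Longrightarrow> norm (y - z - (V x - x)) \<le> r"
  shows "y \<in> V ` S"
proof -
  have "continuous_on (cball z r) V" using assms(1,2) continuous_on_subset by blast
  then have "continuous_on (cball z r) (\<lambda>x. y - (V x - x))" by (intro continuous_intros)
  \<comment> \<open>A fixed point of this map is a preimage of \<open>y\<close> under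
    \<open>V\<close>, and \<open>close\<close> says that the map sends the ball into itself.\<close>
  moreover have "(\<lambda>x. y - (V x - x)) \<in> cball z r \<rightarrow> cball z r"
    using close by (auto simp: dist_norm norm_minus_commute algebra_simps)
  ultimately obtain x where "x \<in> cball z r" "y - (V x - x) = x"
    using brouwer[OF compact_cball convex_cball, of z r "\<lambda>x. y - (V x - x)"] assms(3) by (auto simp: image_subset_iff_funcset)
  then show ?thesis using assms(2) by (intro image_eqI[of _ _ x]) (auto simp: algebra_simps)
qed

text \<open>The integrand is the signed indicator of the interval between 0 and \<open>s\<close>,
  the limit of the layer on one line; outward and inward motion are treated together.\<close>

lemma lborel_integral_step_diff:
  "((\<integral>r. (of_bool (r < s) - of_bool (r < (0::real))) \<partial>lborel) :: real) = s"
proof (cases "s \<ge> 0")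
  case True
  have "((\<integral>r. (of_bool (r < s) - of_bool (r < (0::real))) \<partial>lborel) :: real) = (\<integral>r. indicator {0..<s} r \<partial>lborel)"
    using True by (intro Bochner_Integration.integral_cong) (auto simp: indicator_def)
  then show ?thesis using True by simp
next
  case False
  have "((\<integral>r. (of_bool (r < s) - of_bool (r < (0::real))) \<partial>lborel) :: real) = (\<integral>r. - indicator {s..<0} r \<partial>lborel)"
    using False by (intro Bochner_Integration.integral_cong) (auto simp: indicator_def)
  then show ?thesis using False by simp
qed

text \<open>The height of \<open>x\<close> over the graph, \<open>x \<bullet> e - \<phi> x\<close>,
  is to first order \<open>(x - p) \<bullet> (e - D)\<close>. The tolerance \<eta> is fixed before
  \<rho> because it is later handed to \<open>expansion\<close>, whose radius then enters
  \<rho>.\<close>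

lemma chart_height_expansion:
  fixes p u e :: "'a::euclidean_space"
  assumes D: "GDERIV \<phi> p :> D" and p: "p \<bullet> e = \<phi> p" and e: "norm e = 1"
    and t: "\<And>n. t n > 0" "t \<longlonglongrightarrow> 0" and \<kappa>: "\<kappa> > 0"
  shows "\<exists>\<eta>\<in>{0<..<\<kappa>}. \<forall>\<rho>>0. \<forall>\<^sub>F n in sequentially. \<forall>x. norm (x - p - t n *\<^sub>R u) \<le> t n * \<eta> \<longrightarrow>
    dist p x < \<rho> \<and> \<bar>(x \<bullet> e - \<phi> x) - t n * ((e - D) \<bullet> u)\<bar> \<le> \<kappa> * t n"
proof -
  \<comment> \<open>\<open>norm (e - D)\<close> accounts for the displacement of \<open>x\<close>,
    and \<open>norm u + 1\<close> for the remainder in the derivative of \<phi>.\<close>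
  define c where "c = 1 + norm (e - D) + (norm u + 1)"
  have c: "c > 0" unfolding c_def using norm_ge_zero[of "e - D"] norm_ge_zero[of u] by linarith
  define \<eta> where "\<eta> = min (1/2) (min (\<kappa> / 2) (\<kappa> / c))"
  have \<eta>: "0 < \<eta>" "\<eta> < \<kappa>" "\<eta> \<le> 1" "\<eta> * c \<le> \<kappa>"
    using \<kappa> c by (auto simp: \<eta>_def min_def field_simps)
  obtain d where d: "d > 0" "\<And>y. norm (y - p) < d \<Longrightarrow> norm (\<phi> y - \<phi> p - (y - p) \<bullet> D) \<le> \<eta> * norm (y - p)"
    using D[unfolded gderiv_def has_derivative_at_alt, THEN conjunct2, rule_format, OF \<eta>(1)] by auto
  have pos: "norm u + 1 > 0" using norm_ge_zero[of u] by linarith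
  have "\<forall>\<^sub>F n in sequentially. \<forall>x. norm (x - p - t n *\<^sub>R u) \<le> t n * \<eta> \<longrightarrow>
    dist p x < \<rho> \<and> \<bar>(x \<bullet> e - \<phi> x) - t n * ((e - D) \<bullet> u)\<bar> \<le> \<kappa> * t n" if \<rho>: "\<rho> > 0" for \<rho>
  proof -
    have "\<forall>\<^sub>F n in sequentially. t n < min d \<rho> / (norm u + 1)"
      using t(2) d(1) \<rho> pos by (intro order_tendstoD(2)) auto
    then show ?thesis
    proof eventually_elim
      case (elim n)
      then have tn: "t n * (norm u + 1) < min d \<rho>" using pos by (simp add: field_simps)
      show ?case
      proof (intro allI impI)
        fix x assume x: "norm (x - p - t n *\<^sub>R u) \<le> t n * \<eta>"
        define w where "w = x - p - t n *\<^sub>R u"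
        have xp: "x - p = t n *\<^sub>R u + w" by (simp add: w_def)
        have "norm (x - p) \<le> t n * norm u + t n * \<eta>"
          unfolding xp using x t(1)[of n] by (intro norm_triangle_le) (auto simp: w_def)
        also have "\<dots> \<le> t n * (norm u + 1)" using \<eta> t(1)[of n] by (simp add: distrib_left)
        finally have nx: "norm (x - p) \<le> t n * (norm u + 1)" .
        then have "\<bar>\<phi> x - \<phi> p - (x - p) \<bullet> D\<bar> \<le> \<eta> * norm (x - p)"
          using d(2)[of x] tn by simp
        also have "\<dots> \<le> \<eta> * (t n * (norm u + 1))" using nx \<eta> by (intro mult_left_mono) auto
        finally have 1: "\<bar>\<phi> x - \<phi> p - (x - p) \<bullet> D\<bar> \<le> \<eta> * (t n * (norm u + 1))" .
        have "\<bar>w \<bullet> (e - D)\<bar> \<le> norm w * norm (e - D)" by (rule Cauchy_Schwarz_ineq2)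
        also have "\<dots> \<le> t n * \<eta> * norm (e - D)" using x by (intro mult_right_mono) (auto simp: w_def)
        finally have 2: "\<bar>w \<bullet> (e - D)\<bar> \<le> t n * \<eta> * norm (e - D)" .
        have "(x \<bullet> e - \<phi> x) - t n * ((e - D) \<bullet> u) = (x - p) \<bullet> (e - D) - t n * (u \<bullet> (e - D)) - (\<phi> x - \<phi> p - (x - p) \<bullet> D)"
          by (simp add: inner_commute[of e u] inner_commute[of D u] inner_diff_left inner_diff_right p)
        also have "\<dots> = w \<bullet> (e - D) - (\<phi> x - \<phi> p - (x - p) \<bullet> D)"
          by (simp add: xp inner_add_left)
        finally have "\<bar>(x \<bullet> e - \<phi> x) - t n * ((e - D) \<bullet> u)\<bar> \<le> t n * \<eta> * norm (e - D) + \<eta> * (t n * (norm u + 1))"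
          using 1 2 by linarith
        also have "\<dots> \<le> t n * (\<eta> * c)" using \<eta> t(1)[of n] by (simp add: c_def algebra_simps)
        also have "\<dots> \<le> t n * \<kappa>" using \<eta> t(1)[of n] by (intro mult_left_mono) auto
        finally show "dist p x < \<rho> \<and> \<bar>(x \<bullet> e - \<phi> x) - t n * ((e - D) \<bullet> u)\<bar> \<le> \<kappa> * t n"
          using nx tn by (simp add: dist_norm norm_minus_commute mult.commute)
      qed
    qed
  qed
  with \<eta> show ?thesis by (intro bexI[of _ \<eta>]) auto
qed

text \<open>A one-parameter family of maps \<open>x \<mapsto> x + t\<^sub>n S(x) + o(t\<^sub>n)\<close>, sampled along \<open>t\<^sub>n \<rightarrow> 0\<close>; the
  expansion is only required near the boundary.\<close>

locale perturbation =
  fixes \<Omega> :: "'a::euclidean_space set" and V :: "nat \<Rightarrow> 'a \<Rightarrow> 'a" and t :: "nat \<Rightarrow> real"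
    and S :: "'a \<Rightarrow> 'a" and C :: real
  assumes open_domain: "open \<Omega>" and bounded_domain: "bounded \<Omega>"
    and t_pos: "\<And>n. t n > 0" and t_lim: "t \<longlonglongrightarrow> 0"
    and cont_V: "\<And>n. continuous_on \<Omega> (V n)" and open_V: "\<And>n. open (V n ` \<Omega>)"
    and C_nonneg: "C \<ge> 0" and C_bound: "\<And>n x. x \<in> \<Omega> \<Longrightarrow> norm (V n x - x) \<le> C * t n"
    and expansion: "\<And>p \<eta>. p \<in> frontier \<Omega> \<Longrightarrow> \<eta> > 0 \<Longrightarrow>
      \<exists>\<rho>>0. \<forall>\<^sub>F n in sequentially. \<forall>x\<in>\<Omega> \<inter> ball p \<rho>. norm (V n x - x - t n *\<^sub>R S p) \<le> t n * \<eta>"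
begin

section \<open>The layer between a domain and its image\<close>

text \<open>Gained points count positively and lost points negatively, so that the integral against
  \<open>f\<close> is the change of the integral of \<open>f\<close> over the domain.\<close>

definition image_diff :: "nat \<Rightarrow> 'a \<Rightarrow> real" where
  "image_diff n y = indicator (V n ` \<Omega>) y - indicator \<Omega> y"

lemma borel_image_diff [measurable]: "image_diff n \<in> borel_measurable borel"
  unfolding image_diff_def using open_V open_domain by (intro borel_measurable_diff borel_measurable_indicator) auto

lemma image_diff_cases: "image_diff n y \<in> {-1, 0, 1}"
  by (auto simp: image_diff_def indicator_def)

lemma abs_image_diff_le: "\<bar>image_diff n y\<bar> \<le> 1"
  using image_diff_cases[of n y] by auto

text \<open>A continuous map that moves points by at most \<open>C * t n\<close> cannot vacate the
  centre of a ball of that radius inside \<Omega>.\<close>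

lemma image_diff_eq_0_interior:
  assumes "cball y (C * t n) \<subseteq> \<Omega>"
  shows "image_diff n y = 0"
proof -
  have "0 \<le> C * t n" using C_nonneg t_pos[of n] by simp
  then have "y \<in> V n ` \<Omega>"
    using assms C_bound[of _ n]
    by (intro mem_image_perturbation[OF cont_V assms]) (auto simp: norm_minus_commute)
  moreover have "y \<in> \<Omega>" using assms \<open>0 \<le> C * t n\<close> by auto
  ultimately show ?thesis by (simp add: image_diff_def)
qed

lemma image_diff_eq_0_exterior:
  assumes "cball y (C * t n) \<inter> \<Omega> = {}"
  shows "image_diff n y = 0"
proof -
  have "0 \<le> C * t n" using C_nonneg t_pos[of n] by simp
  then have "y \<in> cball y (C * t n)" by simp
  then have "y \<notin> \<Omega>" using assms by blast
  moreover have "y \<notin> V n ` \<Omega>"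
  proof
    assume "y \<in> V n ` \<Omega>"
    then obtain x where "x \<in> \<Omega>" "y = V n x" by auto
    then have "x \<in> cball y (C * t n) \<inter> \<Omega>" using C_bound[of x n] by (simp add: dist_norm)
    with assms show False by auto
  qed
  ultimately show ?thesis by (simp add: image_diff_def)
qed

text \<open>To first order a preimage of the point is \<open>p\<close> plus \<open>t n\<close> times
  \<open>u\<close>, and its height over the graph is \<open>t n * (r - \<sigma>)\<close>, because
  \<open>D\<close> is orthogonal to \<open>e\<close>. If \<open>r < \<sigma>\<close>, a whole ball
  about that point lies in \<Omega>, and the fixed point argument yields a preimage; if
  \<open>r > \<sigma>\<close>, every candidate lies above the graph. At \<open>r = 0\<close> and
  \<open>r = \<sigma>\<close> a leading term vanishes, so these two values are excluded.\<close>

lemma image_diff_tendsto: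
  assumes chart: "lipschitz_chart \<Omega> U e \<phi>" and p: "p \<in> frontier \<Omega>" "p \<in> U"
    and D: "GDERIV \<phi> p :> D" and De: "D \<bullet> e = 0"
    and r: "r \<noteq> 0" "r \<noteq> S p \<bullet> (e - D)"
  shows "\<forall>\<^sub>F n in sequentially. image_diff n (p + (t n * r) *\<^sub>R e) =
    of_bool (r < S p \<bullet> (e - D)) - of_bool (r < 0)"
proof -
  obtain L where e: "open U" "norm e = 1" "e \<bullet> e = 1" and inv: "\<And>x s. \<phi> (x + s *\<^sub>R e) = \<phi> x"
    and iff: "\<And>x. x \<in> U \<Longrightarrow> x \<in> \<Omega> \<longleftrightarrow> x \<bullet> e < \<phi> x"
    by (rule lipschitz_chartD[OF chart]) blast
  have pe: "p \<bullet> e = \<phi> p" using frontier_chart_iff[OF chart p(2) open_domain] p(1) by simp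
  obtain \<rho>U where \<rho>U: "\<rho>U > 0" "ball p \<rho>U \<subseteq> U" using e(1) p(2) open_contains_ball by blast
  define y where "y n = p + (t n * r) *\<^sub>R e" for n
  define \<sigma> where "\<sigma> = S p \<bullet> (e - D)"
  define u where "u = r *\<^sub>R e - S p"
  \<comment> \<open>Half the gap between \<open>r\<close> and \<sigma>: an error of
    \<open>\<kappa> * t n\<close> in the height cannot change its sign.\<close>
  define \<kappa> where "\<kappa> = \<bar>r - \<sigma>\<bar> / 2"
  have \<kappa>: "\<kappa> > 0" using r by (simp add: \<kappa>_def \<sigma>_def)
  have eDu: "(e - D) \<bullet> u = r - \<sigma>"
    using De e(3) by (simp add: u_def \<sigma>_def inner_diff_left inner_diff_right inner_commute)
  obtain \<eta> where \<eta>: "\<eta> > 0" and height: "\<And>\<rho>. \<rho> > 0 \<Longrightarrow>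
      \<forall>\<^sub>F n in sequentially. \<forall>x. norm (x - p - t n *\<^sub>R u) \<le> t n * \<eta> \<longrightarrow>
        dist p x < \<rho> \<and> \<bar>(x \<bullet> e - \<phi> x) - t n * ((e - D) \<bullet> u)\<bar> \<le> \<kappa> * t n"
    using chart_height_expansion[where t=t and u=u, OF D pe e(2) t_pos t_lim \<kappa>] by auto
  obtain \<rho>1 where \<rho>1: "\<rho>1 > 0"
    "\<forall>\<^sub>F n in sequentially. \<forall>x\<in>\<Omega> \<inter> ball p \<rho>1. norm (V n x - x - t n *\<^sub>R S p) \<le> t n * \<eta>"
    using expansion[OF p(1) \<eta>] by blast
  define \<rho> where "\<rho> = min \<rho>1 \<rho>U"
  have \<rho>: "\<rho> > 0" "ball p \<rho> \<subseteq> U" using \<rho>1 \<rho>U by (auto simp: \<rho>_def)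
  have "\<forall>\<^sub>F n in sequentially. t n < \<rho> / (C + \<bar>r\<bar> + 1)"
    using \<rho> C_nonneg by (intro order_tendstoD(2)[OF t_lim] divide_pos_pos) auto
  with height[OF \<rho>(1)] \<rho>1(2) show ?thesis
  proof eventually_elim
    case (elim n)
    have tn: "t n > 0" by (rule t_pos)
    \<comment> \<open>\<open>y n\<close> is within \<open>t n * \<bar>r\<bar>\<close> of
      \<open>p\<close> and any preimage within \<open>C * t n\<close> of \<open>y n\<close>, so both
      stay in the ball of radius \<rho>; the summand 1 keeps the denominator positive.\<close>
    have "t n * (C + \<bar>r\<bar> + 1) < \<rho>" using elim(3) C_nonneg by (simp add: field_simps)
    then have tn\<rho>: "t n * C + t n * \<bar>r\<bar> < \<rho>" using tn by (simp add: distrib_left)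
    have dy: "norm (y n - p) \<le> t n * \<bar>r\<bar>" using tn e(2) by (simp add: y_def abs_mult)
    have yU: "y n \<in> U"
    proof -
      have "0 \<le> t n * C" using tn C_nonneg by simp
      then have "dist p (y n) < \<rho>" using dy tn\<rho> by (simp add: dist_norm norm_minus_commute)
      then show ?thesis using \<rho>(2) by auto
    qed
    have "y n \<in> \<Omega> \<longleftrightarrow> r < 0"
    proof -
      have "y n \<bullet> e = \<phi> (y n) + t n * r"
        using e(3) pe by (simp add: y_def inv inner_add_left)
      then show ?thesis using iff[OF yU] tn by (simp add: mult_less_0_iff)
    qed
    moreover have "y n \<in> V n ` \<Omega> \<longleftrightarrow> r < \<sigma>"
    proof (cases "r < \<sigma>")
      case True
      define z where "z = p + t n *\<^sub>R u"
      have z: "x \<in> \<Omega> \<inter> ball p \<rho>1" if "x \<in> cball z (t n * \<eta>)" for x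
      proof -
        have "norm (x - p - t n *\<^sub>R u) \<le> t n * \<eta>"
          using that by (simp add: z_def dist_norm norm_minus_commute algebra_simps)
        with elim(1) have 1: "dist p x < \<rho>" and "\<bar>(x \<bullet> e - \<phi> x) - t n * (r - \<sigma>)\<bar> \<le> \<kappa> * t n"
          by (auto simp: eDu)
        then have "x \<bullet> e - \<phi> x \<le> t n * (r - \<sigma>) + \<kappa> * t n" by linarith
        also have "\<dots> = t n * ((r - \<sigma>) / 2)" using True by (simp add: \<kappa>_def field_simps)
        also have "\<dots> < 0" using True tn by (simp add: mult_less_0_iff)
        finally show ?thesis using 1 \<rho>(2) iff[of x] by (auto simp: \<rho>_def)
      qed
      have "y n \<in> V n ` \<Omega>"
      proof (rule mem_image_perturbation[OF cont_V])
        show "cball z (t n * \<eta>) \<subseteq> \<Omega>" using z by blast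
        show "0 \<le> t n * \<eta>" using tn \<eta> by simp
        fix x assume x: "x \<in> cball z (t n * \<eta>)"
        have "y n - z - (V n x - x) = - (V n x - x - t n *\<^sub>R S p)"
          by (simp add: y_def z_def u_def algebra_simps)
        then show "norm (y n - z - (V n x - x)) \<le> t n * \<eta>"
          using elim(2) z[OF x] by (metis norm_minus_cancel)
      qed
      with True show ?thesis by simp
    next
      case False
      then have gt: "\<sigma> < r" using r by (simp add: \<sigma>_def)
      have "y n \<notin> V n ` \<Omega>"
      proof
        assume "y n \<in> V n ` \<Omega>"
        then obtain x where x: "x \<in> \<Omega>" "y n = V n x" by auto
        have "norm (x - p) \<le> norm (y n - p) + norm (V n x - x)"
          using norm_triangle_ineq4[of "y n - p" "V n x - x"] x(2) by simp
        also have "\<dots> < \<rho>" using dy C_bound[OF x(1), of n] tn\<rho> by (simp add: mult.commute)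
        finally have xp: "dist p x < \<rho>" by (simp add: dist_norm norm_minus_commute)
        have "x - p - t n *\<^sub>R u = - (V n x - x - t n *\<^sub>R S p)"
          unfolding x(2)[symmetric] by (simp add: y_def u_def algebra_simps)
        moreover have "norm (V n x - x - t n *\<^sub>R S p) \<le> t n * \<eta>"
          using elim(2) x(1) xp by (auto simp: \<rho>_def)
        ultimately have "norm (x - p - t n *\<^sub>R u) \<le> t n * \<eta>" by (metis norm_minus_cancel)
        with elim(1) have "\<bar>(x \<bullet> e - \<phi> x) - t n * (r - \<sigma>)\<bar> \<le> \<kappa> * t n" by (auto simp: eDu)
        then have "x \<bullet> e - \<phi> x \<ge> t n * (r - \<sigma>) - \<kappa> * t n" by linarith
        moreover have "t n * (r - \<sigma>) - \<kappa> * t n = t n * ((r - \<sigma>) / 2)" using gt by (simp add: \<kappa>_def field_simps)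
        moreover have "t n * ((r - \<sigma>) / 2) > 0" using gt tn by simp
        moreover have "x \<in> U" using xp \<rho>(2) by auto
        ultimately show False using iff[of x] x(1) by simp
      qed
      with False show ?thesis by simp
    qed
    ultimately show ?case
      by (simp add: image_diff_def indicator_def y_def \<sigma>_def)
  qed
qed

text \<open>Within \<open>C * t n\<close> of the point the height over the graph varies by at most
  \<open>t n * ((1 + L) * C)\<close>. For larger \<open>\<bar>r\<bar>\<close> the ball of that
  radius stays on one side of the graph, and there \<Omega> and its image agree. The bounded range
  of \<open>r\<close> is what dominates the inner integral later.\<close>

lemma image_diff_support:
  assumes chart: "lipschitz_chart \<Omega> U e \<phi>" and L: "L-lipschitz_on UNIV \<phi>"
    and y: "ball (graph_point e \<phi> x + (t n * r) *\<^sub>R e) \<delta> \<subseteq> U" and tn: "C * t n < \<delta>"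
    and nz: "image_diff n (graph_point e \<phi> x + (t n * r) *\<^sub>R e) \<noteq> 0"
  shows "\<bar>r\<bar> \<le> (1 + L) * C"
proof (rule ccontr)
  assume r: "\<not> \<bar>r\<bar> \<le> (1 + L) * C"
  obtain L' where e: "norm e = 1" "e \<bullet> e = 1" and inv: "\<And>x s. \<phi> (x + s *\<^sub>R e) = \<phi> x"
    and iff: "\<And>x. x \<in> U \<Longrightarrow> x \<in> \<Omega> \<longleftrightarrow> x \<bullet> e < \<phi> x"
    by (rule lipschitz_chartD[OF chart]) blast
  define y where "y = graph_point e \<phi> x + (t n * r) *\<^sub>R e"
  have ye: "y \<bullet> e = \<phi> y + t n * r"
    by (simp add: y_def inv inner_add_left e graph_point_inner[OF e(2) inv])
  have key: "x' \<in> U \<and> \<bar>(x' \<bullet> e - \<phi> x') - t n * r\<bar> \<le> t n * ((1 + L) * C)" if x': "x' \<in> cball y (C * t n)" for x'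
  proof -
    have d: "norm (x' - y) \<le> C * t n" using x' by (simp add: dist_norm norm_minus_commute)
    have "\<bar>(x' - y) \<bullet> e\<bar> \<le> norm (x' - y) * norm e" by (rule Cauchy_Schwarz_ineq2)
    also have "\<dots> \<le> C * t n" using d e by simp
    finally have 1: "\<bar>x' \<bullet> e - y \<bullet> e\<bar> \<le> C * t n" by (simp add: inner_diff_left)
    have "\<bar>\<phi> x' - \<phi> y\<bar> \<le> L * norm (x' - y)"
      using lipschitz_onD[OF L, of x' y] by (simp add: dist_norm)
    also have "\<dots> \<le> L * (C * t n)" using d lipschitz_on_nonneg[OF L] by (intro mult_left_mono) auto
    finally have "\<bar>(x' \<bullet> e - \<phi> x') - t n * r\<bar> \<le> C * t n + L * (C * t n)" using 1 ye by linarith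
    also have "\<dots> = t n * ((1 + L) * C)" by (simp add: algebra_simps)
    finally show ?thesis using x' y tn by (auto simp: y_def)
  qed
  consider "r > (1 + L) * C" | "r < - ((1 + L) * C)" using r by linarith
  then have "image_diff n y = 0"
  proof cases
    case 1
    show ?thesis
    proof (rule image_diff_eq_0_exterior, rule ccontr)
      assume "cball y (C * t n) \<inter> \<Omega> \<noteq> {}"
      then obtain x' where x': "x' \<in> cball y (C * t n)" "x' \<in> \<Omega>" by blast
      have "t n * ((1 + L) * C) < t n * r" using 1 t_pos[of n] by (intro mult_strict_left_mono) auto
      then show False using key[OF x'(1)] iff[of x'] x'(2) by linarith
    qed
  next
    case 2
    show ?thesis
    proof (rule image_diff_eq_0_interior, rule subsetI)
      fix x' assume x': "x' \<in> cball y (C * t n)"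
      have "t n * r < t n * (- ((1 + L) * C))" using 2 t_pos[of n] by (intro mult_strict_left_mono) auto
      then show "x' \<in> \<Omega>" using key[OF x'] iff[of x'] by (simp, linarith)
    qed
  qed
  with nz show False by (simp add: y_def)
qed

end

section \<open>First-order limit of the layer in one chart\<close>

context perturbation
begin

text \<open>In slab coordinates scaled by \<open>t n\<close> the factor \<open>t n\<close> cancels
  the denominator, and on each line the layer converges by \<open>image_diff_tendsto\<close>.
  Dominated convergence is used in \<open>r\<close> and then in \<open>x\<close>; the supports are
  bounded uniformly in \<open>n\<close> because \<open>C * t n < \<delta>\<close> holds for every
  \<open>n\<close>.\<close>

lemma boundary_layer_aux:
  assumes chart: "lipschitz_chart \<Omega> U e \<phi>" and f: "continuous_on UNIV f" and K: "\<And>y. \<bar>f y\<bar> \<le> K"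
    and \<delta>: "\<delta> > 0" "\<And>y. f y \<noteq> 0 \<Longrightarrow> ball y \<delta> \<subseteq> U" and tn: "\<And>n. C * t n < \<delta>"
    and S: "continuous_on (frontier \<Omega>) S"
  shows "(\<lambda>n. (\<integral>y. f y * image_diff n y \<partial>lborel) / t n) \<longlonglongrightarrow>
    (\<integral>x. indicator (slab e) x *
       (f (graph_point e \<phi> x) * (S (graph_point e \<phi> x) \<bullet> (e - gradient \<phi> x))) \<partial>lborel)"
proof -
  obtain L where L: "L-lipschitz_on UNIV \<phi>" and cont: "continuous_on UNIV \<phi>"
    and U: "open U" and e: "norm e = 1" "e \<bullet> e = 1" and inv: "\<And>x s. \<phi> (x + s *\<^sub>R e) = \<phi> x"
    by (rule lipschitz_chartD[OF chart]) blast
  note gp = graph_point_inner[OF e(2) inv]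
  have [measurable]: "f \<in> borel_measurable borel" "\<phi> \<in> borel_measurable borel"
    using f cont by (auto intro: borel_measurable_continuous_onI)
  note [measurable] = borel_measurable_gradient[OF cont]
  have Kn: "K \<ge> 0" using K[of undefined] by linarith
  have Ln: "L \<ge> 0" by (rule lipschitz_on_nonneg[OF L])
  obtain B where B: "\<And>x. x \<in> \<Omega> \<Longrightarrow> norm x \<le> B"
    using bounded_domain unfolding bounded_iff by blast
  \<comment> \<open>\<open>\<bar>B\<bar> + \<delta>\<close> bounds \<Omega> and all its images;
    doubling and adding 1 is the passage to slab points in
    \<open>norm_le_graph_point\<close>.\<close>
  define R where "R = 2 * (\<bar>B\<bar> + \<delta>) + 1"
  define M where "M = (1 + L) * C"
  have M: "M \<ge> 0" using Ln C_nonneg by (simp add: M_def)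
  let ?p = "graph_point e \<phi>"
  define N where "N x = e - gradient \<phi> x" for x
  have [measurable]: "N \<in> borel_measurable borel" unfolding N_def by measurable
  have dnz: "norm y \<le> \<bar>B\<bar> + \<delta>" if "image_diff n y \<noteq> 0" for n y
  proof -
    have "y \<in> \<Omega> \<or> y \<in> V n ` \<Omega>" using that by (auto simp: image_diff_def indicator_def split: if_splits)
    then show ?thesis
    proof
      assume "y \<in> V n ` \<Omega>"
      then obtain x where x: "x \<in> \<Omega>" "y = V n x" by auto
      have "norm y \<le> norm x + norm (V n x - x)" using norm_triangle_ineq[of x "V n x - x"] x by simp
      then show ?thesis using B[OF x(1)] C_bound[OF x(1), of n] tn[of n] by linarith
    qed (use B \<delta> in fastforce)
  qed
  define F where "F n y = f y * image_diff n y" for n y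
  have [measurable]: "F n \<in> borel_measurable borel" for n unfolding F_def by measurable
  have Fb: "\<bar>F n y\<bar> \<le> K" for n y
    using mult_mono[OF K[of y] abs_image_diff_le[of n y]] Kn by (simp add: F_def abs_mult)
  have Fi: "integrable lborel (F n)" for n
  proof (rule Bochner_Integration.integrable_bound)
    show "integrable lborel (\<lambda>y. K * indicator (cball 0 (\<bar>B\<bar> + \<delta>)) y)"
      by (intro integrable_mult_right integrable_real_indicator emeasure_bounded_finite) auto
    show "AE y in lborel. norm (F n y) \<le> norm (K * indicator (cball 0 (\<bar>B\<bar> + \<delta>)) y :: real)"
    proof (rule AE_I2)
      fix y :: 'a
      show "norm (F n y) \<le> norm (K * indicator (cball 0 (\<bar>B\<bar> + \<delta>)) y :: real)"
      proof (cases "image_diff n y = 0")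
        case False
        then have "y \<in> cball 0 (\<bar>B\<bar> + \<delta>)" using dnz by auto
        then show ?thesis using Fb[of n y] Kn by simp
      qed (simp add: F_def)
    qed
  qed simp
  define g where "g n x r = F n (?p x + (t n * r) *\<^sub>R e)" for n x r
  have gm [measurable]: "(\<lambda>r. g n x r) \<in> borel_measurable borel" for n x unfolding g_def by measurable
  define H where "H n x = (\<integral>r. g n x r \<partial>lborel)" for n x
  have Hm: "H n \<in> borel_measurable borel" for n
  proof -
    have "case_prod (g n) \<in> borel_measurable (borel \<Otimes>\<^sub>M lborel)"
      unfolding g_def by measurable
    then show ?thesis unfolding H_def by (rule lborel.borel_measurable_lebesgue_integral)
  qed
  note [measurable] = Hm
  have supp: "\<bar>r\<bar> \<le> M \<and> (x \<in> slab e \<longrightarrow> norm x \<le> R)" if "g n x r \<noteq> 0" for n x r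
  proof -
    define y where "y = ?p x + (t n * r) *\<^sub>R e"
    have nz: "f y \<noteq> 0" "image_diff n y \<noteq> 0" using that by (auto simp: g_def F_def y_def)
    have 1: "\<bar>r\<bar> \<le> M"
      unfolding M_def using nz unfolding y_def by (intro image_diff_support[OF chart L \<delta>(2) tn])
    have "norm x \<le> R" if "x \<in> slab e"
    proof -
      have "norm x \<le> 2 * norm y + 1"
        using norm_le_graph_point[OF e(1) that, of "\<lambda>x. \<phi> x + t n * r"]
        by (simp add: y_def graph_point_def algebra_simps)
      then show ?thesis using dnz[OF nz(2)] by (simp add: R_def)
    qed
    with 1 show ?thesis by blast
  qed
  have gb: "\<bar>g n x r\<bar> \<le> K * indicator {- M..M} r" for n x r
    using supp[of n x r] Fb[of n "?p x + (t n * r) *\<^sub>R e"] Kn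
    by (cases "g n x r = 0") (auto simp: g_def indicator_def abs_le_iff)
  have gbi: "integrable lborel (\<lambda>r. K * indicator {- M..M} r)"
    by (intro integrable_mult_right integrable_real_indicator) (auto simp: emeasure_lborel_Icc_eq)
  have gi: "integrable lborel (\<lambda>r. g n x r)" for n x
    by (rule Bochner_Integration.integrable_bound[OF gbi]) (use gb Kn in \<open>auto simp: abs_mult\<close>)
  have Hb: "\<bar>H n x\<bar> \<le> K * (2 * M)" for n x
  proof -
    have "\<bar>H n x\<bar> \<le> (\<integral>r. \<bar>g n x r\<bar> \<partial>lborel)" unfolding H_def by (rule integral_abs_bound)
    also have "\<dots> \<le> (\<integral>r. K * indicator {- M..M} r \<partial>lborel)"
      using gi gb gbi by (intro integral_mono integrable_abs) auto
    also have "\<dots> = K * (2 * M)" using M by simp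
    finally show ?thesis .
  qed
  have H0: "\<bar>indicator (slab e) x * H n x\<bar> \<le> K * (2 * M) * indicator (cball 0 R) x" for n x
  proof (cases "x \<in> slab e \<and> norm x > R")
    case True
    then have "g n x r = 0" for r using supp[of n x r] by auto
    then show ?thesis using Kn M by (simp add: H_def)
  next
    case False
    then show ?thesis using Hb[of n x] Kn M by (auto simp: indicator_def)
  qed
  have quot: "(\<integral>y. f y * image_diff n y \<partial>lborel) / t n = (\<integral>x. indicator (slab e) x * H n x \<partial>lborel)" for n
    using integral_slab[OF Fi[of n] _ _ e(1) t_pos[of n], of \<phi>] t_pos[of n]
    by (simp add: F_def[symmetric] H_def g_def)
  have front: "?p x \<in> U \<and> ?p x \<in> frontier \<Omega>" if "f (?p x) \<noteq> 0" for x
  proof -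
    have "?p x \<in> U" using \<delta>(2)[OF that] \<delta>(1) by auto
    then show ?thesis using frontier_chart_iff[OF chart _ open_domain, of "?p x"] by (simp add: gp(1,2))
  qed
  have Hlim: "(\<lambda>n. H n x) \<longlonglongrightarrow> f (?p x) * (S (?p x) \<bullet> N x)" if x: "x \<in> gdiff_set \<phi>" for x
  proof -
    define \<sigma> where "\<sigma> = S (?p x) \<bullet> N x"
    have D: "GDERIV \<phi> (?p x) :> gradient \<phi> x"
      using x gradient_translate(1)[of \<phi> e x, OF inv] gradient_translate(2)[of \<phi> e x, OF inv]
      unfolding gp(4) gdiff_set_def by auto
    have De: "gradient \<phi> x \<bullet> e = 0"
      using gradient_orthogonal[OF inv x] by (simp add: inner_commute)
    have "(\<lambda>n. H n x) \<longlonglongrightarrow> (\<integral>r. f (?p x) * (of_bool (r < \<sigma>) - of_bool (r < 0)) \<partial>lborel)"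
      unfolding H_def
    proof (rule integral_dominated_convergence[OF _ _ gbi])
      show "AE r in lborel. (\<lambda>n. g n x r) \<longlonglongrightarrow> f (?p x) * (of_bool (r < \<sigma>) - of_bool (r < 0))"
        using AE_lborel_singleton[of 0] AE_lborel_singleton[of \<sigma>]
      proof eventually_elim
        case (elim r)
        have "(\<lambda>n. ?p x + (t n * r) *\<^sub>R e) \<longlonglongrightarrow> ?p x + (0 * r) *\<^sub>R e"
          by (intro tendsto_intros t_lim)
        then have y: "(\<lambda>n. ?p x + (t n * r) *\<^sub>R e) \<longlonglongrightarrow> ?p x" by simp
        have "isCont f (?p x)" using f by (simp add: continuous_on_eq_continuous_at)
        then have fy: "(\<lambda>n. f (?p x + (t n * r) *\<^sub>R e)) \<longlonglongrightarrow> f (?p x)"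
          using y by (rule isCont_tendsto_compose)
        show ?case
        \<comment> \<open>Where \<open>f\<close> vanishes the graph point may lie outside
          \<open>U\<close>, and \<open>image_diff\<close> need not converge; its boundedness and the
          continuity of \<open>f\<close> suffice.\<close>
        proof (cases "f (?p x) = 0")
          case True
          have "(\<lambda>n. g n x r) \<longlonglongrightarrow> 0"
          proof (rule Lim_null_comparison)
            show "\<forall>\<^sub>F n in sequentially. norm (g n x r) \<le> \<bar>f (?p x + (t n * r) *\<^sub>R e)\<bar>"
              using mult_left_mono[OF abs_image_diff_le abs_ge_zero]
              by (intro always_eventually allI) (simp add: g_def F_def abs_mult)
            show "(\<lambda>n. \<bar>f (?p x + (t n * r) *\<^sub>R e)\<bar>) \<longlonglongrightarrow> 0"
              using tendsto_rabs[OF fy] True by simp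
          qed
          then show ?thesis using True by simp
        next
          case False
          have "\<forall>\<^sub>F n in sequentially. image_diff n (?p x + (t n * r) *\<^sub>R e) = of_bool (r < \<sigma>) - of_bool (r < 0)"
            using image_diff_tendsto[OF chart _ _ D De, of r] front[OF False] elim
            by (simp add: \<sigma>_def N_def)
          then have "(\<lambda>n. image_diff n (?p x + (t n * r) *\<^sub>R e)) \<longlonglongrightarrow> of_bool (r < \<sigma>) - of_bool (r < 0)"
            by (rule tendsto_eventually)
          then show ?thesis unfolding g_def F_def by (intro tendsto_mult fy)
        qed
      qed
      show "AE r in lborel. norm (g n x r) \<le> K * indicator {- M..M} r" for n
        using gb by auto
    qed measurable
    also have "(\<integral>r. f (?p x) * (of_bool (r < \<sigma>) - of_bool (r < 0)) \<partial>lborel) = f (?p x) * \<sigma>"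
      by (simp only: integral_mult_right_zero lborel_integral_step_diff)
    finally show ?thesis by (simp add: \<sigma>_def)
  qed
  have "(\<lambda>n. \<integral>x. indicator (slab e) x * H n x \<partial>lborel) \<longlonglongrightarrow>
      (\<integral>x. indicator (slab e) x * (f (?p x) * (S (?p x) \<bullet> N x)) \<partial>lborel)"
  proof (rule integral_dominated_convergence)
    show "integrable lborel (\<lambda>x. K * (2 * M) * indicator (cball 0 R) x)"
      by (intro integrable_mult_right integrable_real_indicator emeasure_bounded_finite) auto
    show "AE x in lborel. (\<lambda>n. indicator (slab e) x * H n x) \<longlonglongrightarrow> indicator (slab e) x * (f (?p x) * (S (?p x) \<bullet> N x))"
      using AE_gdiff_set[OF L] by eventually_elim (intro tendsto_intros Hlim)
    show "AE x in lborel. norm (indicator (slab e) x * H n x) \<le> K * (2 * M) * indicator (cball 0 R) x" for n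
      using H0 by auto
    \<comment> \<open>\<open>S\<close> is controlled on the frontier only. The cut-off field is
      Borel, and where \<open>f\<close> does not vanish the graph point lies on the frontier, so the
      integrand is unchanged.\<close>
    have "(\<lambda>y. indicator (frontier \<Omega>) y *\<^sub>R S y) \<in> borel_measurable borel"
      using S by (intro borel_measurable_continuous_on_indicator) auto
    note [measurable] = this
    have "(\<lambda>x. indicator (slab e) x * (f (?p x) * ((indicator (frontier \<Omega>) (?p x) *\<^sub>R S (?p x)) \<bullet> N x))) \<in> borel_measurable borel"
      by measurable
    also have "(\<lambda>x. indicator (slab e) x * (f (?p x) * ((indicator (frontier \<Omega>) (?p x) *\<^sub>R S (?p x)) \<bullet> N x)))
      = (\<lambda>x. indicator (slab e) x * (f (?p x) * (S (?p x) \<bullet> N x)))"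
      using front by (fastforce simp: indicator_def)
    finally show "(\<lambda>x. indicator (slab e) x * (f (?p x) * (S (?p x) \<bullet> N x))) \<in> borel_measurable lborel"
      by simp
  qed simp
  then show ?thesis unfolding quot N_def .
qed

end

text \<open>A limit does not see finitely many terms, and after a shift of the index
  \<open>C * t n < \<delta>\<close> holds throughout.\<close>

theorem (in perturbation) boundary_layer:
  assumes chart: "lipschitz_chart \<Omega> U e \<phi>" and f: "continuous_on UNIV f" and K: "\<And>y. \<bar>f y\<bar> \<le> K"
    and \<delta>: "\<delta> > 0" "\<And>y. f y \<noteq> 0 \<Longrightarrow> ball y \<delta> \<subseteq> U"
    and S: "continuous_on (frontier \<Omega>) S"
  shows "(\<lambda>n. (\<integral>y. f y * image_diff n y \<partial>lborel) / t n) \<longlonglongrightarrow>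
    (\<integral>x. indicator (slab e) x *
       (f (graph_point e \<phi> x) * (S (graph_point e \<phi> x) \<bullet> (e - gradient \<phi> x))) \<partial>lborel)"
proof -
  have "(\<lambda>n. C * t n) \<longlonglongrightarrow> C * 0" by (intro tendsto_intros t_lim)
  then have "\<forall>\<^sub>F n in sequentially. C * t n < \<delta>" using \<delta>(1) by (intro order_tendstoD(2)) auto
  then obtain k where k: "\<And>n. C * t (n + k) < \<delta>"
    unfolding eventually_sequentially by (metis le_add2)
  interpret shifted: perturbation \<Omega> "\<lambda>n. V (n + k)" "\<lambda>n. t (n + k)" S C
  proof
    show "(\<lambda>n. t (n + k)) \<longlonglongrightarrow> 0" by (rule LIMSEQ_ignore_initial_segment[OF t_lim])
    fix p and \<eta> :: real assume p: "p \<in> frontier \<Omega>" "\<eta> > 0"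
    obtain \<rho> where \<rho>: "\<rho> > 0" "\<forall>\<^sub>F n in sequentially. \<forall>x\<in>\<Omega> \<inter> ball p \<rho>. norm (V n x - x - t n *\<^sub>R S p) \<le> t n * \<eta>"
      using expansion[OF p] by blast
    with eventually_sequentially_seg[of "\<lambda>n. \<forall>x\<in>\<Omega> \<inter> ball p \<rho>. norm (V n x - x - t n *\<^sub>R S p) \<le> t n * \<eta>" k]
    show "\<exists>\<rho>>0. \<forall>\<^sub>F n in sequentially. \<forall>x\<in>\<Omega> \<inter> ball p \<rho>. norm (V (n + k) x - x - t (n + k) *\<^sub>R S p) \<le> t (n + k) * \<eta>"
      by blast
  qed (use open_domain bounded_domain t_pos cont_V open_V C_nonneg C_bound in auto)
  have eq: "shifted.image_diff n = image_diff (n + k)" for n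
    by (simp add: fun_eq_iff shifted.image_diff_def image_diff_def)
  show ?thesis
    by (rule LIMSEQ_offset[of _ k]) (rule shifted.boundary_layer_aux[OF chart f K \<delta> k S, unfolded eq])
qed

section \<open>Normals and surface measure\<close>

text \<open>Along \<open>w = n - n'\<close> one leaves \<Omega> according to \<open>n\<close> and
  enters it according to \<open>n'\<close>, because the products of \<open>w\<close> with the two
  unit vectors are opposite and nonzero.\<close>

lemma is_outer_normal_unique:
  fixes x :: "'a::euclidean_space"
  assumes n: "is_outer_normal \<Omega> x n" "is_outer_normal \<Omega> x n'"
  shows "n = n'"
proof (rule ccontr)
  assume "n \<noteq> n'"
  define w where "w = n - n'"
  have w: "norm w > 0" using \<open>n \<noteq> n'\<close> by (simp add: w_def)
  have nn: "n \<bullet> n = 1" "n' \<bullet> n' = 1"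
    using n by (auto simp: is_outer_normal_def power2_norm_eq_inner[symmetric])
  define a where "a = w \<bullet> w / 2"
  have a: "a > 0" using w by (simp add: a_def)
  have wn: "w \<bullet> n = a" "w \<bullet> n' = - a"
    using nn by (auto simp: a_def w_def inner_diff_left inner_diff_right inner_commute field_simps)
  \<comment> \<open>\<open>a / norm w\<close> is, up to sign, the slope of the direction
    \<open>w\<close> with respect to both normals; half of it keeps \<open>w\<close> strictly clear
    of the two undecided cones.\<close>
  define \<eta> where "\<eta> = a / (2 * norm w)"
  have \<eta>: "\<eta> > 0" using a w by (simp add: \<eta>_def)
  have "\<forall>\<^sub>F y in at x. ((y - x) \<bullet> n' < - \<eta> * norm (y - x) \<longrightarrow> y \<in> \<Omega>) \<and> ((y - x) \<bullet> n > \<eta> * norm (y - x) \<longrightarrow> y \<notin> \<Omega>)"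
    using n \<eta> unfolding is_outer_normal_def by (auto intro: eventually_conj elim!: eventually_mono)
  then obtain d where d: "d > 0" "\<And>y. y \<noteq> x \<Longrightarrow> dist y x < d \<Longrightarrow>
      ((y - x) \<bullet> n' < - \<eta> * norm (y - x) \<longrightarrow> y \<in> \<Omega>) \<and> ((y - x) \<bullet> n > \<eta> * norm (y - x) \<longrightarrow> y \<notin> \<Omega>)"
    unfolding eventually_at by auto
  define s where "s = d / (2 * norm w)"
  have s: "s > 0" using d w by (simp add: s_def)
  define y where "y = x + s *\<^sub>R w"
  have nyx: "norm (y - x) = d / 2" using s w by (simp add: y_def) (simp add: s_def)
  then have "y \<noteq> x" "dist y x < d" using d(1) by (auto simp: dist_norm)
  moreover have "\<eta> * norm (y - x) = s * a / 2"
    using w by (simp add: nyx \<eta>_def s_def)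
  moreover have "(y - x) \<bullet> n = s * a" "(y - x) \<bullet> n' = - (s * a)"
    using wn by (auto simp: y_def)
  moreover have "s * a > 0" using s a by simp
  ultimately show False using d(2)[of y] by simp
qed

lemma outer_normal_eq: "is_outer_normal \<Omega> x n \<Longrightarrow> outer_normal \<Omega> x = n"
  unfolding outer_normal_def using is_outer_normal_unique by (auto intro!: the_equality)

text \<open>The gradient is orthogonal to \<open>e\<close>, since \<phi> is constant along
  \<open>e\<close>. The norm identity ties the surface density to the length of the unnormalised
  normal.\<close>

lemma norm_chart_normal:
  assumes chart: "lipschitz_chart \<Omega> U e \<phi>" and x: "x \<in> gdiff_set \<phi>"
  shows "norm (e - gradient \<phi> x) = sqrt (1 + (norm (gradient \<phi> x))\<^sup>2)"
    and "e \<bullet> (e - gradient \<phi> x) = 1"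
proof -
  obtain L where e: "norm e = 1" "e \<bullet> e = 1" and inv: "\<And>x s. \<phi> (x + s *\<^sub>R e) = \<phi> x"
    by (rule lipschitz_chartD[OF chart]) blast
  have o: "e \<bullet> gradient \<phi> x = 0" by (rule gradient_orthogonal[OF inv x])
  then show "e \<bullet> (e - gradient \<phi> x) = 1" by (simp add: inner_diff_right e)
  have "(norm (e - gradient \<phi> x))\<^sup>2 = 1 + (norm (gradient \<phi> x))\<^sup>2"
    using o by (simp add: power2_norm_eq_inner inner_diff_left inner_diff_right e inner_commute)
  then show "norm (e - gradient \<phi> x) = sqrt (1 + (norm (gradient \<phi> x))\<^sup>2)"
    by (metis norm_ge_zero real_sqrt_unique)
qed

text \<open>The height \<open>y \<bullet> e - \<phi> y\<close>, whose sign decides membership in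
  \<Omega>, is \<open>(y - p) \<bullet> N\<close> up to a small multiple of the distance; outside
  the cone of opening \<eta> the linear term prevails.\<close>

lemma chart_outer_normal:
  assumes chart: "lipschitz_chart \<Omega> U e \<phi>" and "open \<Omega>" and p: "p \<in> U" "p \<in> frontier \<Omega>" and x: "p \<in> gdiff_set \<phi>"
  shows "is_outer_normal \<Omega> p ((e - gradient \<phi> p) /\<^sub>R norm (e - gradient \<phi> p))"
  unfolding is_outer_normal_def
proof (intro conjI allI impI)
  obtain L where U: "open U" and iff: "\<And>x. x \<in> U \<Longrightarrow> x \<in> \<Omega> \<longleftrightarrow> x \<bullet> e < \<phi> x"
    by (rule lipschitz_chartD[OF chart]) blast
  define N where "N = e - gradient \<phi> p"
  have Npos: "norm N > 0"
    unfolding N_def norm_chart_normal(1)[OF chart x] by (simp add: add_pos_nonneg)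
  then show "norm ((e - gradient \<phi> p) /\<^sub>R norm (e - gradient \<phi> p)) = 1" by (simp add: N_def)
  have pe: "p \<bullet> e = \<phi> p" using frontier_chart_iff[OF chart p(1) \<open>open \<Omega>\<close>] p(2) by simp
  fix \<eta> :: real assume "\<eta> > 0"
  then have pos: "\<eta> * norm N / 2 > 0" using Npos by simp
  have "GDERIV \<phi> p :> gradient \<phi> p" using x by (simp add: gdiff_set_def)
  from this[unfolded gderiv_def has_derivative_at_alt, THEN conjunct2, rule_format, OF pos]
  obtain d where d: "d > 0" "\<And>y. norm (y - p) < d \<Longrightarrow>
      \<bar>\<phi> y - \<phi> p - (y - p) \<bullet> gradient \<phi> p\<bar> \<le> \<eta> * norm N / 2 * norm (y - p)" by auto
  have "\<forall>\<^sub>F y in at p. y \<in> U" using eventually_at_in_open'[OF U p(1)] .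
  moreover have "\<forall>\<^sub>F y in at p. dist y p < d" using d(1) by (simp add: eventually_at) blast
  moreover have "\<forall>\<^sub>F y in at p. y \<noteq> p" by (simp add: eventually_at_filter)
  ultimately show "\<forall>\<^sub>F y in at p.
      ((y - p) \<bullet> ((e - gradient \<phi> p) /\<^sub>R norm (e - gradient \<phi> p)) < - \<eta> * norm (y - p) \<longrightarrow> y \<in> \<Omega>) \<and>
      ((y - p) \<bullet> ((e - gradient \<phi> p) /\<^sub>R norm (e - gradient \<phi> p)) > \<eta> * norm (y - p) \<longrightarrow> y \<notin> \<Omega>)"
  proof eventually_elim
    case (elim y)
    define h where "h = \<eta> * norm N * norm (y - p)"
    have h: "h > 0" using \<open>\<eta> > 0\<close> Npos elim(3) by (simp add: h_def)
    have "\<bar>\<phi> y - \<phi> p - (y - p) \<bullet> gradient \<phi> p\<bar> \<le> h / 2"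
      using d(2)[of y] elim(2) by (simp add: dist_norm h_def)
    moreover have "y \<bullet> e - \<phi> y = (y - p) \<bullet> N - (\<phi> y - \<phi> p - (y - p) \<bullet> gradient \<phi> p)"
      by (simp add: N_def inner_diff_left inner_diff_right pe)
    ultimately have *: "\<bar>(y \<bullet> e - \<phi> y) - (y - p) \<bullet> N\<bar> \<le> h / 2" by linarith
    have 1: "(y - p) \<bullet> (N /\<^sub>R norm N) < - \<eta> * norm (y - p) \<longleftrightarrow> (y - p) \<bullet> N < - h"
      using Npos by (simp add: h_def divide_simps mult_ac)
    have 2: "(y - p) \<bullet> (N /\<^sub>R norm N) > \<eta> * norm (y - p) \<longleftrightarrow> (y - p) \<bullet> N > h"
      using Npos by (simp add: h_def divide_simps mult_ac)
    show ?case
      unfolding N_def[symmetric] 1 2 using * h iff[OF elim(1)] by linarith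
  qed
qed

text \<open>If \<open>e \<bullet> n\<close> were negative, points slightly above the graph along
  \<open>e\<close> would lie in the cone that belongs to \<Omega>. The normal may come from another
  chart; this yields the sign of the weight between two charts.\<close>

lemma chart_normal_nonneg:
  assumes chart: "lipschitz_chart \<Omega> U e \<phi>" and "open \<Omega>" and p: "p \<in> U" "p \<in> frontier \<Omega>"
    and n: "is_outer_normal \<Omega> p n"
  shows "0 \<le> e \<bullet> n"
proof (rule ccontr)
  assume neg: "\<not> 0 \<le> e \<bullet> n"
  obtain L where U: "open U" and e: "norm e = 1" "e \<bullet> e = 1" and inv: "\<And>x s. \<phi> (x + s *\<^sub>R e) = \<phi> x"
    and iff: "\<And>x. x \<in> U \<Longrightarrow> x \<in> \<Omega> \<longleftrightarrow> x \<bullet> e < \<phi> x"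
    by (rule lipschitz_chartD[OF chart]) blast
  have pe: "p \<bullet> e = \<phi> p" using frontier_chart_iff[OF chart p(1) \<open>open \<Omega>\<close>] p(2) by simp
  define \<eta> where "\<eta> = - (e \<bullet> n) / 2"
  have \<eta>: "\<eta> > 0" using neg by (simp add: \<eta>_def)
  have "\<forall>\<^sub>F y in at p. (y - p) \<bullet> n < - \<eta> * norm (y - p) \<longrightarrow> y \<in> \<Omega>"
    using n \<eta> unfolding is_outer_normal_def by (auto elim!: eventually_mono)
  moreover have "\<forall>\<^sub>F y in at p. y \<in> U" using eventually_at_in_open'[OF U p(1)] .
  ultimately have "\<forall>\<^sub>F y in at p. y \<in> U \<and> ((y - p) \<bullet> n < - \<eta> * norm (y - p) \<longrightarrow> y \<in> \<Omega>)"
    by eventually_elim auto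
  then obtain d where d: "d > 0" "\<And>y. y \<noteq> p \<Longrightarrow> dist y p < d \<Longrightarrow> y \<in> U \<and> ((y - p) \<bullet> n < - \<eta> * norm (y - p) \<longrightarrow> y \<in> \<Omega>)"
    unfolding eventually_at by auto
  define y where "y = p + (d / 2) *\<^sub>R e"
  have y: "norm (y - p) = d / 2" using d(1) e by (simp add: y_def)
  then have "y \<noteq> p" "dist y p < d" using d(1) by (auto simp: dist_norm)
  moreover have "(y - p) \<bullet> n < - \<eta> * norm (y - p)"
    unfolding y using d(1) neg by (simp add: y_def \<eta>_def field_simps mult_less_0_iff)
  ultimately have "y \<in> U" "y \<in> \<Omega>" using d(2)[of y] by auto
  then have "y \<bullet> e < \<phi> y" using iff by blast
  then show False using d(1) by (simp add: y_def inv inner_add_left pe e)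
qed

text \<open>For translations by multiples of \<open>v\<close> the layer quotient does not mention a
  chart, so the limits computed in the two charts coincide. The expansion holds with velocity
  \<open>v\<close> and no remainder.\<close>

lemma chart_flux_intrinsic:
  fixes \<Omega> :: "'a::euclidean_space set"
  assumes \<Omega>: "open \<Omega>" "bounded \<Omega>"
    and chart: "lipschitz_chart \<Omega> U e \<phi>" and chart': "lipschitz_chart \<Omega> U' e' \<phi>'"
    and f: "continuous_on UNIV f" and K: "\<And>y. \<bar>f y\<bar> \<le> K"
    and \<delta>: "\<delta> > 0" "\<And>y. f y \<noteq> 0 \<Longrightarrow> ball y \<delta> \<subseteq> U \<inter> U'"
  shows "(\<integral>x. indicator (slab e) x * (f (graph_point e \<phi> x) * (v \<bullet> (e - gradient \<phi> x))) \<partial>lborel) =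
    (\<integral>x. indicator (slab e') x * (f (graph_point e' \<phi>' x) * (v \<bullet> (e' - gradient \<phi>' x))) \<partial>lborel)"
proof -
  define t where "t n = 1 / (real n + 1)" for n
  interpret perturbation \<Omega> "\<lambda>n x. x + t n *\<^sub>R v" t "\<lambda>_. v" "norm v"
  proof
    show "open ((\<lambda>x. x + t n *\<^sub>R v) ` \<Omega>)" for n
      using open_translation[OF \<Omega>(1), of "t n *\<^sub>R v"] by (simp add: add.commute)
    show "t \<longlonglongrightarrow> 0" unfolding t_def by (rule tendsto_harmonic)
    show "t n > 0" for n by (simp add: t_def)
    then show "norm (x + t n *\<^sub>R v - x) \<le> norm v * t n" for n x by (simp add: less_imp_le)
    show "continuous_on \<Omega> (\<lambda>x. x + t n *\<^sub>R v)" for n by (intro continuous_intros)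
    fix \<eta> :: real assume "\<eta> > 0"
    then show "\<exists>\<rho>>0. \<forall>\<^sub>F n in sequentially. \<forall>x\<in>\<Omega> \<inter> ball p \<rho>. norm (x + t n *\<^sub>R v - x - t n *\<^sub>R v) \<le> t n * \<eta>" for p
      by (intro exI[of _ 1]) (auto simp: t_def)
  qed (use \<Omega> in auto)
  show ?thesis
    by (rule LIMSEQ_unique[OF boundary_layer[OF chart f K \<delta>(1)] boundary_layer[OF chart' f K \<delta>(1)]])
      (use \<delta>(2) in auto)
qed

text \<open>The functions are \<open>real (Suc k) * d y - 1\<close> clipped to the unit interval,
  with \<open>d\<close> the distance to the complement. A nonzero value forces
  \<open>d y > 1 / real (Suc k)\<close>, which is the margin that \<open>boundary_layer\<close>
  requires.\<close>

lemma open_cutoff_sequence: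
  fixes W :: "'a::euclidean_space set"
  assumes W: "open W"
  obtains f :: "nat \<Rightarrow> 'a \<Rightarrow> real" where
    "\<And>k. continuous_on UNIV (f k)" "\<And>k y. 0 \<le> f k y" "\<And>k y. f k y \<le> 1"
    "\<And>k. \<exists>\<delta>>0. \<forall>y. f k y \<noteq> 0 \<longrightarrow> ball y \<delta> \<subseteq> W"
    "\<And>y. incseq (\<lambda>k. f k y)" "\<And>y. (\<lambda>k. f k y) \<longlonglongrightarrow> indicator W y"
proof (cases "W = UNIV")
  case True
  \<comment> \<open>\<open>infdist\<close> to the empty set is 0 by convention, so the whole space
    is treated apart.\<close>
  show ?thesis by (rule that[of "\<lambda>_ _. 1"]) (auto simp: True incseq_def intro: exI[of _ 1])
next
  case False
  then have ne: "- W \<noteq> {}" by auto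
  define d where "d y = infdist y (- W)" for y
  have d0: "d y \<ge> 0" for y by (simp add: d_def infdist_nonneg)
  have dW: "y \<in> W \<longleftrightarrow> d y > 0" for y
    using in_closed_iff_infdist_zero[of "- W" y] W ne d0[of y] by (auto simp: d_def closed_open)
  define f where "f k y = min 1 (max 0 (real (Suc k) * d y - 1))" for k y
  have [continuous_intros]: "continuous_on UNIV d" unfolding d_def by (intro continuous_intros)
  show ?thesis
  proof (rule that[of f])
    show "continuous_on UNIV (f k)" for k unfolding f_def by (intro continuous_intros)
    show "0 \<le> f k y" "f k y \<le> 1" for k y by (auto simp: f_def)
    show "\<exists>\<delta>>0. \<forall>y. f k y \<noteq> 0 \<longrightarrow> ball y \<delta> \<subseteq> W" for k
    proof (intro exI[of _ "1 / real (Suc k)"] conjI allI impI subsetI)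
      fix y z assume y: "f k y \<noteq> 0" and z: "z \<in> ball y (1 / real (Suc k))"
      have "1 < real (Suc k) * d y" using y by (auto simp: f_def)
      then have "1 / real (Suc k) < d y" by (simp add: field_simps)
      then show "z \<in> W" using infdist_le[of z "- W" y] z by (force simp: d_def)
    qed simp
    show "incseq (\<lambda>k. f k y)" for y
    proof (rule incseq_SucI)
      fix k
      have "real (Suc k) * d y \<le> real (Suc (Suc k)) * d y" using d0 by (intro mult_right_mono) auto
      then show "f k y \<le> f (Suc k) y" by (simp add: f_def)
    qed
    show "(\<lambda>k. f k y) \<longlonglongrightarrow> indicator W y" for y
    proof (cases "y \<in> W")
      case True
      then have dy: "d y > 0" using dW by blast
      obtain m :: nat where m: "2 / d y < real m" using reals_Archimedean2 by blast
      have "f k y = 1" if "m \<le> k" for k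
      proof -
        have "2 / d y < real (Suc k)" using m that by simp
        then have "2 < real (Suc k) * d y" using dy by (simp add: field_simps)
        then show ?thesis by (simp add: f_def)
      qed
      then have "\<forall>\<^sub>F k in sequentially. f k y = 1" unfolding eventually_sequentially by blast
      then show ?thesis using True by (simp add: tendsto_eventually)
    next
      case False
      then have "d y = 0" using dW d0[of y] by force
      then show ?thesis using False by (simp add: f_def)
    qed
  qed
qed

text \<open>Translation in the direction \<open>e\<close> has flux density \<open>e \<bullet> (e - \<nabla>\<phi>) = 1\<close> in the first chart.\<close>

lemma chart_weight_transfer:
  fixes \<Omega> :: "'a::euclidean_space set"
  assumes \<Omega>: "open \<Omega>" "bounded \<Omega>"
    and chart: "lipschitz_chart \<Omega> U e \<phi>" and chart': "lipschitz_chart \<Omega> U' e' \<phi>'"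
    and g [measurable]: "g \<in> borel_measurable borel" and gU: "\<And>y. y \<notin> U \<inter> U' \<Longrightarrow> g y = (0::ennreal)"
  shows "(\<integral>\<^sup>+x. indicator (slab e) x * g (graph_point e \<phi> x) \<partial>lborel) =
    (\<integral>\<^sup>+x. indicator (slab e') x * (ennreal (e \<bullet> (e' - gradient \<phi>' x)) * g (graph_point e' \<phi>' x)) \<partial>lborel)"
proof -
  obtain L where L: "L-lipschitz_on UNIV \<phi>" and cont: "continuous_on UNIV \<phi>"
    and U: "open U" and e: "norm e = 1" "e \<bullet> e = 1" and inv: "\<And>x s. \<phi> (x + s *\<^sub>R e) = \<phi> x"
    by (rule lipschitz_chartD[OF chart]) blast
  obtain L' where L': "L'-lipschitz_on UNIV \<phi>'" and cont': "continuous_on UNIV \<phi>'"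
    and U': "open U'" and e': "norm e' = 1" "e' \<bullet> e' = 1" and inv': "\<And>x s. \<phi>' (x + s *\<^sub>R e') = \<phi>' x"
    by (rule lipschitz_chartD[OF chart']) blast
  have [measurable]: "\<phi> \<in> borel_measurable borel" "\<phi>' \<in> borel_measurable borel"
    using cont cont' by (auto intro: borel_measurable_continuous_onI)
  note [measurable] = borel_measurable_gradient[OF cont']
  let ?p = "graph_point e \<phi>" and ?p' = "graph_point e' \<phi>'"
  define G where "G = U \<inter> U'"
  have G: "open G" using U U' by (auto simp: G_def)
  then have [measurable]: "G \<in> sets borel" by simp
  have front: "?p x \<in> frontier \<Omega>" if "?p x \<in> G" for x
    using frontier_chart_iff[OF chart _ \<Omega>(1), of "?p x"] that graph_point_inner(1,2)[OF e(2) inv, of x] by (auto simp: G_def)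
  have front': "?p' x \<in> frontier \<Omega>" if "?p' x \<in> G" for x
    using frontier_chart_iff[OF chart' _ \<Omega>(1), of "?p' x"] that graph_point_inner(1,2)[OF e'(2) inv', of x] by (auto simp: G_def)
  obtain B where B: "\<And>y. y \<in> frontier \<Omega> \<Longrightarrow> norm y \<le> B"
    using compact_imp_bounded[OF compact_frontier_bounded[OF \<Omega>(2)]] unfolding bounded_iff by blast
  have slab_bound: "norm x \<le> 2 * B + 1"
    if "norm d = 1" "x \<in> slab d" "norm (graph_point d \<psi> x) \<le> B" for d x :: 'a and \<psi>
    using norm_le_graph_point[OF that(1,2), of \<psi>] that(3) by simp
  define w where "w x = e \<bullet> (e' - gradient \<phi>' x)" for x
  have [measurable]: "w \<in> borel_measurable borel" unfolding w_def by measurable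
  have wb: "AE x in lborel. \<bar>w x\<bar> \<le> 1 + L'"
    using AE_gdiff_set[OF L']
  proof eventually_elim
    case (elim x)
    have "\<bar>w x\<bar> \<le> norm (e' - gradient \<phi>' x)" using Cauchy_Schwarz_ineq2[of e] e by (simp add: w_def)
    also have "\<dots> \<le> 1 + L'" using norm_gradient_le[OF L' elim] norm_triangle_ineq4[of e' "gradient \<phi>' x"] e' by simp
    finally show ?case .
  qed
  \<comment> \<open>\<open>ennreal\<close> sends negative reals to 0, so the weight has to be
    nonnegative where it counts. It is a positive multiple of \<open>e \<bullet> n\<close> for the
    normal \<open>n\<close> read off in the second chart, and the first chart forces its
    sign.\<close>
  have wn: "AE x in lborel. ?p' x \<in> G \<longrightarrow> 0 \<le> w x"
    using AE_gdiff_set[OF L']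
  proof eventually_elim
    case (elim x)
    show ?case
    proof
      assume G': "?p' x \<in> G"
      let ?N = "e' - gradient \<phi>' x"
      have fr: "?p' x \<in> frontier \<Omega>" by (rule front'[OF G'])
      have gd: "?p' x \<in> gdiff_set \<phi>'" "gradient \<phi>' (?p' x) = gradient \<phi>' x"
        using elim gradient_translate[of \<phi>' e' x, OF inv'] by (auto simp: graph_point_def)
      have "is_outer_normal \<Omega> (?p' x) (?N /\<^sub>R norm ?N)"
        using chart_outer_normal[OF chart' \<Omega>(1) _ fr gd(1)] G' by (auto simp: gd G_def)
      from chart_normal_nonneg[OF chart \<Omega>(1) _ fr this]
      have "0 \<le> w x / norm ?N" using G' by (simp add: G_def w_def divide_inverse mult.commute)
      moreover have "norm ?N > 0" unfolding norm_chart_normal(1)[OF chart' elim] by (simp add: add_pos_nonneg)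
      ultimately show "0 \<le> w x" by (simp add: zero_le_divide_iff)
    qed
  qed
  \<comment> \<open>Both sides become integrals against measures concentrated on \<open>G\<close>.
    They agree for continuous cut-offs by comparison of fluxes, hence for open sets by monotone
    convergence, hence for Borel sets since \<open>M1\<close> is finite.\<close>
  define M1 where "M1 = distr (density lborel (\<lambda>x. indicator (slab e) x * indicator G (?p x))) borel ?p"
  define M2 where "M2 = distr (density lborel (\<lambda>x. indicator (slab e') x * (ennreal (w x) * indicator G (?p' x)))) borel ?p'"
  have nn1: "(\<integral>\<^sup>+y. h y \<partial>M1) = (\<integral>\<^sup>+x. indicator (slab e) x * (indicator G (?p x) * h (?p x)) \<partial>lborel)"
    if [measurable]: "h \<in> borel_measurable borel" for h
    unfolding M1_def by (simp add: nn_integral_distr nn_integral_density mult.assoc)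
  have nn2: "(\<integral>\<^sup>+y. h y \<partial>M2) = (\<integral>\<^sup>+x. indicator (slab e') x * (ennreal (w x) * (indicator G (?p' x) * h (?p' x))) \<partial>lborel)"
    if [measurable]: "h \<in> borel_measurable borel" for h
    unfolding M2_def by (simp add: nn_integral_distr nn_integral_density mult.assoc)
  have cut: "(\<integral>\<^sup>+y. ennreal (f y) \<partial>M1) = (\<integral>\<^sup>+y. ennreal (f y) \<partial>M2) \<and> (\<integral>\<^sup>+y. ennreal (f y) \<partial>M1) < \<infinity>"
    if f: "continuous_on UNIV f" "\<And>y. 0 \<le> f y" "\<And>y. f y \<le> 1"
      and \<delta>: "\<delta> > 0" "\<And>y. f y \<noteq> 0 \<Longrightarrow> ball y \<delta> \<subseteq> G" for f :: "'a \<Rightarrow> real" and \<delta>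
  proof -
    have [measurable]: "f \<in> borel_measurable borel" using f(1) by (rule borel_measurable_continuous_onI)
    have fG: "f y \<noteq> 0 \<Longrightarrow> y \<in> G" for y using \<delta> by (meson centre_in_ball subsetD)
    then have fG0: "y \<notin> G \<Longrightarrow> f y = 0" for y by blast
    have ib: "integrable lborel (\<lambda>x. c * indicator (cball 0 (2 * B + 1)) x)" for c :: real
      by (intro integrable_mult_right integrable_real_indicator emeasure_bounded_finite) auto
    have sup1: "f (?p x) \<noteq> 0 \<Longrightarrow> x \<in> slab e \<Longrightarrow> x \<in> cball 0 (2 * B + 1)" for x
      using slab_bound[OF e(1) _ B[OF front[OF fG]]] by simp
    have sup2: "f (?p' x) \<noteq> 0 \<Longrightarrow> x \<in> slab e' \<Longrightarrow> x \<in> cball 0 (2 * B + 1)" for x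
      using slab_bound[OF e'(1) _ B[OF front'[OF fG]]] by simp
    have i1: "integrable lborel (\<lambda>x. indicator (slab e) x * f (?p x))"
    proof (rule Bochner_Integration.integrable_bound[OF ib[of 1]])
      have "norm (indicator (slab e) x * f (?p x)) \<le> norm (1 * indicator (cball 0 (2 * B + 1)) x :: real)" for x
        using f(2,3)[of "?p x"] sup1[of x] by (cases "f (?p x) = 0") (auto simp: indicator_def)
      then show "AE x in lborel. norm (indicator (slab e) x * f (?p x)) \<le> norm (1 * indicator (cball 0 (2 * B + 1)) x :: real)"
        by simp
    qed measurable
    have i2: "integrable lborel (\<lambda>x. indicator (slab e') x * (f (?p' x) * w x))"
    proof (rule Bochner_Integration.integrable_bound[OF ib[of "1 + L'"]])
      show "AE x in lborel. norm (indicator (slab e') x * (f (?p' x) * w x)) \<le> norm ((1 + L') * indicator (cball 0 (2 * B + 1)) x :: real)"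
        using wb
      proof eventually_elim
        case (elim x)
        have "\<bar>f (?p' x) * w x\<bar> \<le> 1 * (1 + L')"
          unfolding abs_mult using f elim by (intro mult_mono) auto
        then show ?case using sup2[of x] by (cases "f (?p' x) = 0") (auto simp: indicator_def)
      qed
    qed measurable
    have "(\<integral>\<^sup>+y. ennreal (f y) \<partial>M1) = (\<integral>\<^sup>+x. ennreal (indicator (slab e) x * f (?p x)) \<partial>lborel)"
      using fG0 by (subst nn1) (auto intro!: nn_integral_cong simp: indicator_def)
    also have "\<dots> = ennreal (\<integral>x. indicator (slab e) x * f (?p x) \<partial>lborel)"
      using i1 f by (intro nn_integral_eq_integral) auto
    finally have 1: "(\<integral>\<^sup>+y. ennreal (f y) \<partial>M1) = ennreal (\<integral>x. indicator (slab e) x * f (?p x) \<partial>lborel)" .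
    have "(\<integral>\<^sup>+y. ennreal (f y) \<partial>M2) = (\<integral>\<^sup>+x. ennreal (indicator (slab e') x * (f (?p' x) * w x)) \<partial>lborel)"
    proof (subst nn2, simp, rule nn_integral_cong_AE)
      show "AE x in lborel. indicator (slab e') x * (ennreal (w x) * (indicator G (?p' x) * ennreal (f (?p' x)))) =
           ennreal (indicator (slab e') x * (f (?p' x) * w x))"
        using wn
      proof eventually_elim
        case (elim x)
        then show ?case
          using f(2)[of "?p' x"] fG[of "?p' x"]
          by (cases "f (?p' x) = 0") (auto simp: indicator_def ennreal_mult mult.commute)
      qed
    qed
    also have "\<dots> = ennreal (\<integral>x. indicator (slab e') x * (f (?p' x) * w x) \<partial>lborel)"
    proof (rule nn_integral_eq_integral[OF i2])
      show "AE x in lborel. 0 \<le> indicator (slab e') x * (f (?p' x) * w x)"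
        using wn
      proof eventually_elim
        case (elim x)
        then show ?case using f(2)[of "?p' x"] fG[of "?p' x"] by (cases "f (?p' x) = 0") auto
      qed
    qed
    also have "(\<integral>x. indicator (slab e') x * (f (?p' x) * w x) \<partial>lborel) =
        (\<integral>x. indicator (slab e) x * (f (?p x) * (e \<bullet> (e - gradient \<phi> x))) \<partial>lborel)"
      unfolding w_def
      by (rule chart_flux_intrinsic[OF \<Omega> chart chart' f(1) _ \<delta>(1), symmetric, where K=1])
        (use f \<delta>(2) in \<open>auto simp: G_def\<close>)
    also have "\<dots> = (\<integral>x. indicator (slab e) x * f (?p x) \<partial>lborel)"
    proof (rule integral_cong_AE)
      note [measurable] = borel_measurable_gradient[OF cont]
      show "(\<lambda>x. indicator (slab e) x * (f (?p x) * (e \<bullet> (e - gradient \<phi> x)))) \<in> borel_measurable lborel"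
        by measurable
      show "(\<lambda>x. indicator (slab e) x * f (?p x)) \<in> borel_measurable lborel" by measurable
      show "AE x in lborel. indicator (slab e) x * (f (?p x) * (e \<bullet> (e - gradient \<phi> x))) = indicator (slab e) x * f (?p x)"
        using AE_gdiff_set[OF L] by eventually_elim (simp add: norm_chart_normal(2)[OF chart])
    qed
    finally show ?thesis unfolding 1 by simp
  qed
  have eqW: "emeasure M1 W = emeasure M2 W" if "open W" for W
  proof -
    have [measurable]: "W \<in> sets borel" using that by simp
    have "open (W \<inter> G)" using that G by auto
    then obtain f :: "nat \<Rightarrow> 'a \<Rightarrow> real" where f: "\<And>k. continuous_on UNIV (f k)" "\<And>k y. 0 \<le> f k y" "\<And>k y. f k y \<le> 1"
      "\<And>k. \<exists>\<delta>>0. \<forall>y. f k y \<noteq> 0 \<longrightarrow> ball y \<delta> \<subseteq> W \<inter> G"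
      "\<And>y. incseq (\<lambda>k. f k y)" "\<And>y. (\<lambda>k. f k y) \<longlonglongrightarrow> indicator (W \<inter> G) y"
      by (rule open_cutoff_sequence) blast
    have [measurable]: "f k \<in> borel_measurable borel" for k using f(1) by (rule borel_measurable_continuous_onI)
    have lim: "(\<lambda>k. \<integral>\<^sup>+y. ennreal (f k y) \<partial>M) \<longlonglongrightarrow> (\<integral>\<^sup>+y. ennreal (indicator (W \<inter> G) y) \<partial>M)"
      if "sets M = sets borel" for M
    proof (rule nn_integral_LIMSEQ)
      show "incseq (\<lambda>k y. ennreal (f k y))"
        using f(5) by (auto simp: incseq_def le_fun_def intro: ennreal_leI)
      show "(\<lambda>k. ennreal (f k y)) \<longlonglongrightarrow> ennreal (indicator (W \<inter> G) y)" for y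
        using f(6) by (rule tendsto_ennrealI)
      show "(\<lambda>y. ennreal (f k y)) \<in> borel_measurable M" for k
        unfolding measurable_cong_sets[OF that refl] by measurable
    qed
    have eq: "(\<integral>\<^sup>+y. ennreal (f k y) \<partial>M1) = (\<integral>\<^sup>+y. ennreal (f k y) \<partial>M2)" for k
      using f(4)[of k] cut[OF f(1,2,3), of _ k] by auto
    have "(\<integral>\<^sup>+y. ennreal (indicator (W \<inter> G) y) \<partial>M1) = (\<integral>\<^sup>+y. ennreal (indicator (W \<inter> G) y) \<partial>M2)"
      by (rule LIMSEQ_unique[OF lim[of M1, unfolded eq] lim[of M2]]) (auto simp: M1_def M2_def)
    moreover have "(\<integral>\<^sup>+y. ennreal (indicator (W \<inter> G) y) \<partial>M) = emeasure M (W \<inter> G)" if "sets M = sets borel" for M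
      using that by (simp add: ennreal_indicator nn_integral_indicator)
    ultimately have "emeasure M1 (W \<inter> G) = emeasure M2 (W \<inter> G)" by (simp add: M1_def M2_def)
    moreover have "emeasure M1 W = emeasure M1 (W \<inter> G)"
    proof -
      have "emeasure M1 W = (\<integral>\<^sup>+y. indicator W y \<partial>M1)" by (simp add: M1_def)
      also have "\<dots> = (\<integral>\<^sup>+y. indicator (W \<inter> G) y \<partial>M1)"
        by (subst (1 2) nn1) (auto intro!: nn_integral_cong simp: indicator_def)
      finally show ?thesis by (simp add: M1_def)
    qed
    moreover have "emeasure M2 W = emeasure M2 (W \<inter> G)"
    proof -
      have "emeasure M2 W = (\<integral>\<^sup>+y. indicator W y \<partial>M2)" by (simp add: M2_def)
      also have "\<dots> = (\<integral>\<^sup>+y. indicator (W \<inter> G) y \<partial>M2)"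
        by (subst (1 2) nn2) (auto intro!: nn_integral_cong simp: indicator_def)
      finally show ?thesis by (simp add: M2_def)
    qed
    ultimately show ?thesis by simp
  qed
  \<comment> \<open>Graph points in \<open>G\<close> lie on the bounded frontier, so only a bounded
    part of the slab contributes.\<close>
  have fin1: "emeasure M1 UNIV \<noteq> \<infinity>"
  proof -
    have "emeasure M1 UNIV = (\<integral>\<^sup>+y. 1 \<partial>M1)" by (simp add: M1_def)
    also have "\<dots> = (\<integral>\<^sup>+x. indicator (slab e) x * (indicator G (?p x) * 1) \<partial>lborel)"
      by (rule nn1) simp
    also have "\<dots> \<le> (\<integral>\<^sup>+x. indicator (cball (0::'a) (2 * B + 1)) x \<partial>lborel)"
      by (rule nn_integral_mono) (use slab_bound[OF e(1) _ B[OF front]] in \<open>auto simp: indicator_def\<close>)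
    also have "\<dots> < \<infinity>" using emeasure_bounded_finite[OF bounded_cball, of "0::'a" "2 * B + 1"] by simp
    finally show ?thesis by simp
  qed
  have "M1 = M2"
  proof (rule measure_eqI_generator_eq[where E="{W. open W}" and \<Omega>=UNIV and A="\<lambda>_. UNIV"])
    show "Int_stable {W::'a set. open W}" by (auto simp: Int_stable_def)
    show "sets M1 = sigma_sets UNIV {W. open W}" "sets M2 = sigma_sets UNIV {W. open W}"
      by (simp_all add: M1_def M2_def borel_def)
  qed (use eqW fin1 in auto)
  then have "(\<integral>\<^sup>+y. g y \<partial>M1) = (\<integral>\<^sup>+y. g y \<partial>M2)" by simp
  moreover have "indicator G y * g y = g y" for y using gU[of y] by (auto simp: G_def indicator_def)
  ultimately show ?thesis unfolding nn1[OF g] nn2[OF g] w_def by simp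
qed

section \<open>The surface measure\<close>

text \<open>The area measure of the entire graph, pushed forward from the slab. Outside
  \<open>U\<close> the graph is unrelated to \<Omega>, so the comparison with the surface measure is
  restricted to subsets of \<open>frontier \<Omega> \<inter> U\<close>.\<close>

definition graph_measure :: "'a::euclidean_space \<Rightarrow> ('a \<Rightarrow> real) \<Rightarrow> 'a measure" where
  "graph_measure e \<phi> = distr
     (density lborel (\<lambda>x. indicator (slab e) x * ennreal (sqrt (1 + (norm (gradient \<phi> x))\<^sup>2))))
     borel (graph_point e \<phi>)"

lemma sets_graph_measure [simp, measurable_cong]: "sets (graph_measure e \<phi>) = sets borel"
  by (simp add: graph_measure_def)

lemma nn_integral_graph_measure:
  fixes e :: "'a::euclidean_space"
  assumes \<phi>: "continuous_on UNIV \<phi>" and [measurable]: "g \<in> borel_measurable borel"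
  shows "(\<integral>\<^sup>+y. g y \<partial>graph_measure e \<phi>) =
    (\<integral>\<^sup>+x. indicator (slab e) x * (ennreal (sqrt (1 + (norm (gradient \<phi> x))\<^sup>2)) * g (graph_point e \<phi> x)) \<partial>lborel)"
proof -
  have [measurable]: "\<phi> \<in> borel_measurable borel" using \<phi> by (rule borel_measurable_continuous_onI)
  note [measurable] = borel_measurable_gradient[OF \<phi>]
  show ?thesis
    unfolding graph_measure_def by (simp add: nn_integral_distr nn_integral_density mult.assoc)
qed

lemma integral_graph_measure:
  fixes e :: "'a::euclidean_space" and g :: "'a \<Rightarrow> real"
  assumes \<phi>: "continuous_on UNIV \<phi>" and [measurable]: "g \<in> borel_measurable borel"
  shows "(\<integral>y. g y \<partial>graph_measure e \<phi>) =
    (\<integral>x. indicator (slab e) x * (sqrt (1 + (norm (gradient \<phi> x))\<^sup>2) * g (graph_point e \<phi> x)) \<partial>lborel)"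
proof -
  have [measurable]: "\<phi> \<in> borel_measurable borel" using \<phi> by (rule borel_measurable_continuous_onI)
  note [measurable] = borel_measurable_gradient[OF \<phi>]
  have eq: "indicator (slab e) x * ennreal (sqrt (1 + (norm (gradient \<phi> x))\<^sup>2)) =
      ennreal (indicator (slab e) x * sqrt (1 + (norm (gradient \<phi> x))\<^sup>2))" for x
    by (simp add: indicator_def)
  show ?thesis
    unfolding graph_measure_def eq
    by (simp add: integral_distr integral_density mult.assoc)
qed

lemma emeasure_graph_measure_slab:
  fixes e :: "'a::euclidean_space"
  assumes \<phi>: "continuous_on UNIV \<phi>" and A [measurable]: "A \<in> sets borel"
  shows "emeasure (graph_measure e \<phi>) A =
    (\<integral>\<^sup>+ x \<in> {x. 0 \<le> x \<bullet> e \<and> x \<bullet> e \<le> 1}.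
                indicator A (x + (\<phi> x - x \<bullet> e) *\<^sub>R e)
                  * ennreal (sqrt (1 + (norm (gradient \<phi> x))\<^sup>2)) \<partial>lebesgue)"
proof -
  have "emeasure (graph_measure e \<phi>) A = (\<integral>\<^sup>+y. indicator A y \<partial>graph_measure e \<phi>)" by simp
  also have "\<dots> = (\<integral>\<^sup>+ x. indicator A (x + (\<phi> x - x \<bullet> e) *\<^sub>R e)
        * ennreal (sqrt (1 + (norm (gradient \<phi> x))\<^sup>2)) * indicator {x. 0 \<le> x \<bullet> e \<and> x \<bullet> e \<le> 1} x \<partial>lborel)"
    by (subst nn_integral_graph_measure[OF \<phi>])
      (auto intro!: nn_integral_cong simp: graph_point_def slab_def mult_ac)
  finally show ?thesis by (simp add: nn_integral_completion)
qed

lemma is_surface_measure_iff: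
  "is_surface_measure \<Omega> \<sigma> \<longleftrightarrow> sets \<sigma> = sets borel \<and> emeasure \<sigma> (- frontier \<Omega>) = 0 \<and>
     (\<forall>U e \<phi>. lipschitz_chart \<Omega> U e \<phi> \<longrightarrow>
        (\<forall>A \<in> sets borel. A \<subseteq> frontier \<Omega> \<inter> U \<longrightarrow> emeasure \<sigma> A = emeasure (graph_measure e \<phi>) A))"
proof -
  have cont: "continuous_on UNIV \<phi>" if "lipschitz_chart \<Omega> U e \<phi>" for U e \<phi>
    using that by (rule lipschitz_chartD)
  show ?thesis
    unfolding is_surface_measure_def
    by (intro conj_cong refl iff_allI imp_cong ball_cong) (auto simp: emeasure_graph_measure_slab dest: cont)
qed

lemma graph_measure_gradient_point:
  assumes chart: "lipschitz_chart \<Omega> U e \<phi>"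
  shows "gradient \<phi> (graph_point e \<phi> x) = gradient \<phi> x" "graph_point e \<phi> x \<in> gdiff_set \<phi> \<longleftrightarrow> x \<in> gdiff_set \<phi>"
proof -
  obtain L where inv: "\<And>x s. \<phi> (x + s *\<^sub>R e) = \<phi> x"
    by (rule lipschitz_chartD[OF chart]) blast
  show "gradient \<phi> (graph_point e \<phi> x) = gradient \<phi> x" "graph_point e \<phi> x \<in> gdiff_set \<phi> \<longleftrightarrow> x \<in> gdiff_set \<phi>"
    unfolding graph_point_def by (rule gradient_translate[OF inv])+
qed

text \<open>Where both functions are differentiable, the two charts give the same unit normal. Its
  product with \<open>e\<close> is \<open>1 / \<nu> q\<close> in one chart and
  \<open>(e \<bullet> N') / \<nu>' q\<close> in the other, so the transfer weight
  \<open>e \<bullet> N'\<close> turns the density \<nu> into \<open>\<nu>'\<close>.\<close>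

lemma graph_measure_unique:
  fixes \<Omega> :: "'a::euclidean_space set"
  assumes \<Omega>: "open \<Omega>" "bounded \<Omega>"
    and chart: "lipschitz_chart \<Omega> U e \<phi>" and chart': "lipschitz_chart \<Omega> U' e' \<phi>'"
    and A: "A \<in> sets borel" "A \<subseteq> frontier \<Omega> \<inter> (U \<inter> U')"
  shows "emeasure (graph_measure e \<phi>) A = emeasure (graph_measure e' \<phi>') A"
proof -
  note [measurable] = A(1)
  have cont: "continuous_on UNIV \<phi>" by (rule lipschitz_chartD[OF chart])
  have cont': "continuous_on UNIV \<phi>'" by (rule lipschitz_chartD[OF chart'])
  obtain L where L: "L-lipschitz_on UNIV \<phi>" by (rule lipschitz_chartD[OF chart])
  obtain L' where L': "L'-lipschitz_on UNIV \<phi>'" by (rule lipschitz_chartD[OF chart'])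
  note [measurable] = borel_gdiff_set[OF cont] borel_gdiff_set[OF cont'] borel_measurable_gradient[OF cont] borel_measurable_gradient[OF cont']
  have [measurable]: "\<phi> \<in> borel_measurable borel" "\<phi>' \<in> borel_measurable borel"
    using cont cont' by (auto intro: borel_measurable_continuous_onI)
  let ?p = "graph_point e \<phi>" and ?p' = "graph_point e' \<phi>'"
  note gp = graph_measure_gradient_point[OF chart] and gp' = graph_measure_gradient_point[OF chart']
  define \<nu> where "\<nu> q = sqrt (1 + (norm (gradient \<phi> q))\<^sup>2)" for q
  define \<nu>' where "\<nu>' q = sqrt (1 + (norm (gradient \<phi>' q))\<^sup>2)" for q
  have [measurable]: "\<nu> \<in> borel_measurable borel" "\<nu>' \<in> borel_measurable borel"
    unfolding \<nu>_def \<nu>'_def by measurable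
  \<comment> \<open>Points where \<phi> is not differentiable are negligible in the first chart and
    must be so in the second. The transfer with the charts exchanged shows this.\<close>
  have "(\<integral>\<^sup>+x. indicator (slab e') x * indicator (A - gdiff_set \<phi>) (?p' x) \<partial>lborel) =
     (\<integral>\<^sup>+x. indicator (slab e) x * (ennreal (e' \<bullet> (e - gradient \<phi> x)) * indicator (A - gdiff_set \<phi>) (?p x)) \<partial>lborel)"
    using A(2) by (intro chart_weight_transfer[OF \<Omega> chart' chart]) (auto simp: indicator_def)
  also have "\<dots> = (\<integral>\<^sup>+x. 0 \<partial>(lborel :: 'a measure))"
    using AE_gdiff_set[OF L] by (intro nn_integral_cong_AE) (auto simp: gp elim!: eventually_mono)
  also have "\<dots> = 0" by simp
  finally have "AE x in lborel. indicator (slab e') x * indicator (A - gdiff_set \<phi>) (?p' x) = (0::ennreal)"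
    by (subst (asm) nn_integral_0_iff_AE) auto
  then have ae: "AE x in lborel. x \<in> slab e' \<longrightarrow> ?p' x \<in> A \<longrightarrow> ?p' x \<in> gdiff_set \<phi>"
    by eventually_elim (auto simp: indicator_def split: if_splits)
  have "emeasure (graph_measure e \<phi>) A = (\<integral>\<^sup>+y. indicator A y \<partial>graph_measure e \<phi>)" by simp
  also have "\<dots> = (\<integral>\<^sup>+x. indicator (slab e) x * (ennreal (\<nu> (?p x)) * indicator A (?p x)) \<partial>lborel)"
    unfolding \<nu>_def gp by (rule nn_integral_graph_measure[OF cont]) simp
  also have "\<dots> = (\<integral>\<^sup>+x. indicator (slab e') x * (ennreal (e \<bullet> (e' - gradient \<phi>' x)) * (ennreal (\<nu> (?p' x)) * indicator A (?p' x))) \<partial>lborel)"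
    using A(2) by (intro chart_weight_transfer[OF \<Omega> chart chart', where g="\<lambda>y. ennreal (\<nu> y) * indicator A y"])
      (auto simp: indicator_def)
  also have "\<dots> = (\<integral>\<^sup>+x. indicator (slab e') x * (ennreal (\<nu>' (?p' x)) * indicator A (?p' x)) \<partial>lborel)"
  proof (rule nn_integral_cong_AE)
    show "AE x in lborel. indicator (slab e') x * (ennreal (e \<bullet> (e' - gradient \<phi>' x)) * (ennreal (\<nu> (?p' x)) * indicator A (?p' x))) =
        indicator (slab e') x * (ennreal (\<nu>' (?p' x)) * indicator A (?p' x))"
      using ae AE_gdiff_set[OF L']
    proof eventually_elim
      case (elim x)
      show ?case
      proof (cases "x \<in> slab e' \<and> ?p' x \<in> A")
        case True
        define q where "q = ?p' x"
        define N where "N = e - gradient \<phi> q"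
        define N' where "N' = e' - gradient \<phi>' q"
        have q: "q \<in> A" "q \<in> gdiff_set \<phi>" "q \<in> gdiff_set \<phi>'" using True elim by (auto simp: q_def gp')
        then have qU: "q \<in> U" "q \<in> U'" "q \<in> frontier \<Omega>" using A(2) by auto
        have "N /\<^sub>R norm N = N' /\<^sub>R norm N'"
          unfolding N_def N'_def
          by (rule is_outer_normal_unique[OF chart_outer_normal[OF chart \<Omega>(1) qU(1,3) q(2)]
                chart_outer_normal[OF chart' \<Omega>(1) qU(2,3) q(3)]])
        then have eq: "e \<bullet> (N /\<^sub>R norm N) = e \<bullet> (N' /\<^sub>R norm N')" by simp
        have N: "norm N = \<nu> q" "e \<bullet> N = 1" "norm N' = \<nu>' q"
          using norm_chart_normal[OF chart q(2)] norm_chart_normal(1)[OF chart' q(3)]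
          by (simp_all add: N_def N'_def \<nu>_def \<nu>'_def)
        have pos: "\<nu> q > 0" "\<nu>' q > 0" by (auto simp: \<nu>_def \<nu>'_def add_pos_nonneg)
        have *: "e \<bullet> N' * \<nu> q = \<nu>' q"
          using eq pos by (simp add: N) (simp add: field_simps)
        then have "e \<bullet> N' > 0" using pos by (metis zero_less_mult_pos2)
        then have "ennreal (e \<bullet> N') * ennreal (\<nu> q) = ennreal (\<nu>' q)"
          using pos by (simp add: ennreal_mult[symmetric] *)
        moreover have "N' = e' - gradient \<phi>' x" by (simp add: N'_def q_def gp')
        ultimately show ?thesis using True by (simp add: q_def)
      qed (auto simp: indicator_def)
    qed
  qed
  also have "\<dots> = (\<integral>\<^sup>+y. indicator A y \<partial>graph_measure e' \<phi>')"
    unfolding \<nu>'_def gp' by (rule nn_integral_graph_measure[OF cont', symmetric]) simp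
  finally show ?thesis by simp
qed

lemma finite_chart_cover:
  fixes \<Omega> :: "'a::euclidean_space set"
  assumes "lipschitz_domain \<Omega>" "bounded \<Omega>"
  obtains m :: nat and U e \<phi> where "\<And>i. i < m \<Longrightarrow> lipschitz_chart \<Omega> (U i) (e i) (\<phi> i)"
    "frontier \<Omega> \<subseteq> (\<Union>i<m. U i)"
proof -
  define CH where "CH = {(U, e, \<phi>). lipschitz_chart \<Omega> U e \<phi>}"
  have "compact (frontier \<Omega>)" using assms(2) by (rule compact_frontier_bounded)
  moreover have "open (fst c)" if "c \<in> CH" for c using that by (auto simp: CH_def lipschitz_chart_def)
  moreover have "frontier \<Omega> \<subseteq> (\<Union>c\<in>CH. fst c)"
  proof
    fix p assume "p \<in> frontier \<Omega>"
    then obtain U e \<phi> where "p \<in> U" "lipschitz_chart \<Omega> U e \<phi>"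
      using assms(1) unfolding lipschitz_domain_def by blast
    then have "(U, e, \<phi>) \<in> CH" "p \<in> fst (U, e, \<phi>)" by (auto simp: CH_def)
    then show "p \<in> (\<Union>c\<in>CH. fst c)" by (rule UN_I)
  qed
  ultimately obtain F where F: "F \<subseteq> CH" "finite F" "frontier \<Omega> \<subseteq> (\<Union>c\<in>F. fst c)"
    by (rule compactE_image[of "frontier \<Omega>" CH fst]) auto
  obtain h where h: "bij_betw h {0..<card F} F" using ex_bij_betw_nat_finite[OF F(2)] by blast
  show ?thesis
  proof (rule that[of "card F" "\<lambda>i. fst (h i)" "\<lambda>i. fst (snd (h i))" "\<lambda>i. snd (snd (h i))"])
    fix i assume "i < card F"
    then have "h i \<in> CH" using h F(1) by (auto simp: bij_betw_def)
    then show "lipschitz_chart \<Omega> (fst (h i)) (fst (snd (h i))) (snd (snd (h i)))"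
      by (auto simp: CH_def case_prod_unfold)
  next
    show "frontier \<Omega> \<subseteq> (\<Union>i<card F. fst (h i))"
    proof
      fix x assume "x \<in> frontier \<Omega>"
      then obtain c where "c \<in> F" "x \<in> fst c" using F(3) by blast
      moreover have "c \<in> h ` {0..<card F}" using h \<open>c \<in> F\<close> by (simp add: bij_betw_def)
      ultimately show "x \<in> (\<Union>i<card F. fst (h i))" by auto
    qed
  qed
qed

text \<open>The frontier is cut into disjoint pieces \<open>D i\<close>, each inside one chart. On a
  piece a surface measure must equal the graph measure, which determines it. Conversely the sum of
  the restricted graph measures qualifies, because graph measures of different charts agree on
  overlaps.\<close>

theorem ex1_surface_measure:
  fixes \<Omega> :: "'a::euclidean_space set"
  assumes dom: "lipschitz_domain \<Omega>" "bounded \<Omega>"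
  shows "\<exists>!\<sigma>. is_surface_measure \<Omega> \<sigma>"
proof -
  have \<Omega>: "open \<Omega>" using dom by (simp add: lipschitz_domain_def)
  obtain m :: nat and U e \<phi> where chart: "\<And>i. i < m \<Longrightarrow> lipschitz_chart \<Omega> (U i) (e i) (\<phi> i)"
    and cover: "frontier \<Omega> \<subseteq> (\<Union>i<m. U i)"
    by (rule finite_chart_cover[OF dom]) blast
  define D where "D i = frontier \<Omega> \<inter> U i - (\<Union>j<i. U j)" for i
  have U: "open (U i)" if "i < m" for i using chart[OF that] by (simp add: lipschitz_chart_def)
  have D: "D i \<in> sets borel" if "i < m" for i
  proof -
    have "open (\<Union>j<i. U j)" using that U by (intro open_UN) auto
    then show ?thesis
      unfolding D_def using U[OF that] borel_closed[OF frontier_closed[of \<Omega>]] by auto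
  qed
  have DU: "D i \<subseteq> frontier \<Omega> \<inter> U i" for i by (auto simp: D_def)
  have dj: "disjoint_family_on D {..<m}"
    by (auto simp: disjoint_family_on_def D_def nat_neq_iff)
  have UD: "(\<Union>i<m. D i) = frontier \<Omega>"
  proof (intro equalityI subsetI)
    fix x assume x: "x \<in> frontier \<Omega>"
    then have ex: "\<exists>i. i < m \<and> x \<in> U i" using cover by auto
    define i where "i = (LEAST i. i < m \<and> x \<in> U i)"
    have "i < m \<and> x \<in> U i" unfolding i_def by (rule LeastI_ex[OF ex])
    moreover have "x \<notin> U j" if "j < i" for j
      using not_less_Least[of j "\<lambda>i. i < m \<and> x \<in> U i"] that calculation unfolding i_def by auto
    ultimately show "x \<in> (\<Union>i<m. D i)" using x by (auto simp: D_def)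
  qed (use DU in blast)
  have split: "emeasure \<mu> A = (\<Sum>i<m. emeasure \<mu> (A \<inter> D i))"
    if "sets \<mu> = sets borel" "A \<in> sets borel" "A \<subseteq> frontier \<Omega>" for \<mu> A
  proof -
    have "(\<Sum>i<m. emeasure \<mu> (A \<inter> D i)) = emeasure \<mu> (\<Union>i<m. A \<inter> D i)"
    proof (rule sum_emeasure)
      show "disjoint_family_on (\<lambda>i. A \<inter> D i) {..<m}"
        using dj unfolding disjoint_family_on_def by blast
    qed (use that D in auto)
    also have "(\<Union>i<m. A \<inter> D i) = A" using UD that(3) by auto
    finally show ?thesis ..
  qed
  have uniq: "emeasure \<sigma> A = (\<Sum>i<m. emeasure (graph_measure (e i) (\<phi> i)) (A \<inter> D i))"
    if \<sigma>: "is_surface_measure \<Omega> \<sigma>" and A: "A \<in> sets borel" for \<sigma> A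
  proof -
    have s: "sets \<sigma> = sets borel" "emeasure \<sigma> (- frontier \<Omega>) = 0"
      and c: "\<And>U e \<phi> A. lipschitz_chart \<Omega> U e \<phi> \<Longrightarrow> A \<in> sets borel \<Longrightarrow> A \<subseteq> frontier \<Omega> \<inter> U \<Longrightarrow>
         emeasure \<sigma> A = emeasure (graph_measure e \<phi>) A"
      using \<sigma> by (auto simp: is_surface_measure_iff)
    have "- frontier \<Omega> \<in> null_sets \<sigma>" using s by (auto simp: null_sets_def)
    then have "emeasure \<sigma> A = emeasure \<sigma> (A - (- frontier \<Omega>))"
      using A s by (intro emeasure_Diff_null_set[symmetric]) auto
    also have "A - (- frontier \<Omega>) = A \<inter> frontier \<Omega>" by auto
    also have "emeasure \<sigma> (A \<inter> frontier \<Omega>) = (\<Sum>i<m. emeasure \<sigma> (A \<inter> frontier \<Omega> \<inter> D i))"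
      using A by (intro split[OF s(1)]) auto
    also have "\<dots> = (\<Sum>i<m. emeasure (graph_measure (e i) (\<phi> i)) (A \<inter> D i))"
    proof (rule sum.cong)
      fix i assume i: "i \<in> {..<m}"
      have "A \<inter> frontier \<Omega> \<inter> D i = A \<inter> D i" using DU by auto
      then show "emeasure \<sigma> (A \<inter> frontier \<Omega> \<inter> D i) = emeasure (graph_measure (e i) (\<phi> i)) (A \<inter> D i)"
        using c[OF chart, of i "A \<inter> D i"] i A D[of i] DU[of i] by auto
    qed simp
    finally show ?thesis .
  qed
  obtain \<sigma> where \<sigma>: "sets \<sigma> = sets borel" "\<And>A. A \<in> sets borel \<Longrightarrow>
      emeasure \<sigma> A = (\<Sum>i<m. emeasure (density (graph_measure (e i) (\<phi> i)) (indicator (D i))) A)"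
    using ex_sum_measure[of "{..<m}" "\<lambda>i. density (graph_measure (e i) (\<phi> i)) (indicator (D i))"] by auto
  have e\<sigma>: "emeasure \<sigma> A = (\<Sum>i<m. emeasure (graph_measure (e i) (\<phi> i)) (A \<inter> D i))" if A: "A \<in> sets borel" for A
    unfolding \<sigma>(2)[OF A]
  proof (rule sum.cong)
    fix i assume "i \<in> {..<m}"
    then show "emeasure (density (graph_measure (e i) (\<phi> i)) (indicator (D i))) A = emeasure (graph_measure (e i) (\<phi> i)) (A \<inter> D i)"
      using D[of i] A by (simp add: emeasure_density indicator_inter_arith[symmetric] Int_commute)
  qed simp
  have "is_surface_measure \<Omega> \<sigma>"
    unfolding is_surface_measure_iff
  proof (intro conjI allI impI ballI)
    have "- frontier \<Omega> \<inter> D i = {}" for i using DU by auto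
    then show "emeasure \<sigma> (- frontier \<Omega>) = 0" by (subst e\<sigma>) auto
    fix V d \<psi> and A :: "'a set"
    assume ch: "lipschitz_chart \<Omega> V d \<psi>" and A: "A \<in> sets borel" "A \<subseteq> frontier \<Omega> \<inter> V"
    have "emeasure (graph_measure d \<psi>) A = (\<Sum>i<m. emeasure (graph_measure d \<psi>) (A \<inter> D i))"
      using A by (intro split) auto
    also have "\<dots> = (\<Sum>i<m. emeasure (graph_measure (e i) (\<phi> i)) (A \<inter> D i))"
    proof (rule sum.cong)
      fix i assume "i \<in> {..<m}"
      then show "emeasure (graph_measure d \<psi>) (A \<inter> D i) = emeasure (graph_measure (e i) (\<phi> i)) (A \<inter> D i)"
        using A D[of i] DU[of i] by (intro graph_measure_unique[OF \<Omega> dom(2) ch chart]) auto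
    qed simp
    finally show "emeasure \<sigma> A = emeasure (graph_measure d \<psi>) A" using e\<sigma>[OF A(1)] by simp
  qed (rule \<sigma>(1))
  moreover have "\<sigma>1 = \<sigma>2" if "is_surface_measure \<Omega> \<sigma>1" "is_surface_measure \<Omega> \<sigma>2" for \<sigma>1 \<sigma>2
  proof (rule measure_eqI)
    show s: "sets \<sigma>1 = sets \<sigma>2" using that by (simp add: is_surface_measure_iff)
    fix A assume "A \<in> sets \<sigma>1"
    then have "A \<in> sets borel" using that by (simp add: is_surface_measure_iff)
    then show "emeasure \<sigma>1 A = emeasure \<sigma>2 A" using uniq that by simp
  qed
  ultimately show ?thesis by blast
qed

text \<open>The outer normal is identified with a Borel function only almost everywhere;
  completeness of the measure makes it measurable nevertheless.\<close>

lemma borel_measurable_completion_AE: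
  assumes f: "f \<in> borel_measurable M" and eq: "AE x in M. f x = g x"
  shows "g \<in> borel_measurable (completion M)"
proof -
  obtain N where N: "N \<in> null_sets M" "{x \<in> space M. f x \<noteq> g x} \<subseteq> N"
    using eq by (auto simp: eventually_ae_filter)
  show ?thesis
  proof (rule measurableI)
    fix S :: "'b set" assume S: "S \<in> sets borel"
    have "g -` S \<inter> space M = (f -` S \<inter> space M - N) \<union> (g -` S \<inter> space M \<inter> N)"
      using N(2) by auto
    moreover have "f -` S \<inter> space M - N \<in> sets (completion M)"
      using measurable_sets[OF f S] N(1) by (intro sets_completionI_sets sets.Diff) auto
    moreover have "g -` S \<inter> space M \<inter> N \<in> sets (completion M)"
      using null_sets_completion_subset[of "g -` S \<inter> space M \<inter> N" N M] null_sets_completionI[OF N(1)] by auto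
    ultimately show "g -` S \<inter> space (completion M) \<in> sets (completion M)"
      by (metis sets.Un space_completion)
  qed simp
qed

text \<open>The density is at most \<open>sqrt (1 + L\<^sup>2)\<close> almost everywhere, and only a
  bounded part of the slab lies over \<open>A\<close>.\<close>

lemma emeasure_graph_measure_bounded:
  fixes e :: "'a::euclidean_space"
  assumes \<phi>: "L-lipschitz_on UNIV \<phi>" and e: "norm e = 1" and A: "A \<in> sets borel" "bounded A"
  shows "emeasure (graph_measure e \<phi>) A < \<infinity>"
proof -
  have cont: "continuous_on UNIV \<phi>" by (rule lipschitz_on_continuous_on[OF \<phi>])
  note [measurable] = A(1)
  obtain B where B: "\<And>y. y \<in> A \<Longrightarrow> norm y \<le> B" using A(2) unfolding bounded_iff by blast
  have "emeasure (graph_measure e \<phi>) A = (\<integral>\<^sup>+y. indicator A y \<partial>graph_measure e \<phi>)" by simp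
  also have "\<dots> = (\<integral>\<^sup>+x. indicator (slab e) x * (ennreal (sqrt (1 + (norm (gradient \<phi> x))\<^sup>2)) * indicator A (graph_point e \<phi> x)) \<partial>lborel)"
    by (rule nn_integral_graph_measure[OF cont]) simp
  also have "\<dots> \<le> (\<integral>\<^sup>+x. ennreal (sqrt (1 + L\<^sup>2)) * indicator (cball (0::'a) (2 * B + 1)) x \<partial>lborel)"
  proof (rule nn_integral_mono_AE)
    show "AE x in lborel. indicator (slab e) x * (ennreal (sqrt (1 + (norm (gradient \<phi> x))\<^sup>2)) * indicator A (graph_point e \<phi> x))
        \<le> ennreal (sqrt (1 + L\<^sup>2)) * indicator (cball (0::'a) (2 * B + 1)) x"
      using AE_gdiff_set[OF \<phi>]
    proof eventually_elim
      case (elim x)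
      have "sqrt (1 + (norm (gradient \<phi> x))\<^sup>2) \<le> sqrt (1 + L\<^sup>2)"
        using norm_gradient_le[OF \<phi> elim] by (simp add: power_mono)
      moreover have "x \<in> cball 0 (2 * B + 1)" if "x \<in> slab e" "graph_point e \<phi> x \<in> A"
        using norm_le_graph_point[OF e that(1), of \<phi>] B[OF that(2)] by simp
      ultimately show ?case by (auto simp: indicator_def intro: ennreal_leI)
    qed
  qed
  also have "\<dots> = ennreal (sqrt (1 + L\<^sup>2)) * emeasure lborel (cball (0::'a) (2 * B + 1))"
    by (rule nn_integral_cmult_indicator) simp
  also have "\<dots> < \<infinity>"
    using emeasure_bounded_finite[OF bounded_cball, of "0::'a" "2 * B + 1"] by (simp add: ennreal_mult_less_top)
  finally show ?thesis .
qed

text \<open>In slab coordinates each line in direction \<open>e\<close> meets this set at most at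
  \<open>r = 0\<close>.\<close>

lemma null_sets_chart_frontier:
  fixes \<Omega> :: "'a::euclidean_space set"
  assumes chart: "lipschitz_chart \<Omega> U e \<phi>" and \<Omega>: "open \<Omega>"
  shows "frontier \<Omega> \<inter> U \<in> null_sets lborel"
proof -
  obtain L where \<phi>: "continuous_on UNIV \<phi>" and U: "open U" and e: "norm e = 1" "e \<bullet> e = 1"
    and inv: "\<And>x s. \<phi> (x + s *\<^sub>R e) = \<phi> x"
    by (rule lipschitz_chartD[OF chart]) blast
  have [measurable]: "\<phi> \<in> borel_measurable borel" using \<phi> by (rule borel_measurable_continuous_onI)
  have W [measurable]: "frontier \<Omega> \<inter> U \<in> sets borel" using U by auto
  have on: "r = 0" if "graph_point e \<phi> x + r *\<^sub>R e \<in> frontier \<Omega> \<inter> U" for x r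
    using frontier_chart_iff[OF chart _ \<Omega>, of "graph_point e \<phi> x + r *\<^sub>R e"] that
    by (simp add: inner_add_left inv graph_point_inner(1,2)[OF e(2) inv] e)
  have "emeasure lborel (frontier \<Omega> \<inter> U) = (\<integral>\<^sup>+y. indicator (frontier \<Omega> \<inter> U) y \<partial>lborel)" by simp
  also have "\<dots> = (\<integral>\<^sup>+x. (\<integral>\<^sup>+r. ennreal 1 * indicator (slab e) x * indicator (frontier \<Omega> \<inter> U) (graph_point e \<phi> x + (1 * r) *\<^sub>R e) \<partial>lborel) \<partial>lborel)"
    by (rule nn_integral_slab[OF _ _ e(1)]) auto
  also have "\<dots> = (\<integral>\<^sup>+x. 0 \<partial>(lborel :: 'a measure))"
  proof (rule nn_integral_cong)
    fix x :: 'a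
    have "AE r in lborel. ennreal 1 * indicator (slab e) x * indicator (frontier \<Omega> \<inter> U) (graph_point e \<phi> x + (1 * r) *\<^sub>R e) = 0"
      using AE_lborel_singleton[of "0::real"] by eventually_elim (use on[of x] in \<open>auto simp: indicator_def\<close>)
    then show "(\<integral>\<^sup>+r. ennreal 1 * indicator (slab e) x * indicator (frontier \<Omega> \<inter> U) (graph_point e \<phi> x + (1 * r) *\<^sub>R e) \<partial>lborel) = 0"
      by (subst nn_integral_0_iff_AE) auto
  qed
  finally show ?thesis using W by auto
qed

lemma null_sets_lipschitz_frontier:
  assumes dom: "lipschitz_domain \<Omega>" "bounded \<Omega>"
  shows "frontier \<Omega> \<in> null_sets lborel"
proof -
  have \<Omega>: "open \<Omega>" using dom by (simp add: lipschitz_domain_def)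
  obtain m :: nat and U e \<phi> where chart: "\<And>i. i < m \<Longrightarrow> lipschitz_chart \<Omega> (U i) (e i) (\<phi> i)"
    and cover: "frontier \<Omega> \<subseteq> (\<Union>i<m. U i)"
    by (rule finite_chart_cover[OF dom]) blast
  have "(\<Union>i<m. frontier \<Omega> \<inter> U i) \<in> null_sets lborel"
    using null_sets_chart_frontier[OF chart \<Omega>] by (intro null_sets_UN') auto
  also have "(\<Union>i<m. frontier \<Omega> \<inter> U i) = frontier \<Omega>" using cover by auto
  finally show ?thesis .
qed

section \<open>Flux through the boundary\<close>

text \<open>On \<open>frontier \<Omega> \<inter> U\<close> the surface measure is the graph measure,
  with density \<open>norm N\<close> for \<open>N = e - gradient \<phi>\<close>, and the outer
  normal is \<open>N\<close> divided by its norm. The two factors cancel and leave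
  \<open>S \<bullet> N\<close>. Since \<open>f\<close> vanishes off \<open>U\<close>, one chart
  suffices.\<close>

theorem surface_flux:
  fixes S :: "'a::euclidean_space \<Rightarrow> 'a"
  assumes dom: "lipschitz_domain \<Omega>" "bounded \<Omega>" and chart: "lipschitz_chart \<Omega> U e \<phi>"
    and f [measurable]: "f \<in> borel_measurable borel" and K: "\<And>y. \<bar>f y\<bar> \<le> K"
    and fU: "\<And>y. f y \<noteq> 0 \<Longrightarrow> y \<in> U" and S: "continuous_on (frontier \<Omega>) S"
  shows "integrable (surface_measure \<Omega>) (\<lambda>q. indicator (frontier \<Omega>) q * (f q * (S q \<bullet> outer_normal \<Omega> q)))"
    and "(\<integral>q. indicator (frontier \<Omega>) q * (f q * (S q \<bullet> outer_normal \<Omega> q)) \<partial>surface_measure \<Omega>) =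
      (\<integral>x. indicator (slab e) x * (f (graph_point e \<phi> x) * (S (graph_point e \<phi> x) \<bullet> (e - gradient \<phi> x))) \<partial>lborel)"
proof -
  have \<Omega>: "open \<Omega>" using dom by (simp add: lipschitz_domain_def)
  obtain L where L: "L-lipschitz_on UNIV \<phi>" and cont: "continuous_on UNIV \<phi>" and U: "open U" and e: "norm e = 1" "e \<bullet> e = 1"
    and inv: "\<And>x s. \<phi> (x + s *\<^sub>R e) = \<phi> x"
    by (rule lipschitz_chartD[OF chart]) blast
  have [measurable]: "\<phi> \<in> borel_measurable borel" using cont by (rule borel_measurable_continuous_onI)
  note [measurable] = borel_measurable_gradient[OF cont] borel_gdiff_set[OF cont]
  let ?p = "graph_point e \<phi>"
  note gp = graph_measure_gradient_point[OF chart]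
  define \<sigma> where "\<sigma> = (THE \<sigma>. is_surface_measure \<Omega> \<sigma>)"
  have \<sigma>: "is_surface_measure \<Omega> \<sigma>" unfolding \<sigma>_def by (rule theI'[OF ex1_surface_measure[OF dom]])
  have sm: "surface_measure \<Omega> = completion \<sigma>" by (simp add: surface_measure_def \<sigma>_def)
  have sets [measurable_cong]: "sets \<sigma> = sets borel" using \<sigma> by (simp add: is_surface_measure_iff)
  have em: "emeasure \<sigma> A = emeasure (graph_measure e \<phi>) A" if "A \<in> sets borel" "A \<subseteq> frontier \<Omega> \<inter> U" for A
    using \<sigma> chart that unfolding is_surface_measure_iff by blast
  define W where "W = frontier \<Omega> \<inter> U"
  have Wm [measurable]: "W \<in> sets borel" "frontier \<Omega> \<in> sets borel" using U by (auto simp: W_def)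
  \<comment> \<open>The two measures are known to agree only on subsets of \<open>W\<close>, so they
    are compared after restriction, written as densities to which \<open>integral_density\<close>
    applies.\<close>
  have dens: "density \<sigma> (\<lambda>q. ennreal (indicator W q)) = density (graph_measure e \<phi>) (\<lambda>q. ennreal (indicator W q))"
  proof (rule measure_eqI)
    fix A assume "A \<in> sets (density \<sigma> (\<lambda>q. ennreal (indicator W q)))"
    then have [measurable]: "A \<in> sets borel" using sets by simp
    have de: "emeasure (density M (\<lambda>q. ennreal (indicator W q))) A = emeasure M (W \<inter> A)" if [measurable_cong]: "sets M = sets borel" for M
    proof -
      have "emeasure (density M (\<lambda>q. ennreal (indicator W q))) A = (\<integral>\<^sup>+q. ennreal (indicator W q) * indicator A q \<partial>M)"
        by (rule emeasure_density) measurable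
      also have "\<dots> = (\<integral>\<^sup>+q. indicator (W \<inter> A) q \<partial>M)"
        by (intro nn_integral_cong) (simp add: indicator_def)
      finally show ?thesis by simp
    qed
    have "emeasure \<sigma> (W \<inter> A) = emeasure (graph_measure e \<phi>) (W \<inter> A)"
    proof (rule em)
      show "W \<inter> A \<in> sets borel" by measurable
    qed (auto simp: W_def)
    then show "emeasure (density \<sigma> (\<lambda>q. ennreal (indicator W q))) A = emeasure (density (graph_measure e \<phi>) (\<lambda>q. ennreal (indicator W q))) A"
      unfolding de[OF sets] de[OF sets_graph_measure] .
  qed (simp add: sets)
  have "bounded W"
    using compact_imp_bounded[OF compact_frontier_bounded[OF dom(2)]] by (rule bounded_subset) (simp add: W_def)
  then have fin: "emeasure \<sigma> W < \<infinity>"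
    using em[OF Wm(1)] emeasure_graph_measure_bounded[OF L e(1) Wm(1)] by (simp add: W_def)
  have null: "emeasure \<sigma> (W - gdiff_set \<phi>) = 0"
  proof -
    have m: "W - gdiff_set \<phi> \<in> sets borel" by measurable
    have "emeasure \<sigma> (W - gdiff_set \<phi>) = emeasure (graph_measure e \<phi>) (W - gdiff_set \<phi>)"
      by (rule em[OF m]) (auto simp: W_def)
    also have "\<dots> = (\<integral>\<^sup>+y. indicator (W - gdiff_set \<phi>) y \<partial>graph_measure e \<phi>)"
      using m by simp
    also have "\<dots> = (\<integral>\<^sup>+x. indicator (slab e) x * (ennreal (sqrt (1 + (norm (gradient \<phi> x))\<^sup>2)) * indicator (W - gdiff_set \<phi>) (?p x)) \<partial>lborel)"
      by (rule nn_integral_graph_measure[OF cont]) simp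
    also have "\<dots> = (\<integral>\<^sup>+x. 0 \<partial>(lborel :: 'a measure))"
      using AE_gdiff_set[OF L] by (intro nn_integral_cong_AE) (auto simp: gp elim!: eventually_mono)
    finally show ?thesis by simp
  qed
  have "W - gdiff_set \<phi> \<in> null_sets \<sigma>" using null by (auto simp: sets)
  then have ae: "AE q in \<sigma>. q \<notin> W - gdiff_set \<phi>" by (rule AE_not_in)
  define N where "N q = e - gradient \<phi> q" for q
  define S0 where "S0 q = indicator (frontier \<Omega>) q *\<^sub>R S q" for q
  have [measurable]: "S0 \<in> borel_measurable borel"
    unfolding S0_def using S by (intro borel_measurable_continuous_on_indicator) auto
  have [measurable]: "N \<in> borel_measurable borel" unfolding N_def by measurable
  \<comment> \<open>A Borel representative of the integrand \<open>F\<close>, with the normal of the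
    chart in place of the outer normal and \<open>S\<close> cut off to the frontier.\<close>
  define G where "G q = indicator W q * (f q * (S0 q \<bullet> (N q /\<^sub>R norm (N q))))" for q
  have [measurable]: "G \<in> borel_measurable borel" unfolding G_def by measurable
  define F where "F q = indicator (frontier \<Omega>) q * (f q * (S q \<bullet> outer_normal \<Omega> q))" for q
  have FG: "AE q in \<sigma>. G q = F q"
    using ae
  proof eventually_elim
    case (elim q)
    show ?case
    proof (cases "q \<in> frontier \<Omega> \<and> f q \<noteq> 0")
      case True
      then have q: "q \<in> U" "q \<in> frontier \<Omega>" "q \<in> W" using fU by (auto simp: W_def)
      then have "q \<in> gdiff_set \<phi>" using elim by blast
      then have "outer_normal \<Omega> q = N q /\<^sub>R norm (N q)"
        unfolding N_def by (intro outer_normal_eq chart_outer_normal[OF chart \<Omega> q(1,2)])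
      then show ?thesis using q by (simp add: F_def G_def S0_def)
    qed (auto simp: F_def G_def S0_def)
  qed
  obtain BS where BS: "\<And>q. q \<in> frontier \<Omega> \<Longrightarrow> norm (S q) \<le> BS"
    using compact_imp_bounded[OF compact_continuous_image[OF S compact_frontier_bounded[OF dom(2)]]]
    unfolding bounded_iff by auto
  have Gb: "\<bar>G q\<bar> \<le> (K * \<bar>BS\<bar>) * indicator W q" for q
  proof (cases "q \<in> W")
    case True
    have "norm (N q /\<^sub>R norm (N q)) \<le> 1" by (cases "N q = 0") simp_all
    then have "norm (S0 q) * norm (N q /\<^sub>R norm (N q)) \<le> norm (S0 q) * 1" by (intro mult_left_mono) auto
    also have "norm (S0 q) * 1 \<le> \<bar>BS\<bar>" using BS[of q] by (auto simp: S0_def indicator_def)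
    finally have "\<bar>S0 q \<bullet> (N q /\<^sub>R norm (N q))\<bar> \<le> \<bar>BS\<bar>"
      using Cauchy_Schwarz_ineq2[of "S0 q" "N q /\<^sub>R norm (N q)"] by linarith
    moreover have "0 \<le> K" using K[of q] by linarith
    ultimately have "\<bar>f q\<bar> * \<bar>S0 q \<bullet> (N q /\<^sub>R norm (N q))\<bar> \<le> K * \<bar>BS\<bar>" using K[of q] by (intro mult_mono) auto
    then show ?thesis using True by (simp add: G_def abs_mult)
  qed (simp add: G_def)
  have Gi: "integrable \<sigma> G"
  proof (rule Bochner_Integration.integrable_bound)
    show "integrable \<sigma> (\<lambda>q. (K * \<bar>BS\<bar>) * indicator W q)"
      using fin by (intro integrable_mult_right integrable_real_indicator) (auto simp: sets)
    show "AE q in \<sigma>. norm (G q) \<le> norm ((K * \<bar>BS\<bar>) * indicator W q)"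
      using Gb by (intro AE_I2) (metis abs_ge_self order_trans real_norm_def)
  qed measurable
  have Fm: "F \<in> borel_measurable (completion \<sigma>)"
    by (rule borel_measurable_completion_AE[OF _ FG]) measurable
  have Gm: "G \<in> borel_measurable (completion \<sigma>)" by (rule measurable_completion) measurable
  have FGc: "AE q in completion \<sigma>. G q = F q" using FG by (rule AE_completion)
  show "integrable (surface_measure \<Omega>) (\<lambda>q. indicator (frontier \<Omega>) q * (f q * (S q \<bullet> outer_normal \<Omega> q)))"
    using Gi integrable_cong_AE[OF Gm Fm FGc] integrable_completion[of G \<sigma>]
    unfolding sm F_def[symmetric] by simp
  have "(\<integral>q. F q \<partial>completion \<sigma>) = (\<integral>q. G q \<partial>completion \<sigma>)"
    using FGc by (intro integral_cong_AE Fm Gm) (auto elim!: eventually_mono)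
  also have "\<dots> = (\<integral>q. G q \<partial>\<sigma>)" by (rule integral_completion) measurable
  also have "\<dots> = (\<integral>q. indicator W q *\<^sub>R G q \<partial>\<sigma>)"
    by (intro Bochner_Integration.integral_cong) (auto simp: G_def indicator_def)
  also have "\<dots> = (\<integral>q. G q \<partial>density \<sigma> (\<lambda>q. ennreal (indicator W q)))"
    by (rule integral_density[symmetric]) (auto simp: sets)
  also have "\<dots> = (\<integral>q. indicator W q *\<^sub>R G q \<partial>graph_measure e \<phi>)"
    unfolding dens by (rule integral_density) auto
  also have "\<dots> = (\<integral>q. G q \<partial>graph_measure e \<phi>)"
    by (intro Bochner_Integration.integral_cong) (auto simp: G_def indicator_def)
  also have "\<dots> = (\<integral>x. indicator (slab e) x * (sqrt (1 + (norm (gradient \<phi> x))\<^sup>2) * G (?p x)) \<partial>lborel)"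
    by (rule integral_graph_measure[OF cont]) measurable
  also have "\<dots> = (\<integral>x. indicator (slab e) x * (f (?p x) * (S0 (?p x) \<bullet> N x)) \<partial>lborel)"
  proof (rule integral_cong_AE)
    show "AE x in lborel. indicator (slab e) x * (sqrt (1 + (norm (gradient \<phi> x))\<^sup>2) * G (?p x)) = indicator (slab e) x * (f (?p x) * (S0 (?p x) \<bullet> N x))"
      using AE_gdiff_set[OF L]
    proof eventually_elim
      case (elim x)
      have N: "norm (N x) = sqrt (1 + (norm (gradient \<phi> x))\<^sup>2)" "N (?p x) = N x"
        using norm_chart_normal(1)[OF chart elim] by (simp_all add: N_def gp)
      have pos: "norm (N x) > 0" unfolding N(1) by (simp add: add_pos_nonneg)
      show ?case
      proof (cases "f (?p x) = 0 \<or> ?p x \<notin> frontier \<Omega>")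
        case False
        then have "?p x \<in> W" using fU by (auto simp: W_def)
        then show ?thesis unfolding N(1)[symmetric] using pos by (simp add: G_def N(2))
      qed (auto simp: G_def S0_def)
    qed
  qed measurable
  also have "\<dots> = (\<integral>x. indicator (slab e) x * (f (?p x) * (S (?p x) \<bullet> N x)) \<partial>lborel)"
  proof (rule Bochner_Integration.integral_cong)
    fix x
    show "indicator (slab e) x * (f (?p x) * (S0 (?p x) \<bullet> N x)) = indicator (slab e) x * (f (?p x) * (S (?p x) \<bullet> N x))"
    proof (cases "f (?p x) = 0")
      case False
      then have "?p x \<in> frontier \<Omega>"
        using frontier_chart_iff[OF chart _ \<Omega>, of "?p x"] fU graph_point_inner(1,2)[OF e(2) inv] by auto
      then show ?thesis by (simp add: S0_def)
    qed simp
  qed simp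
  finally show "(\<integral>q. indicator (frontier \<Omega>) q * (f q * (S q \<bullet> outer_normal \<Omega> q)) \<partial>surface_measure \<Omega>) =
      (\<integral>x. indicator (slab e) x * (f (?p x) * (S (?p x) \<bullet> (e - gradient \<phi> x))) \<partial>lborel)"
    unfolding sm F_def N_def .
qed

section \<open>Uniform estimates for deformations\<close>

lemma AE_lborel_translate:
  fixes P :: "'a::euclidean_space \<Rightarrow> bool"
  assumes "AE x in lborel. P x"
  shows "AE x in lborel. P (c + x)"
proof -
  have "AE x in distr lborel borel ((+) c). P x" using assms unfolding lborel_distr_plus .
  then show ?thesis by (rule AE_distrD[rotated]) simp
qed

text \<open>A segment may be a null set, so the hypothesis can be void on the segment itself. The
  integrals \<open>F\<close> of \<open>r\<close> over a ball sliding from \<open>a\<close> to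
  \<open>b\<close> are differentiable at every parameter, with derivative at most \<open>K\<close>
  times the volume of the ball. The mean value inequality applies to them, and the ball then
  shrinks.\<close>

lemma AE_derivative_imp_increment_bound:
  fixes r :: "'a::euclidean_space \<Rightarrow> real"
  assumes W: "open W" "closed_segment a b \<subseteq> W" and r: "L-lipschitz_on W r"
    and ae: "AE x in lborel. x \<in> W \<longrightarrow> (\<exists>D. (r has_derivative D) (at x) \<and> \<bar>D (b - a)\<bar> \<le> K)"
  shows "\<bar>r b - r a\<bar> \<le> K"
proof -
  define v where "v = b - a"
  have L: "L \<ge> 0" using r lipschitz_on_nonneg by blast
  \<comment> \<open>Extension by zero makes the function Borel on the whole space; the sliding ball
    never leaves \<open>W\<close>.\<close>
  define r' where "r' x = indicator W x *\<^sub>R r x" for x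
  have [measurable]: "r' \<in> borel_measurable borel"
    unfolding r'_def using W(1) lipschitz_on_continuous_on[OF r]
    by (intro borel_measurable_continuous_on_indicator) auto
  have r'W: "r' x = r x" if "x \<in> W" for x using that by (simp add: r'_def)
  obtain \<epsilon> where \<epsilon>: "\<epsilon> > 0" "(\<Union>x\<in>closed_segment a b. ball x \<epsilon>) \<subseteq> W"
    using compact_subset_open_imp_ball_epsilon_subset[OF compact_segment W] by blast
  have inW: "a + \<tau> *\<^sub>R v + z \<in> W" if "\<tau> \<in> {0..1}" "norm z < \<epsilon>" for \<tau> z
  proof -
    have "a + \<tau> *\<^sub>R v \<in> closed_segment a b"
      using that(1) unfolding closed_segment_def v_def by (auto simp: algebra_simps intro!: exI[of _ \<tau>])
    moreover have "a + \<tau> *\<^sub>R v + z \<in> ball (a + \<tau> *\<^sub>R v) \<epsilon>" using that(2) by (simp add: dist_norm)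
    ultimately show ?thesis using \<epsilon>(2) by blast
  qed
  have dd: "AE x in lborel. x \<in> W \<longrightarrow> ((\<lambda>h. (r' (x + h *\<^sub>R v) - r' x) / h) \<longlongrightarrow> dir_deriv r' v x) (at 0) \<and> \<bar>dir_deriv r' v x\<bar> \<le> K"
    using ae
  proof eventually_elim
    case (elim x)
    show ?case
    proof
      assume x: "x \<in> W"
      then obtain D where D: "(r has_derivative D) (at x)" "\<bar>D v\<bar> \<le> K" using elim by (auto simp: v_def)
      have D': "(r' has_derivative D) (at x)"
        by (rule has_derivative_transform_within_open[OF D(1) W(1) x]) (simp add: r'W)
      have "((\<lambda>h. r' (x + h *\<^sub>R v)) has_derivative (\<lambda>h. D (h *\<^sub>R v))) (at 0)"
      proof (rule has_derivative_compose[where f="\<lambda>h. x + h *\<^sub>R v" and g=r' and g'=D])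
        show "((\<lambda>h. x + h *\<^sub>R v) has_derivative (\<lambda>h. h *\<^sub>R v)) (at 0)"
          by (auto intro!: derivative_eq_intros)
      qed (use D' in simp)
      then have "((\<lambda>h. r' (x + h *\<^sub>R v)) has_field_derivative (D v)) (at 0)"
        by (rule has_derivative_imp_has_field_derivative)
          (simp add: linear_scale[OF has_derivative_linear[OF D(1)]])
      then have *: "((\<lambda>h. (r' (x + h *\<^sub>R v) - r' x) / h) \<longlongrightarrow> D v) (at 0)" by (simp add: DERIV_def)
      show "((\<lambda>h. (r' (x + h *\<^sub>R v) - r' x) / h) \<longlongrightarrow> dir_deriv r' v x) (at 0) \<and> \<bar>dir_deriv r' v x\<bar> \<le> K"
        using * D(2) dir_deriv_tendsto(2)[OF *] by simp
    qed
  qed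
  \<comment> \<open>Relative to the volume of the ball, \<open>F\<close> differs from the value of
    \<open>r\<close> at the centre by at most \<open>L * \<rho>\<close>, once at each
    endpoint.\<close>
  have small: "\<bar>r b - r a\<bar> \<le> K + 2 * L * \<rho>" if \<rho>: "0 < \<rho>" "\<rho> < \<epsilon>" for \<rho>
  proof -
    define B where "B = ball (0::'a) \<rho>"
    have [measurable]: "B \<in> sets borel" by (simp add: B_def)
    have Bfin: "emeasure lborel B < \<infinity>" unfolding B_def by (rule emeasure_bounded_finite) simp
    define m where "m = measure lborel B"
    have m: "m > 0"
      using content_ball_pos[OF \<rho>(1), of "0::'a"] unfolding m_def B_def by (simp add: measure_completion)
    have ib: "integrable lborel (\<lambda>z. c * indicator B z)" for c :: real
      using Bfin by (intro integrable_mult_right integrable_real_indicator) auto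
    have intB: "(\<integral>z. c * indicator B z \<partial>lborel) = c * m" for c :: real
      by (simp add: m_def)
    have Bn: "norm z < \<epsilon>" if "z \<in> B" for z using that \<rho> by (simp add: B_def)
    define F where "F \<tau> = (\<integral>z. indicator B z * r' (a + \<tau> *\<^sub>R v + z) \<partial>lborel)" for \<tau>
    have aW: "a \<in> W" using W(2) by auto
    have Fi: "integrable lborel (\<lambda>z. indicator B z * r' (a + \<tau> *\<^sub>R v + z))" if \<tau>: "\<tau> \<in> {0..1}" for \<tau>
    proof (rule Bochner_Integration.integrable_bound[OF ib[of "\<bar>r a\<bar> + L * (norm v + \<rho>)"]])
      have "\<bar>r' (a + \<tau> *\<^sub>R v + z)\<bar> \<le> \<bar>r a\<bar> + L * (norm v + \<rho>)" if z: "z \<in> B" for z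
      proof -
        have "\<bar>r (a + \<tau> *\<^sub>R v + z) - r a\<bar> \<le> L * norm (\<tau> *\<^sub>R v + z)"
          using lipschitz_onD[OF r inW[OF \<tau> Bn[OF z]] aW] by (simp add: dist_norm add.assoc)
        also have "norm (\<tau> *\<^sub>R v + z) \<le> norm v + \<rho>"
        proof -
          have "norm (\<tau> *\<^sub>R v) \<le> norm v" using \<tau> by (simp add: mult_left_le_one_le)
          then show ?thesis using z norm_triangle_ineq[of "\<tau> *\<^sub>R v" z] by (simp add: B_def)
        qed
        finally show ?thesis using L inW[OF \<tau> Bn[OF z]] by (simp add: r'W mult_left_mono)
      qed
      moreover have "0 \<le> \<bar>r a\<bar> + L * (norm v + \<rho>)" using L \<rho> by simp
      ultimately show "AE z in lborel. norm (indicator B z * r' (a + \<tau> *\<^sub>R v + z)) \<le> norm ((\<bar>r a\<bar> + L * (norm v + \<rho>)) * indicator B z)"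
        by (intro AE_I2) (auto simp: indicator_def)
    qed measurable
    define Fd where "Fd \<tau> = (\<integral>z. indicator B z * dir_deriv r' v (a + \<tau> *\<^sub>R v + z) \<partial>lborel)" for \<tau>
    \<comment> \<open>Along a sequence of parameters the quotients of \<open>F\<close> are integrals
      of quotients of \<open>r'\<close>, which converge almost everywhere and are dominated by
      \<open>L * norm v\<close>.\<close>
    have der: "(F has_field_derivative Fd \<tau>) (at \<tau> within {0..1})" if \<tau>: "\<tau> \<in> {0..1}" for \<tau>
      unfolding has_field_derivative_iff tendsto_at_iff_sequentially
    proof (intro allI impI)
      fix X :: "nat \<Rightarrow> real" assume X: "\<forall>i. X i \<in> {0..1} - {\<tau>}" "X \<longlonglongrightarrow> \<tau>"
      have eq: "(F (X i) - F \<tau>) / (X i - \<tau>) =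
          (\<integral>z. indicator B z * ((r' (a + X i *\<^sub>R v + z) - r' (a + \<tau> *\<^sub>R v + z)) / (X i - \<tau>)) \<partial>lborel)" for i
      proof -
        have "F (X i) - F \<tau> = (\<integral>z. indicator B z * r' (a + X i *\<^sub>R v + z) - indicator B z * r' (a + \<tau> *\<^sub>R v + z) \<partial>lborel)"
          unfolding F_def using X \<tau> by (intro Bochner_Integration.integral_diff[symmetric] Fi) auto
        then have "(F (X i) - F \<tau>) / (X i - \<tau>) =
            (\<integral>z. (indicator B z * r' (a + X i *\<^sub>R v + z) - indicator B z * r' (a + \<tau> *\<^sub>R v + z)) / (X i - \<tau>) \<partial>lborel)"
          by simp
        also have "\<dots> = (\<integral>z. indicator B z * ((r' (a + X i *\<^sub>R v + z) - r' (a + \<tau> *\<^sub>R v + z)) / (X i - \<tau>)) \<partial>lborel)"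
          by (intro Bochner_Integration.integral_cong) (auto simp: diff_divide_distrib right_diff_distrib)
        finally show ?thesis .
      qed
      have "(\<lambda>i. \<integral>z. indicator B z * ((r' (a + X i *\<^sub>R v + z) - r' (a + \<tau> *\<^sub>R v + z)) / (X i - \<tau>)) \<partial>lborel) \<longlonglongrightarrow> Fd \<tau>"
        unfolding Fd_def
      proof (rule integral_dominated_convergence[OF _ _ ib[of "L * norm v"]])
        show "AE z in lborel. (\<lambda>i. indicator B z * ((r' (a + X i *\<^sub>R v + z) - r' (a + \<tau> *\<^sub>R v + z)) / (X i - \<tau>)))
            \<longlonglongrightarrow> indicator B z * dir_deriv r' v (a + \<tau> *\<^sub>R v + z)"
          using AE_lborel_translate[OF dd, of "a + \<tau> *\<^sub>R v"]
        proof eventually_elim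
          case (elim z)
          show ?case
          proof (cases "z \<in> B")
            case True
            have "a + \<tau> *\<^sub>R v + z \<in> W" by (rule inW[OF \<tau> Bn[OF True]])
            then have l: "((\<lambda>h. (r' (a + \<tau> *\<^sub>R v + z + h *\<^sub>R v) - r' (a + \<tau> *\<^sub>R v + z)) / h)
                \<longlongrightarrow> dir_deriv r' v (a + \<tau> *\<^sub>R v + z)) (at 0)" using elim by simp
            have "(\<lambda>i. X i - \<tau>) \<longlonglongrightarrow> 0" using X(2) by (simp add: LIM_zero)
            then have "filterlim (\<lambda>i. X i - \<tau>) (at 0) sequentially"
              using X(1) by (auto simp: filterlim_at intro!: always_eventually)
            from filterlim_compose[OF l this] show ?thesis
              using True by (simp add: algebra_simps)
          qed simp
        qed
        show "AE z in lborel. norm (indicator B z * ((r' (a + X i *\<^sub>R v + z) - r' (a + \<tau> *\<^sub>R v + z)) / (X i - \<tau>)))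
            \<le> L * norm v * indicator B z" for i
        proof (rule AE_I2)
          fix z
          show "norm (indicator B z * ((r' (a + X i *\<^sub>R v + z) - r' (a + \<tau> *\<^sub>R v + z)) / (X i - \<tau>))) \<le> L * norm v * indicator B z"
          proof (cases "z \<in> B")
            case True
            have Xi: "X i \<in> {0..1}" "X i \<noteq> \<tau>" using X(1) by auto
            note in1 = inW[OF \<tau> Bn[OF True]] and in2 = inW[OF Xi(1) Bn[OF True]]
            have "\<bar>r (a + X i *\<^sub>R v + z) - r (a + \<tau> *\<^sub>R v + z)\<bar> \<le> L * (\<bar>X i - \<tau>\<bar> * norm v)"
              using lipschitz_onD[OF r in2 in1]
              by (simp add: dist_norm scaleR_diff_left norm_scaleR[symmetric] del: norm_scaleR)
            then have "\<bar>r (a + X i *\<^sub>R v + z) - r (a + \<tau> *\<^sub>R v + z)\<bar> / \<bar>X i - \<tau>\<bar> \<le> L * norm v"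
              using Xi(2) by (simp add: field_simps)
            then show ?thesis using True in1 in2 by (simp add: r'W abs_divide)
          qed simp
        qed
      qed measurable
      then show "((\<lambda>y. (F y - F \<tau>) / (y - \<tau>)) \<circ> X) \<longlonglongrightarrow> Fd \<tau>" by (simp add: o_def eq)
    qed
    have Fdb: "norm (Fd \<tau>) \<le> K * m" if \<tau>: "\<tau> \<in> {0..1}" for \<tau>
    proof -
      have b: "AE z in lborel. \<bar>indicator B z * dir_deriv r' v (a + \<tau> *\<^sub>R v + z)\<bar> \<le> K * indicator B z"
        using AE_lborel_translate[OF dd, of "a + \<tau> *\<^sub>R v"]
        by eventually_elim (use inW[OF \<tau> Bn] in \<open>auto simp: indicator_def\<close>)
      have i: "integrable lborel (\<lambda>z. indicator B z * dir_deriv r' v (a + \<tau> *\<^sub>R v + z))"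
      proof (rule Bochner_Integration.integrable_bound[OF ib[of K]])
        show "AE z in lborel. norm (indicator B z * dir_deriv r' v (a + \<tau> *\<^sub>R v + z)) \<le> norm (K * indicator B z)"
          using b by eventually_elim auto
      qed measurable
      have "norm (Fd \<tau>) \<le> (\<integral>z. \<bar>indicator B z * dir_deriv r' v (a + \<tau> *\<^sub>R v + z)\<bar> \<partial>lborel)"
        unfolding Fd_def real_norm_def by (rule integral_abs_bound)
      also have "\<dots> \<le> (\<integral>z. K * indicator B z \<partial>lborel)"
        using b by (intro integral_mono_AE integrable_abs i ib)
      finally show ?thesis unfolding intB .
    qed
    have F10: "\<bar>F 1 - F 0\<bar> \<le> K * m"
      using field_differentiable_bound[OF convex_real_interval(5) der Fdb, of 1 0] by simp
    have Fpt: "\<bar>F \<tau> - r (a + \<tau> *\<^sub>R v) * m\<bar> \<le> L * \<rho> * m" if \<tau>: "\<tau> \<in> {0..1}" for \<tau>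
    proof -
      have "F \<tau> - r (a + \<tau> *\<^sub>R v) * m = (\<integral>z. indicator B z * r' (a + \<tau> *\<^sub>R v + z) - r (a + \<tau> *\<^sub>R v) * indicator B z \<partial>lborel)"
        unfolding F_def intB[symmetric] by (intro Bochner_Integration.integral_diff[symmetric] Fi \<tau> ib)
      also have "\<bar>\<dots>\<bar> \<le> (\<integral>z. \<bar>indicator B z * r' (a + \<tau> *\<^sub>R v + z) - r (a + \<tau> *\<^sub>R v) * indicator B z\<bar> \<partial>lborel)"
        by (rule integral_abs_bound)
      also have "\<dots> \<le> (\<integral>z. (L * \<rho>) * indicator B z \<partial>lborel)"
      proof (intro integral_mono integrable_abs Bochner_Integration.integrable_diff Fi \<tau> ib)
        fix z :: 'a
        show "\<bar>indicator B z * r' (a + \<tau> *\<^sub>R v + z) - r (a + \<tau> *\<^sub>R v) * indicator B z\<bar> \<le> (L * \<rho>) * indicator B z"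
        proof (cases "z \<in> B")
          case True
          have in0: "a + \<tau> *\<^sub>R v \<in> W" using inW[OF \<tau>, of 0] \<epsilon>(1) by simp
          note in1 = inW[OF \<tau> Bn[OF True]]
          have "\<bar>r (a + \<tau> *\<^sub>R v + z) - r (a + \<tau> *\<^sub>R v)\<bar> \<le> L * norm z"
            using lipschitz_onD[OF r in1 in0] by (simp add: dist_norm)
          also have "\<dots> \<le> L * \<rho>" using True L by (intro mult_left_mono) (auto simp: B_def)
          finally show ?thesis using True in1 by (simp add: r'W)
        qed simp
      qed
      finally show ?thesis unfolding intB .
    qed
    have "\<bar>r b - r a\<bar> * m = \<bar>r b * m - r a * m\<bar>"
      using m by (simp add: abs_mult left_diff_distrib[symmetric])
    also have "\<dots> \<le> K * m + 2 * (L * \<rho> * m)"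
      using F10 Fpt[of 0] Fpt[of 1] by (simp add: v_def)
    also have "\<dots> = (K + 2 * L * \<rho>) * m" by (simp add: algebra_simps)
    finally show ?thesis using m by (simp add: mult_le_cancel_right)
  qed
  show ?thesis
  proof (rule tendsto_lowerbound)
    have "((\<lambda>\<rho>. K + 2 * L * \<rho>) \<longlongrightarrow> K + 2 * L * 0) (at_right 0)" by (intro tendsto_intros)
    then show "((\<lambda>\<rho>. K + 2 * L * \<rho>) \<longlongrightarrow> K) (at_right 0)" by simp
    show "\<forall>\<^sub>F \<rho> in at_right 0. \<bar>r b - r a\<bar> \<le> K + 2 * L * \<rho>"
      using eventually_at_right_real[OF \<epsilon>(1)] by eventually_elim (use small in auto)
  qed simp
qed

lemma differentiable_deformationsD:
  assumes "differentiable_deformations \<Omega> \<epsilon> T"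
  shows "\<epsilon> > 0" "\<And>t. \<bar>t\<bar> < \<epsilon> \<Longrightarrow> bi_lipschitz_on \<Omega> (T t)" "\<And>t. \<bar>t\<bar> < \<epsilon> \<Longrightarrow> continuous_on (closure \<Omega>) (T t)"
    "\<And>x. x \<in> \<Omega> \<Longrightarrow> T 0 x = x"
    "\<And>x. x \<in> \<Omega> \<Longrightarrow> (\<lambda>t. T t x) C1_differentiable_on {-\<epsilon><..<\<epsilon>}"
  using assms by (auto simp: differentiable_deformations_def)

lemma deformation_fixes_closure:
  assumes T: "differentiable_deformations \<Omega> \<epsilon> T" and x: "x \<in> closure \<Omega>"
  shows "T 0 x = x"
proof -
  have "continuous_on (closure \<Omega>) (T 0)" using differentiable_deformationsD(1,3)[OF T] by simp
  then have "continuous_on (closure \<Omega>) (\<lambda>x. T 0 x - x)" by (intro continuous_intros)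
  from continuous_constant_on_closure[OF this, of 0] differentiable_deformationsD(4)[OF T] x
  show ?thesis by simp
qed

text \<open>At almost every point the Jacobi matrix of \<open>T t\<close> differs from the identity
  by at most a constant times \<open>\<bar>t\<bar>\<close>, by the mean value inequality in time.
  Tested against the unit vector \<open>u\<close> along the increment, this bounds the derivative of
  a scalar function whose increment is the norm sought, and
  \<open>AE_derivative_imp_increment_bound\<close> applies.\<close>

lemma deformation_segment_bound:
  assumes T: "differentiable_deformations \<Omega> \<epsilon> T" and \<Omega>: "open \<Omega>"
  obtains K where "K \<ge> 0" "\<And>t a b. \<bar>t\<bar> < \<epsilon> \<Longrightarrow> closed_segment a b \<subseteq> \<Omega> \<Longrightarrow>
    norm ((T t b - b) - (T t a - a)) \<le> K * \<bar>t\<bar> * norm (b - a)"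
proof -
  note TD = differentiable_deformationsD[OF T]
  let ?J = "\<lambda>s x. jacobian (T s) (at x)"
  obtain M where M0: "AE x in lebesgue. x \<in> \<Omega> \<longrightarrow>
        (\<forall>t. \<bar>t\<bar> < \<epsilon> \<longrightarrow>
           T t differentiable (at x) \<and>
           (\<lambda>s. ?J s x) differentiable (at t) \<and>
           norm (vector_derivative (\<lambda>s. ?J s x) (at t)) \<le> M \<and>
           (\<lambda>s. matrix_inv (?J s x)) differentiable (at t) \<and>
           norm (vector_derivative (\<lambda>s. matrix_inv (?J s x)) (at t)) \<le> M)"
    using T unfolding differentiable_deformations_def by blast
  then have M: "AE x in lebesgue. x \<in> \<Omega> \<longrightarrow>
        (\<forall>t. \<bar>t\<bar> < \<epsilon> \<longrightarrow>
           T t differentiable (at x) \<and>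
           (\<lambda>s. ?J s x) differentiable (at t) \<and>
           norm (vector_derivative (\<lambda>s. ?J s x) (at t)) \<le> M)"
    by (rule eventually_mono) blast
  \<comment> \<open>The sign of \<open>M\<close> could be read off only at a point where the bound
    holds; the maximum settles it outright.\<close>
  define M' where "M' = max M 0"
  \<comment> \<open>The square of the dimension passes from a bound on matrix entries to one on the
    operator norm.\<close>
  define K where "K = real CARD('a) * real CARD('a) * M'"
  have K0: "K \<ge> 0" by (simp add: K_def M'_def)
  have J: "norm (?J t x - ?J 0 x) \<le> M' * \<bar>t\<bar>"
    if d: "\<And>s. \<bar>s\<bar> < \<epsilon> \<Longrightarrow> (\<lambda>s. ?J s x) differentiable (at s) \<and> norm (vector_derivative (\<lambda>s. ?J s x) (at s)) \<le> M"
      and t: "\<bar>t\<bar> < \<epsilon>" for x t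
  proof -
    let ?V = "\<lambda>s. vector_derivative (\<lambda>s. ?J s x) (at s)"
    have "norm (?J t x - ?J 0 x) \<le> M' * norm (t - 0)"
    proof (rule differentiable_bound[of "{-\<epsilon><..<\<epsilon>}" _ "\<lambda>s h. h *\<^sub>R ?V s"])
      fix s assume s: "s \<in> {-\<epsilon><..<\<epsilon>}"
      then have "((\<lambda>s. ?J s x) has_vector_derivative ?V s) (at s)"
        using d[of s] vector_derivative_works by (auto simp: abs_less_iff)
      then show "((\<lambda>s. ?J s x) has_derivative (\<lambda>h. h *\<^sub>R ?V s)) (at s within {-\<epsilon><..<\<epsilon>})"
        unfolding has_vector_derivative_def by (rule has_derivative_at_withinI)
      have "norm (?V s) \<le> M'" using d[of s] s by (auto simp: M'_def abs_less_iff)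
      then show "onorm (\<lambda>h. h *\<^sub>R ?V s) \<le> M'"
        by (intro onorm_bound) (auto simp: M'_def mult.commute[of "\<bar>_\<bar>"] intro: mult_right_mono)
    qed (use t TD(1) in \<open>auto simp: abs_less_iff\<close>)
    then show ?thesis by simp
  qed
  show ?thesis
  proof (rule that[OF K0])
    fix t :: real and a b :: "real^'a" assume t: "\<bar>t\<bar> < \<epsilon>" and seg: "closed_segment a b \<subseteq> \<Omega>"
    define R where "R x = T t x - x" for x
    show "norm ((T t b - b) - (T t a - a)) \<le> K * \<bar>t\<bar> * norm (b - a)"
    proof (cases "R b = R a")
      case True
      then have "(T t b - b) - (T t a - a) = 0" by (simp add: R_def)
      moreover have "0 \<le> K * \<bar>t\<bar> * norm (b - a)" using K0 by simp
      ultimately show ?thesis by (metis norm_zero)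
    next
      case False
      define u where "u = (R b - R a) /\<^sub>R norm (R b - R a)"
      have u: "norm u = 1" using False by (simp add: u_def)
      define r where "r x = R x \<bullet> u" for x
      obtain L where L: "L > 0" "\<And>x y. x \<in> \<Omega> \<Longrightarrow> y \<in> \<Omega> \<Longrightarrow> dist (T t x) (T t y) \<le> L * dist x y"
        using TD(2)[OF t] unfolding bi_lipschitz_on_def by blast
      have lip: "(L + 1)-lipschitz_on \<Omega> r"
      proof (rule lipschitz_onI)
        fix x y assume xy: "x \<in> \<Omega>" "y \<in> \<Omega>"
        have "\<bar>r x - r y\<bar> \<le> norm (R x - R y)"
          using Cauchy_Schwarz_ineq2[of "R x - R y" u] u by (simp add: r_def inner_diff_left)
        also have "\<dots> \<le> norm (T t x - T t y) + norm (x - y)"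
          using norm_triangle_ineq4[of "T t x - T t y" "x - y"] by (simp add: R_def algebra_simps)
        also have "\<dots> \<le> (L + 1) * norm (x - y)"
          using L(2)[OF xy] by (simp add: dist_norm algebra_simps)
        finally show "dist (r x) (r y) \<le> (L + 1) * dist x y" by (simp add: dist_norm)
      qed (use L in simp)
      have "AE x in lborel. x \<in> \<Omega> \<longrightarrow>
        (\<forall>t. \<bar>t\<bar> < \<epsilon> \<longrightarrow> T t differentiable (at x) \<and> (\<lambda>s. ?J s x) differentiable (at t) \<and>
           norm (vector_derivative (\<lambda>s. ?J s x) (at t)) \<le> M)"
        using M by (simp add: AE_completion_iff)
      then have "AE x in lborel. x \<in> \<Omega> \<longrightarrow> (\<exists>D. (r has_derivative D) (at x) \<and> \<bar>D (b - a)\<bar> \<le> K * \<bar>t\<bar> * norm (b - a))"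
      proof eventually_elim
        case (elim x)
        show ?case
        proof
          assume x: "x \<in> \<Omega>"
          have Td: "T s differentiable (at x)" if "\<bar>s\<bar> < \<epsilon>" for s using elim x that by blast
          have TJ: "(T s has_derivative (\<lambda>h. ?J s x *v h)) (at x)" if "\<bar>s\<bar> < \<epsilon>" for s
            using jacobian_works[THEN iffD1, OF Td[OF that]] .
          have "(T 0 has_derivative (\<lambda>h. h)) (at x)"
            by (rule has_derivative_transform_within_open[OF has_derivative_ident \<Omega> x]) (simp add: TD(4))
          from has_derivative_unique[OF this TJ[of 0]] have J0: "?J 0 x *v h = h" for h
            using TD(1) by (metis abs_zero)
          have "(r has_derivative (\<lambda>h. (?J t x *v h - h) \<bullet> u)) (at x)"
            unfolding r_def R_def using TJ[OF t] by (auto intro!: derivative_eq_intros)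
          moreover have "\<bar>(?J t x *v (b - a) - (b - a)) \<bullet> u\<bar> \<le> K * \<bar>t\<bar> * norm (b - a)"
          proof -
            let ?A = "?J t x - ?J 0 x"
            have nA: "norm ?A \<le> M' * \<bar>t\<bar>" using J[OF _ t] elim x by blast
            have "\<bar>?A $ i $ j\<bar> \<le> M' * \<bar>t\<bar>" for i j
              using component_le_norm_cart[of "?A $ i" j] Finite_Cartesian_Product.norm_nth_le[of ?A i] nA by linarith
            then have "onorm ((*v) ?A) \<le> real CARD('a) * real CARD('a) * (M' * \<bar>t\<bar>)"
              by (rule onorm_le_matrix_component)
            then have "onorm ((*v) ?A) * norm (b - a) \<le> real CARD('a) * real CARD('a) * (M' * \<bar>t\<bar>) * norm (b - a)"
              by (rule mult_right_mono) simp
            also have "\<dots> = K * \<bar>t\<bar> * norm (b - a)" by (simp add: K_def)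
            finally have "norm (?A *v (b - a)) \<le> K * \<bar>t\<bar> * norm (b - a)"
              using onorm[OF matrix_vector_mul_bounded_linear, of ?A "b - a"] by linarith
            moreover have "?A *v (b - a) = ?J t x *v (b - a) - (b - a)"
              by (simp add: matrix_vector_mult_diff_rdistrib J0)
            moreover have "\<bar>(?J t x *v (b - a) - (b - a)) \<bullet> u\<bar> \<le> norm (?J t x *v (b - a) - (b - a))"
              using Cauchy_Schwarz_ineq2[of "?J t x *v (b - a) - (b - a)" u] u by simp
            ultimately show ?thesis by simp
          qed
          ultimately show "\<exists>D. (r has_derivative D) (at x) \<and> \<bar>D (b - a)\<bar> \<le> K * \<bar>t\<bar> * norm (b - a)" by blast
        qed
      qed
      from AE_derivative_imp_increment_bound[OF \<Omega> seg lip this]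
      have "\<bar>r b - r a\<bar> \<le> K * \<bar>t\<bar> * norm (b - a)" .
      moreover have "r b - r a = norm (R b - R a)"
      proof -
        define w where "w = R b - R a"
        have "r b - r a = w \<bullet> u" by (simp add: r_def w_def inner_diff_left)
        also have "\<dots> = inverse (norm w) * (norm w * norm w)"
          by (simp add: u_def w_def[symmetric] power2_norm_eq_inner[symmetric] power2_eq_square)
        finally show ?thesis using False by (simp add: w_def)
      qed
      ultimately show ?thesis by (simp add: R_def)
    qed
  qed
qed

text \<open>Two points near the boundary at distance \<open>d\<close> are joined by descending
  \<open>(L + 1) * d\<close> along \<open>- e\<close> from each and crossing between the lowered
  points. Along the crossing the graph drops by at most \<open>L * d\<close> and the points rise by
  at most \<open>d\<close>, so the path stays below the graph. Its length is at most
  \<open>(2 * L + 3) * d\<close>, the origin of the constant; continuity extends the bound to the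
  closure.\<close>

lemma deformation_local_lipschitz:
  assumes T: "differentiable_deformations \<Omega> \<epsilon> T" and dom: "lipschitz_domain \<Omega>" and p: "p \<in> closure \<Omega>"
  shows "\<exists>\<rho>>0. \<exists>K\<ge>0. \<forall>t. \<bar>t\<bar> < \<epsilon> \<longrightarrow> (K * \<bar>t\<bar>)-lipschitz_on (closure \<Omega> \<inter> ball p \<rho>) (\<lambda>x. T t x - x)"
proof -
  note TD = differentiable_deformationsD[OF T]
  have \<Omega>: "open \<Omega>" using dom by (simp add: lipschitz_domain_def)
  obtain K where K: "K \<ge> 0" "\<And>t a b. \<bar>t\<bar> < \<epsilon> \<Longrightarrow> closed_segment a b \<subseteq> \<Omega> \<Longrightarrow>
    norm ((T t b - b) - (T t a - a)) \<le> K * \<bar>t\<bar> * norm (b - a)"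
    by (rule deformation_segment_bound[OF T \<Omega>]) blast
  have "\<exists>\<rho>>0. \<exists>c\<ge>0. \<forall>t. \<bar>t\<bar> < \<epsilon> \<longrightarrow> (\<forall>a\<in>\<Omega> \<inter> ball p \<rho>. \<forall>b\<in>\<Omega> \<inter> ball p \<rho>.
      norm ((T t b - b) - (T t a - a)) \<le> K * c * \<bar>t\<bar> * norm (b - a))"
  proof (cases "p \<in> \<Omega>")
    case True
    then obtain \<rho> where \<rho>: "\<rho> > 0" "ball p \<rho> \<subseteq> \<Omega>" using \<Omega> open_contains_ball by blast
    have "closed_segment a b \<subseteq> \<Omega>" if "a \<in> ball p \<rho>" "b \<in> ball p \<rho>" for a b
      using closed_segment_subset[OF that convex_ball] \<rho>(2) by blast
    then show ?thesis using \<rho>(1) K(2) by (intro exI[of _ \<rho>] conjI exI[of _ 1]) auto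
  next
    case False
    then have "p \<in> frontier \<Omega>" using p \<Omega> by (simp add: frontier_def interior_open)
    then obtain U e \<phi> where pU: "p \<in> U" and chart: "lipschitz_chart \<Omega> U e \<phi>"
      using dom unfolding lipschitz_domain_def by blast
    obtain L where L: "L-lipschitz_on UNIV \<phi>" and U: "open U" and e: "norm e = 1" "e \<bullet> e = 1"
      and inv: "\<And>x s. \<phi> (x + s *\<^sub>R e) = \<phi> x" and iff: "\<And>x. x \<in> U \<Longrightarrow> x \<in> \<Omega> \<longleftrightarrow> x \<bullet> e < \<phi> x"
      by (rule lipschitz_chartD[OF chart]) blast
    have Ln: "L \<ge> 0" by (rule lipschitz_on_nonneg[OF L])
    obtain \<rho>U where \<rho>U: "\<rho>U > 0" "ball p \<rho>U \<subseteq> U" using U pU open_contains_ball by blast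
    \<comment> \<open>Since \<open>d < 2 * \<rho>\<close>, the descent is at most
      \<open>2 * (L + 1) * \<rho>\<close>, which together with \<rho> fits into the radius
      \<open>\<rho>U\<close>.\<close>
    define \<rho> where "\<rho> = \<rho>U / (2 * L + 3)"
    have \<rho>: "\<rho> > 0" "(2 * L + 3) * \<rho> = \<rho>U" using \<rho>U(1) Ln by (auto simp: \<rho>_def)
    have "norm ((T t b - b) - (T t a - a)) \<le> K * (2 * L + 3) * \<bar>t\<bar> * norm (b - a)"
      if t: "\<bar>t\<bar> < \<epsilon>" and a: "a \<in> \<Omega>" "a \<in> ball p \<rho>" and b: "b \<in> \<Omega>" "b \<in> ball p \<rho>" for t a b
    proof -
      define d where "d = norm (b - a)"
      define \<mu> where "\<mu> = (L + 1) * d"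
      have d: "d < 2 * \<rho>" using a(2) b(2) dist_triangle2[of b a p] by (simp add: d_def dist_norm norm_minus_commute)
      have d0: "d \<ge> 0" by (simp add: d_def)
      have \<mu>: "\<mu> \<ge> 0" using Ln d0 by (simp add: \<mu>_def)
      have "(L + 1) * d \<le> (L + 1) * (2 * \<rho>)" using d Ln by (intro mult_left_mono) auto
      then have \<mu>\<rho>: "\<rho> + \<mu> \<le> \<rho>U" unfolding \<mu>_def \<rho>(2)[symmetric] by (simp add: algebra_simps)
      have inU: "x - s *\<^sub>R e \<in> U" if "x \<in> ball p \<rho>" "0 \<le> s" "s \<le> \<mu>" for x s
      proof -
        have "dist p (x - s *\<^sub>R e) \<le> dist p x + norm (s *\<^sub>R e)"
          using norm_triangle_ineq[of "p - x" "s *\<^sub>R e"] by (simp add: dist_norm algebra_simps)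
        then show ?thesis using that \<mu>\<rho> e(1) by (intro subsetD[OF \<rho>U(2)]) auto
      qed
      have U0: "x \<in> U" if "x \<in> ball p \<rho>" for x using inU[of x 0] that \<mu> by simp
      have vert: "closed_segment x (x - \<mu> *\<^sub>R e) \<subseteq> \<Omega>" if x: "x \<in> \<Omega>" "x \<in> ball p \<rho>" for x
      proof
        fix y assume "y \<in> closed_segment x (x - \<mu> *\<^sub>R e)"
        then obtain s where s: "0 \<le> s" "s \<le> 1" "y = x - (s * \<mu>) *\<^sub>R e"
          unfolding closed_segment_def by (auto simp: algebra_simps)
        have sl: "0 \<le> s * \<mu>" "s * \<mu> \<le> \<mu>" using s(1,2) \<mu> by (auto simp: mult_left_le_one_le)
        have "y \<in> U" unfolding s(3) by (rule inU[OF x(2) sl])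
        moreover have "\<phi> y = \<phi> x" unfolding s(3) using inv[of x "- (s * \<mu>)"] by simp
        moreover have "y \<bullet> e \<le> x \<bullet> e" using sl e(2) by (simp add: s(3) inner_diff_left)
        ultimately show "y \<in> \<Omega>" using iff[of y] iff[OF U0[OF x(2)]] x(1) by simp
      qed
      have horiz: "closed_segment (a - \<mu> *\<^sub>R e) (b - \<mu> *\<^sub>R e) \<subseteq> \<Omega>"
      proof
        fix y assume "y \<in> closed_segment (a - \<mu> *\<^sub>R e) (b - \<mu> *\<^sub>R e)"
        then obtain s where s: "0 \<le> s" "s \<le> 1" and y: "y = (1 - s) *\<^sub>R (a - \<mu> *\<^sub>R e) + s *\<^sub>R (b - \<mu> *\<^sub>R e)"
          unfolding closed_segment_def by auto
        define x where "x = a + s *\<^sub>R (b - a)"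
        have yx: "y = x - \<mu> *\<^sub>R e" unfolding y x_def by (simp add: algebra_simps)
        have "x = (1 - s) *\<^sub>R a + s *\<^sub>R b" by (simp add: x_def algebra_simps)
        then have xb: "x \<in> ball p \<rho>" using convexD[OF convex_ball a(2) b(2), of "1 - s" s] s by simp
        have sd: "s * d \<le> d" using s d0 by (simp add: mult_left_le_one_le)
        have "\<phi> y = \<phi> x" unfolding yx using inv[of x "- \<mu>"] by simp
        moreover have "\<bar>\<phi> x - \<phi> a\<bar> \<le> L * (s * d)"
          using lipschitz_onD[OF L, of x a] s by (simp add: dist_norm x_def d_def)
        moreover have "L * (s * d) \<le> L * d" using sd Ln by (rule mult_left_mono)
        moreover have "(s *\<^sub>R (b - a)) \<bullet> e \<le> d"
          using Cauchy_Schwarz_ineq2[of "s *\<^sub>R (b - a)" e] e s sd by (simp add: d_def)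
        moreover have "a \<bullet> e < \<phi> a" using iff[OF U0[OF a(2)]] a(1) by simp
        moreover have "y \<bullet> e = a \<bullet> e + (s *\<^sub>R (b - a)) \<bullet> e - \<mu>"
          unfolding yx x_def by (simp only: inner_diff_left inner_add_left inner_scaleR_left e mult_1_right)
        moreover have "\<mu> = L * d + d" by (simp add: \<mu>_def algebra_simps)
        ultimately have "y \<bullet> e < \<phi> y" by linarith
        moreover have "y \<in> U" unfolding yx by (rule inU[OF xb \<mu> order_refl])
        ultimately show "y \<in> \<Omega>" using iff by blast
      qed
      define R where "R x = T t x - x" for x
      have "norm (R (a - \<mu> *\<^sub>R e) - R a) \<le> K * \<bar>t\<bar> * \<mu>"
        using K(2)[OF t vert[OF a]] \<mu> e(1) by (simp add: R_def)
      moreover have "norm (R (b - \<mu> *\<^sub>R e) - R (a - \<mu> *\<^sub>R e)) \<le> K * \<bar>t\<bar> * d"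
        using K(2)[OF t horiz] by (simp add: R_def d_def)
      moreover have "norm (R (b - \<mu> *\<^sub>R e) - R b) \<le> K * \<bar>t\<bar> * \<mu>"
        using K(2)[OF t vert[OF b]] \<mu> e(1) by (simp add: R_def)
      moreover have "R b - R a = (R (a - \<mu> *\<^sub>R e) - R a) + (R (b - \<mu> *\<^sub>R e) - R (a - \<mu> *\<^sub>R e)) - (R (b - \<mu> *\<^sub>R e) - R b)"
        by simp
      ultimately have "norm (R b - R a) \<le> K * \<bar>t\<bar> * \<mu> + K * \<bar>t\<bar> * d + K * \<bar>t\<bar> * \<mu>"
        by (metis (no_types, lifting) add_mono norm_triangle_le norm_triangle_le_diff)
      also have "\<dots> = K * (2 * L + 3) * \<bar>t\<bar> * norm (b - a)"
        by (simp add: \<mu>_def d_def algebra_simps)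
      finally show ?thesis by (simp add: R_def)
    qed
    then show ?thesis using \<rho>(1) Ln by (intro exI[of _ \<rho>] conjI exI[of _ "2 * L + 3"]) auto
  qed
  then obtain \<rho> c where \<rho>: "\<rho> > 0" "c \<ge> 0" "\<And>t a b. \<bar>t\<bar> < \<epsilon> \<Longrightarrow> a \<in> \<Omega> \<inter> ball p \<rho> \<Longrightarrow> b \<in> \<Omega> \<inter> ball p \<rho> \<Longrightarrow>
      norm ((T t b - b) - (T t a - a)) \<le> K * c * \<bar>t\<bar> * norm (b - a)" by blast
  have sub: "closure (\<Omega> \<inter> ball p \<rho>) \<subseteq> closure \<Omega>" by (rule closure_mono) auto
  have "(K * c * \<bar>t\<bar>)-lipschitz_on (closure \<Omega> \<inter> ball p \<rho>) (\<lambda>x. T t x - x)" if t: "\<bar>t\<bar> < \<epsilon>" for t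
  proof -
    have "(K * c * \<bar>t\<bar>)-lipschitz_on (\<Omega> \<inter> ball p \<rho>) (\<lambda>x. T t x - x)"
      using \<rho>(3)[OF t] K(1) \<rho>(2) by (intro lipschitz_onI) (auto simp: dist_norm)
    moreover have "continuous_on (closure (\<Omega> \<inter> ball p \<rho>)) (\<lambda>x. T t x - x)"
      by (intro continuous_intros continuous_on_subset[OF TD(3)[OF t] sub])
    ultimately have "(K * c * \<bar>t\<bar>)-lipschitz_on (closure (\<Omega> \<inter> ball p \<rho>)) (\<lambda>x. T t x - x)"
      by (rule lipschitz_on_closure)
    moreover have "closure \<Omega> \<inter> ball p \<rho> \<subseteq> closure (\<Omega> \<inter> ball p \<rho>)"
      using open_Int_closure_subset[OF open_ball, of p \<rho> \<Omega>] by (simp add: Int_commute)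
    ultimately show ?thesis by (rule lipschitz_on_subset)
  qed
  then show ?thesis using \<rho>(1,2) K(1) by (intro exI[of _ \<rho>] conjI exI[of _ "K * c"]) auto
qed

lemma has_vector_derivative_at_0_iff:
  "(f has_vector_derivative D) (at 0) \<longleftrightarrow> ((\<lambda>t. (f t - f 0) /\<^sub>R t) \<longlongrightarrow> D) (at 0)"
proof -
  have "(f has_vector_derivative D) (at 0) \<longleftrightarrow> ((\<lambda>h. norm (f h - f 0 - h *\<^sub>R D) / norm h) \<longlongrightarrow> 0) (at 0)"
    by (simp add: has_vector_derivative_def has_derivative_at bounded_linear_scaleR_left)
  also have "\<dots> \<longleftrightarrow> ((\<lambda>h. norm ((f h - f 0) /\<^sub>R h - D)) \<longlongrightarrow> 0) (at 0)"
  proof (rule LIM_cong)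
    fix h :: real assume "h \<noteq> 0"
    then have "(f h - f 0) /\<^sub>R h - D = (f h - f 0 - h *\<^sub>R D) /\<^sub>R h" by (simp add: scaleR_diff_right)
    then show "norm (f h - f 0 - h *\<^sub>R D) / norm h = norm ((f h - f 0) /\<^sub>R h - D)"
      by (simp add: divide_inverse mult.commute)
  qed simp_all
  also have "\<dots> \<longleftrightarrow> ((\<lambda>t. (f t - f 0) /\<^sub>R t) \<longlongrightarrow> D) (at 0)"
    by (simp add: tendsto_norm_zero_iff LIM_zero_iff)
  finally show ?thesis .
qed

section \<open>The velocity field up to the boundary\<close>

lemma deformation_field_tendsto_interior:
  assumes T: "differentiable_deformations \<Omega> \<epsilon> T" and x: "x \<in> \<Omega>"
  shows "((\<lambda>t. (T t x - x) /\<^sub>R t) \<longlongrightarrow> deformation_field T x) (at 0)"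
proof -
  note TD = differentiable_deformationsD[OF T]
  obtain D where D: "((\<lambda>t. T t x) has_vector_derivative D) (at 0)"
    using TD(5)[OF x] TD(1) unfolding C1_differentiable_on_def by force
  then have "deformation_field T x = D" unfolding deformation_field_def by (rule vector_derivative_at)
  with D show ?thesis using TD(4)[OF x] by (simp add: has_vector_derivative_at_0_iff)
qed

text \<open>Differentiability in time is assumed in \<Omega> only. Near \<open>p\<close> the
  difference quotients are Lipschitz in space uniformly in \<open>t\<close>, so the velocities at
  interior points tending to \<open>p\<close> form a Cauchy sequence, and the quotient at
  \<open>p\<close> converges to its limit.\<close>

lemma deformation_field_closure:
  assumes T: "differentiable_deformations \<Omega> \<epsilon> T" and dom: "lipschitz_domain \<Omega>" and p: "p \<in> closure \<Omega>"
  shows "((\<lambda>t. (T t p - p) /\<^sub>R t) \<longlongrightarrow> deformation_field T p) (at 0)"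
proof -
  note TD = differentiable_deformationsD[OF T]
  let ?S = "deformation_field T"
  obtain \<rho> K where \<rho>: "\<rho> > 0" "K \<ge> 0"
    "\<And>t. \<bar>t\<bar> < \<epsilon> \<Longrightarrow> (K * \<bar>t\<bar>)-lipschitz_on (closure \<Omega> \<inter> ball p \<rho>) (\<lambda>x. T t x - x)"
    using deformation_local_lipschitz[OF T dom p] by blast
  define Q where "Q t x = (T t x - x) /\<^sub>R t" for t x
  have Q: "norm (Q t a - Q t b) \<le> K * norm (a - b)"
    if "a \<in> closure \<Omega> \<inter> ball p \<rho>" "b \<in> closure \<Omega> \<inter> ball p \<rho>" "t \<noteq> 0" "\<bar>t\<bar> < \<epsilon>" for t a b
  proof -
    have "norm ((T t a - a) - (T t b - b)) \<le> K * \<bar>t\<bar> * norm (a - b)"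
      using lipschitz_onD[OF \<rho>(3)[OF that(4)] that(1,2)] by (simp add: dist_norm)
    then have "norm ((T t a - a) - (T t b - b)) / \<bar>t\<bar> \<le> K * norm (a - b)"
      using that(3) by (simp add: field_simps)
    moreover have "Q t a - Q t b = ((T t a - a) - (T t b - b)) /\<^sub>R t"
      by (simp add: Q_def scaleR_diff_right)
    ultimately show ?thesis by (simp add: divide_inverse mult.commute)
  qed
  have ev: "\<forall>\<^sub>F t in at 0. t \<noteq> 0 \<and> \<bar>t\<bar> < \<epsilon>"
    using TD(1) by (auto simp: eventually_at intro!: exI[of _ \<epsilon>])
  have Sl: "norm (?S a - ?S b) \<le> K * norm (a - b)"
    if "a \<in> \<Omega> \<inter> ball p \<rho>" "b \<in> \<Omega> \<inter> ball p \<rho>" for a b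
  proof (rule tendsto_upperbound)
    show "((\<lambda>t. norm (Q t a - Q t b)) \<longlongrightarrow> norm (?S a - ?S b)) (at 0)"
      unfolding Q_def using that by (intro tendsto_intros deformation_field_tendsto_interior[OF T]) auto
    show "\<forall>\<^sub>F t in at 0. norm (Q t a - Q t b) \<le> K * norm (a - b)"
      using ev by eventually_elim (use that closure_subset in \<open>auto intro!: Q\<close>)
  qed simp
  have "\<exists>a. a \<in> \<Omega> \<and> dist a p < \<rho> \<and> dist a p < 1 / (real n + 1)" for n :: nat
  proof -
    have "min \<rho> (1 / (real n + 1)) > 0" using \<rho>(1) by simp
    then obtain a where "a \<in> \<Omega>" "dist a p < min \<rho> (1 / (real n + 1))"
      using p unfolding closure_approachable by blast
    then show ?thesis by auto
  qed
  then have "\<forall>n::nat. \<exists>a. a \<in> \<Omega> \<and> dist a p < \<rho> \<and> dist a p < 1 / (real n + 1)" by blast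
  from choice[OF this] obtain a where
    a: "\<And>n. a n \<in> \<Omega>" "\<And>n. dist (a n) p < \<rho>" "\<And>n. dist (a n) p < 1 / (real n + 1)"
    by blast
  have ap: "a \<longlonglongrightarrow> p"
    by (rule metric_tendsto_imp_tendsto[OF tendsto_harmonic]) (use a(3) in \<open>auto simp: less_imp_le dist_real_def\<close>)
  have ab: "a n \<in> \<Omega> \<inter> ball p \<rho>" for n using a by (simp add: dist_commute)
  have "Cauchy (\<lambda>n. ?S (a n))"
  proof (rule metric_CauchyI)
    fix e :: real assume e: "0 < e"
    have "Cauchy a" using ap LIMSEQ_imp_Cauchy by blast
    then obtain M where M: "\<And>m n. m \<ge> M \<Longrightarrow> n \<ge> M \<Longrightarrow> dist (a m) (a n) < e / (K + 1)"
      using metric_CauchyD[of a "e / (K + 1)"] e \<rho>(2) by auto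
    have "dist (?S (a m)) (?S (a n)) < e" if "m \<ge> M" "n \<ge> M" for m n
    proof -
      have "dist (?S (a m)) (?S (a n)) \<le> K * dist (a m) (a n)" using Sl[OF ab ab] by (simp add: dist_norm)
      also have "\<dots> \<le> K * (e / (K + 1))" using M[OF that] \<rho>(2) by (intro mult_left_mono) auto
      also have "\<dots> < e" using e \<rho>(2) by (simp add: field_simps)
      finally show ?thesis .
    qed
    then show "\<exists>M. \<forall>m\<ge>M. \<forall>n\<ge>M. dist (?S (a m)) (?S (a n)) < e" by blast
  qed
  then obtain l where l: "(\<lambda>n. ?S (a n)) \<longlonglongrightarrow> l" using Cauchy_convergent convergent_def by blast
  have lim: "((\<lambda>t. Q t p) \<longlongrightarrow> l) (at 0)"
  proof (rule tendstoI)
    fix e :: real assume e: "0 < e"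
    have "\<forall>\<^sub>F n in sequentially. dist (?S (a n)) l < e / 3" using l e by (intro tendstoD) auto
    moreover have "\<forall>\<^sub>F n in sequentially. dist (a n) p < e / (3 * (K + 1))" using ap e \<rho>(2) by (intro tendstoD) auto
    ultimately obtain n where n: "dist (?S (a n)) l < e / 3" "dist (a n) p < e / (3 * (K + 1))"
      using eventually_happens'[OF sequentially_bot eventually_conj] by blast
    have "K * dist (a n) p \<le> K * (e / (3 * (K + 1)))" using n(2) \<rho>(2) by (intro mult_left_mono) auto
    also have "\<dots> < e / 3" using e \<rho>(2) by (simp add: field_simps)
    finally have Kn: "K * dist (a n) p < e / 3" .
    have "\<forall>\<^sub>F t in at 0. dist (Q t (a n)) (?S (a n)) < e / 3"
      unfolding Q_def using e a(1) by (intro tendstoD deformation_field_tendsto_interior[OF T]) auto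
    with ev show "\<forall>\<^sub>F t in at 0. dist (Q t p) l < e"
    proof eventually_elim
      case (elim t)
      have "dist (Q t p) (Q t (a n)) \<le> K * dist (a n) p"
        using Q[of p "a n" t] elim(1) p \<rho>(1) ab[of n] closure_subset[of \<Omega>] by (auto simp: dist_norm norm_minus_commute)
      then show ?case
        using dist_triangle[of "Q t p" l "Q t (a n)"] dist_triangle[of "Q t (a n)" l "?S (a n)"] elim(2) n(1) Kn by linarith
    qed
  qed
  have "((\<lambda>t. T t p) has_vector_derivative l) (at 0)"
    unfolding has_vector_derivative_at_0_iff deformation_fixes_closure[OF T p] using lim by (simp add: Q_def)
  then have "?S p = l" unfolding deformation_field_def by (rule vector_derivative_at)
  then show ?thesis using lim by (simp add: Q_def)
qed

text \<open>Half of the tolerance pays for the convergence of the quotient at \<open>p\<close>, the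
  other half for moving from \<open>p\<close> to \<open>x\<close>, which costs at most
  \<open>K * \<bar>t\<bar> * \<rho>'\<close>. The uniformity in \<open>x\<close> comes from the
  local Lipschitz bound.\<close>

lemma deformation_expansion:
  assumes T: "differentiable_deformations \<Omega> \<epsilon> T" and dom: "lipschitz_domain \<Omega>" and p: "p \<in> closure \<Omega>" and \<eta>: "\<eta> > 0"
  shows "\<exists>\<rho>>0. \<forall>\<^sub>F t in at 0. \<forall>x\<in>closure \<Omega> \<inter> ball p \<rho>. norm (T t x - x - t *\<^sub>R deformation_field T p) \<le> \<bar>t\<bar> * \<eta>"
proof -
  note TD = differentiable_deformationsD[OF T]
  let ?S = "deformation_field T"
  obtain \<rho> K where \<rho>: "\<rho> > 0" "K \<ge> 0"
    "\<And>t. \<bar>t\<bar> < \<epsilon> \<Longrightarrow> (K * \<bar>t\<bar>)-lipschitz_on (closure \<Omega> \<inter> ball p \<rho>) (\<lambda>x. T t x - x)"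
    using deformation_local_lipschitz[OF T dom p] by blast
  define \<rho>' where "\<rho>' = min \<rho> (\<eta> / (2 * (K + 1)))"
  have \<rho>': "\<rho>' > 0" "\<rho>' \<le> \<rho>" using \<rho>(1,2) \<eta> by (auto simp: \<rho>'_def)
  have "K * \<rho>' \<le> K * (\<eta> / (2 * (K + 1)))" using \<rho>(2) by (intro mult_left_mono) (auto simp: \<rho>'_def)
  also have "\<dots> \<le> \<eta> / 2" using \<rho>(2) \<eta> by (simp add: field_simps)
  finally have K\<rho>: "K * \<rho>' \<le> \<eta> / 2" .
  have ev: "\<forall>\<^sub>F t in at 0. t \<noteq> 0 \<and> \<bar>t\<bar> < \<epsilon>"
    using TD(1) by (auto simp: eventually_at intro!: exI[of _ \<epsilon>])
  have "\<forall>\<^sub>F t in at 0. dist ((T t p - p) /\<^sub>R t) (?S p) < \<eta> / 2"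
    using \<eta> by (intro tendstoD deformation_field_closure[OF T dom p]) auto
  with ev have "\<forall>\<^sub>F t in at 0. \<forall>x\<in>closure \<Omega> \<inter> ball p \<rho>'. norm (T t x - x - t *\<^sub>R ?S p) \<le> \<bar>t\<bar> * \<eta>"
  proof eventually_elim
    case (elim t)
    show ?case
    proof
      fix x assume x: "x \<in> closure \<Omega> \<inter> ball p \<rho>'"
      have "norm ((T t x - x) - (T t p - p)) \<le> K * \<bar>t\<bar> * norm (x - p)"
        using lipschitz_onD[OF \<rho>(3), of t x p] elim(1) x p \<rho>(1) \<rho>'(2) by (simp add: dist_norm)
      also have "\<dots> \<le> K * \<bar>t\<bar> * \<rho>'"
        using x \<rho>(2) by (intro mult_left_mono) (auto simp: dist_norm norm_minus_commute)
      also have "\<dots> \<le> \<bar>t\<bar> * (\<eta> / 2)"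
        using mult_left_mono[OF K\<rho>, of "\<bar>t\<bar>"] by (simp add: mult_ac)
      finally have 1: "norm ((T t x - x) - (T t p - p)) \<le> \<bar>t\<bar> * (\<eta> / 2)" .
      have "T t p - p - t *\<^sub>R ?S p = t *\<^sub>R ((T t p - p) /\<^sub>R t - ?S p)"
        using elim(1) by (simp add: scaleR_diff_right)
      then have "norm (T t p - p - t *\<^sub>R ?S p) = \<bar>t\<bar> * norm ((T t p - p) /\<^sub>R t - ?S p)" by simp
      also have "\<dots> \<le> \<bar>t\<bar> * (\<eta> / 2)" using elim(2) by (intro mult_left_mono) (auto simp: dist_norm)
      finally have 2: "norm (T t p - p - t *\<^sub>R ?S p) \<le> \<bar>t\<bar> * (\<eta> / 2)" .
      have "T t x - x - t *\<^sub>R ?S p = ((T t x - x) - (T t p - p)) + (T t p - p - t *\<^sub>R ?S p)" by simp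
      then have "norm (T t x - x - t *\<^sub>R ?S p) \<le> \<bar>t\<bar> * (\<eta> / 2) + \<bar>t\<bar> * (\<eta> / 2)"
        using 1 2 norm_triangle_mono by metis
      then show "norm (T t x - x - t *\<^sub>R ?S p) \<le> \<bar>t\<bar> * \<eta>" by (simp add: field_simps)
    qed
  qed
  with \<rho>'(1) show ?thesis by blast
qed

text \<open>The expansion at \<open>p\<close>, divided by \<open>t\<close>, controls the quotients
  at all nearby points; their limits inherit the bound.\<close>

lemma continuous_on_deformation_field:
  assumes T: "differentiable_deformations \<Omega> \<epsilon> T" and dom: "lipschitz_domain \<Omega>"
  shows "continuous_on (closure \<Omega>) (deformation_field T)"
  unfolding continuous_on_iff
proof (intro ballI allI impI)
  fix p and e :: real assume p: "p \<in> closure \<Omega>" and e: "0 < e"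
  let ?S = "deformation_field T"
  obtain \<rho> where \<rho>: "\<rho> > 0"
    "\<forall>\<^sub>F t in at 0. \<forall>x\<in>closure \<Omega> \<inter> ball p \<rho>. norm (T t x - x - t *\<^sub>R ?S p) \<le> \<bar>t\<bar> * (e / 2)"
    using deformation_expansion[OF T dom p, of "e / 2"] e by auto
  have "dist (?S x) (?S p) < e" if x: "x \<in> closure \<Omega>" "dist x p < \<rho>" for x
  proof -
    have "norm (?S x - ?S p) \<le> e / 2"
    proof (rule tendsto_upperbound)
      show "((\<lambda>t. norm ((T t x - x) /\<^sub>R t - ?S p)) \<longlongrightarrow> norm (?S x - ?S p)) (at 0)"
        by (intro tendsto_intros deformation_field_closure[OF T dom x(1)])
      have "\<forall>\<^sub>F t in at (0::real). t \<noteq> 0" by (simp add: eventually_at_filter)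
      with \<rho>(2) show "\<forall>\<^sub>F t in at 0. norm ((T t x - x) /\<^sub>R t - ?S p) \<le> e / 2"
      proof eventually_elim
        case (elim t)
        have "norm (T t x - x - t *\<^sub>R ?S p) \<le> \<bar>t\<bar> * (e / 2)" using elim(1) x by (simp add: dist_commute)
        moreover have "(T t x - x) /\<^sub>R t - ?S p = (T t x - x - t *\<^sub>R ?S p) /\<^sub>R t"
          using elim(2) by (simp add: scaleR_diff_right)
        ultimately show ?case using elim(2) by (simp add: divide_simps mult.commute)
      qed
    qed simp
    then show ?thesis using e by (simp add: dist_norm)
  qed
  with \<rho>(1) show "\<exists>d>0. \<forall>x'\<in>closure \<Omega>. dist x' p < d \<longrightarrow> dist (?S x') (?S p) < e" by blast
qed

lemma deformation_uniform_bound: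
  assumes T: "differentiable_deformations \<Omega> \<epsilon> T" and dom: "lipschitz_domain \<Omega>" "bounded \<Omega>"
  obtains C \<delta> where "C \<ge> 0" "0 < \<delta>" "\<delta> \<le> \<epsilon>"
    "\<And>t x. \<bar>t\<bar> < \<delta> \<Longrightarrow> x \<in> \<Omega> \<Longrightarrow> norm (T t x - x) \<le> C * \<bar>t\<bar>"
proof -
  note TD = differentiable_deformationsD[OF T]
  let ?S = "deformation_field T"
  have "\<forall>p\<in>closure \<Omega>. \<exists>\<rho>>0. \<forall>\<^sub>F t in at 0. \<forall>x\<in>closure \<Omega> \<inter> ball p \<rho>. norm (T t x - x - t *\<^sub>R ?S p) \<le> \<bar>t\<bar> * 1"
    using deformation_expansion[OF T dom(1) _ zero_less_one] by blast
  from bchoice[OF this] obtain \<rho> where \<rho>: "\<And>p. p \<in> closure \<Omega> \<Longrightarrow> \<rho> p > 0"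
    "\<And>p. p \<in> closure \<Omega> \<Longrightarrow> \<forall>\<^sub>F t in at 0. \<forall>x\<in>closure \<Omega> \<inter> ball p (\<rho> p). norm (T t x - x - t *\<^sub>R ?S p) \<le> \<bar>t\<bar> * 1"
    by blast
  have comp: "compact (closure \<Omega>)" using dom(2) by (simp add: compact_closure)
  have cov: "closure \<Omega> \<subseteq> (\<Union>p\<in>closure \<Omega>. ball p (\<rho> p))" using \<rho>(1) by force
  obtain F where F: "F \<subseteq> closure \<Omega>" "finite F" "closure \<Omega> \<subseteq> (\<Union>p\<in>F. ball p (\<rho> p))"
    by (rule compactE_image[OF comp _ cov]) auto
  \<comment> \<open>The sum over the finite cover dominates each velocity \<open>?S p\<close>, and
    the summand 1 is the tolerance used in the expansion.\<close>
  define C where "C = 1 + (\<Sum>p\<in>F. norm (?S p))"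
  have C: "C \<ge> 0" by (simp add: C_def add_nonneg_nonneg sum_nonneg)
  have "\<forall>\<^sub>F t in at 0. \<forall>p\<in>F. \<forall>x\<in>closure \<Omega> \<inter> ball p (\<rho> p). norm (T t x - x - t *\<^sub>R ?S p) \<le> \<bar>t\<bar> * 1"
    using F(1) \<rho>(2) by (intro eventually_ball_finite[OF F(2)]) blast
  then obtain \<delta> where \<delta>: "\<delta> > 0" "\<And>t. t \<noteq> 0 \<Longrightarrow> \<bar>t\<bar> < \<delta> \<Longrightarrow>
      \<forall>p\<in>F. \<forall>x\<in>closure \<Omega> \<inter> ball p (\<rho> p). norm (T t x - x - t *\<^sub>R ?S p) \<le> \<bar>t\<bar> * 1"
    unfolding eventually_at by (auto simp: dist_real_def)
  show ?thesis
  proof (rule that[OF C])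
    show "0 < min \<delta> \<epsilon>" "min \<delta> \<epsilon> \<le> \<epsilon>" using \<delta>(1) TD(1) by auto
    fix t x assume t: "\<bar>t\<bar> < min \<delta> \<epsilon>" and x: "x \<in> \<Omega>"
    show "norm (T t x - x) \<le> C * \<bar>t\<bar>"
    proof (cases "t = 0")
      case False
      have xc: "x \<in> closure \<Omega>" using x closure_subset by blast
      then obtain p where p: "p \<in> F" "x \<in> ball p (\<rho> p)" using F(3) by blast
      have "norm (T t x - x - t *\<^sub>R ?S p) \<le> \<bar>t\<bar>" using \<delta>(2)[OF False, of] t p xc by auto
      then have "norm (T t x - x) \<le> \<bar>t\<bar> + norm (t *\<^sub>R ?S p)"
        using norm_triangle_ineq[of "T t x - x - t *\<^sub>R ?S p" "t *\<^sub>R ?S p"] by simp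
      also have "\<dots> = \<bar>t\<bar> * (1 + norm (?S p))" by (simp add: algebra_simps)
      also have "\<dots> \<le> \<bar>t\<bar> * C"
        unfolding C_def using member_le_sum[OF p(1), of "\<lambda>p. norm (?S p)"] F(2) by (intro mult_left_mono) auto
      finally show ?thesis by (simp add: mult.commute)
    qed (simp add: TD(4)[OF x])
  qed
qed

section \<open>Differentiation of the domain integral\<close>

text \<open>The McShane extension, an infimum of cones of slope \<open>L\<close>. It supplies values
  at \<open>(x, 0)\<close> for \<open>x\<close> in the layer outside \<Omega>, where
  \<open>(x, 0)\<close> may lie outside the closed tube.\<close>

lemma lipschitz_extension_real:
  fixes f :: "'a::metric_space \<Rightarrow> real"
  assumes f: "L-lipschitz_on A f"
  obtains g where "L-lipschitz_on UNIV g" "\<And>x. x \<in> A \<Longrightarrow> g x = f x"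
proof (cases "A = {}")
  case True
  show ?thesis
    by (rule that[of "\<lambda>_. 0"]) (use True lipschitz_on_nonneg[OF f] in \<open>auto intro: lipschitz_onI\<close>)
next
  case False
  have L: "L \<ge> 0" using f lipschitz_on_nonneg by blast
  define g where "g x = (INF a\<in>A. f a + L * dist x a)" for x
  obtain a0 where a0: "a0 \<in> A" using False by blast
  have bdd: "bdd_below ((\<lambda>a. f a + L * dist x a) ` A)" for x
  proof (rule bdd_belowI2)
    fix a assume a: "a \<in> A"
    have "f a0 - f a \<le> L * dist a0 a" using lipschitz_onD[OF f a0 a] by (simp add: dist_real_def)
    also have "\<dots> \<le> L * (dist x a0 + dist x a)"
      using L dist_triangle3[of a0 a x] by (intro mult_left_mono) auto
    finally show "f a0 - L * dist x a0 \<le> f a + L * dist x a" by (simp add: algebra_simps)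
  qed
  have le: "g x \<le> g y + L * dist x y" for x y
  proof -
    have "g x - L * dist x y \<le> g y"
      unfolding g_def
    proof (rule cINF_greatest[OF False])
      fix a assume a: "a \<in> A"
      have "(INF a\<in>A. f a + L * dist x a) \<le> f a + L * dist x a" by (rule cINF_lower[OF bdd a])
      also have "\<dots> \<le> f a + L * (dist x y + dist y a)"
        using L dist_triangle[of x a y] by (intro add_left_mono mult_left_mono) auto
      finally show "(INF a\<in>A. f a + L * dist x a) - L * dist x y \<le> f a + L * dist y a"
        by (simp add: algebra_simps)
    qed
    then show ?thesis by simp
  qed
  show ?thesis
  proof (rule that)
    show "L-lipschitz_on UNIV g"
    proof (rule lipschitz_onI)
      fix x y
      show "dist (g x) (g y) \<le> L * dist x y"
        using le[of x y] le[of y x] by (simp add: dist_real_def dist_commute abs_le_iff)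
    qed (rule L)
    fix x assume x: "x \<in> A"
    show "g x = f x"
    proof (rule antisym)
      show "g x \<le> f x" unfolding g_def using cINF_lower[OF bdd x, of x] by simp
      show "f x \<le> g x"
        unfolding g_def
      proof (rule cINF_greatest[OF False])
        fix a assume a: "a \<in> A"
        show "f x \<le> f a + L * dist x a"
          using lipschitz_onD[OF f x a] by (auto simp: dist_real_def abs_le_iff)
      qed
    qed
  qed
qed

lemma integrable_indicator_continuous:
  fixes f :: "'a::euclidean_space \<Rightarrow> real"
  assumes f: "continuous_on UNIV f" and A: "A \<in> sets borel" "bounded A"
  shows "integrable lborel (\<lambda>x. indicator A x * f x)"
proof -
  have [measurable]: "f \<in> borel_measurable borel" using f by (rule borel_measurable_continuous_onI)
  note [measurable] = A(1)
  have "bounded (f ` closure A)"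
    using A(2) f by (intro compact_imp_bounded compact_continuous_image) (auto simp: compact_closure intro: continuous_on_subset)
  then obtain M where M: "\<And>x. x \<in> closure A \<Longrightarrow> \<bar>f x\<bar> \<le> M" unfolding bounded_iff by auto
  show ?thesis
  proof (rule Bochner_Integration.integrable_bound)
    show "integrable lborel (\<lambda>x. M * indicator A x)"
      using A by (intro integrable_mult_right integrable_real_indicator emeasure_bounded_finite) auto
    have "norm (indicator A x * f x) \<le> norm (M * indicator A x)" for x
      using M[of x] closure_subset[of A] by (cases "x \<in> A") (auto simp: abs_le_iff)
    then show "AE x in lborel. norm (indicator A x * f x) \<le> norm (M * indicator A x)" by simp
  qed measurable
qed

text \<open>The boundary layers of the individual charts are added up with a partition of unity near
  the boundary; away from the boundary \<open>\<Omega>\<close> and its image eventually coincide.\<close>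

theorem (in perturbation) integral_image_diff_tendsto:
  assumes dom: "lipschitz_domain \<Omega>" and f: "continuous_on UNIV f" and S: "continuous_on (frontier \<Omega>) S"
  shows "(\<lambda>n. (\<integral>y. f y * image_diff n y \<partial>lborel) / t n) \<longlonglongrightarrow>
    (\<integral>q. indicator (frontier \<Omega>) q * (f q * (S q \<bullet> outer_normal \<Omega> q)) \<partial>surface_measure \<Omega>)"
proof -
  have comp: "compact (frontier \<Omega>)" by (rule compact_frontier_bounded[OF bounded_domain])
  \<comment> \<open>The ball of twice the radius fits into the chart, so that every point of a tent
    of radius \<open>r\<close> has a ball of radius \<open>r\<close> inside \<open>U\<close>, the
    margin that \<open>boundary_layer\<close> asks for.\<close>
  have "\<forall>p\<in>frontier \<Omega>. \<exists>U e \<phi> r. 0 < r \<and> ball p (2 * r) \<subseteq> U \<and> lipschitz_chart \<Omega> U e \<phi>"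
  proof
    fix p assume "p \<in> frontier \<Omega>"
    then obtain U e \<phi> where U: "p \<in> U" "lipschitz_chart \<Omega> U e \<phi>"
      using dom unfolding lipschitz_domain_def by blast
    then obtain r where "r > 0" "ball p r \<subseteq> U" using open_contains_ball unfolding lipschitz_chart_def by blast
    with U show "\<exists>U e \<phi> r. 0 < r \<and> ball p (2 * r) \<subseteq> U \<and> lipschitz_chart \<Omega> U e \<phi>"
      by (intro exI[of _ U] exI[of _ e] exI[of _ \<phi>] exI[of _ "r / 2"]) auto
  qed
  then obtain U e \<phi> r where r: "\<And>p. p \<in> frontier \<Omega> \<Longrightarrow> 0 < r p"
    and U: "\<And>p. p \<in> frontier \<Omega> \<Longrightarrow> ball p (2 * r p) \<subseteq> U p"
    and chart: "\<And>p. p \<in> frontier \<Omega> \<Longrightarrow> lipschitz_chart \<Omega> (U p) (e p) (\<phi> p)"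
    by metis
  have cov: "frontier \<Omega> \<subseteq> (\<Union>p\<in>frontier \<Omega>. ball p (r p))" using r by force
  obtain F where F: "F \<subseteq> frontier \<Omega>" "finite F" "frontier \<Omega> \<subseteq> (\<Union>p\<in>F. ball p (r p))"
    by (rule compactE_image[OF comp _ cov]) auto
  define h where "h p y = max 0 (r p - dist y p)" for p y
  define H where "H y = (\<Sum>p\<in>F. h p y)" for y
  have hc [continuous_intros]: "continuous_on A (h p)" for p A unfolding h_def by (intro continuous_intros)
  have Hc [continuous_intros]: "continuous_on A H" for A unfolding H_def by (intro continuous_intros)
  have h0: "h p y \<ge> 0" for p y by (simp add: h_def)
  have Hpos: "H y > 0" if y: "y \<in> frontier \<Omega>" for y
  proof -
    obtain p where p: "p \<in> F" "y \<in> ball p (r p)" using F(3) y by blast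
    then have "h p y > 0" by (simp add: h_def dist_commute)
    then show ?thesis unfolding H_def using p F(2) h0 by (intro sum_pos2) auto
  qed
  obtain d where d: "d > 0" "\<And>y. y \<in> frontier \<Omega> \<Longrightarrow> 2 * d \<le> H y"
  proof (cases "frontier \<Omega> = {}")
    case False
    obtain y where y: "y \<in> frontier \<Omega>" "\<And>z. z \<in> frontier \<Omega> \<Longrightarrow> H y \<le> H z"
      using continuous_attains_inf[OF comp False Hc] by blast
    then show ?thesis using Hpos[OF y(1)] by (intro that[of "H y / 2"]) auto
  qed (use that[of 1] in auto)
  \<comment> \<open>The floor \<open>d\<close> keeps the denominator positive everywhere. On the
    frontier \<open>w\<close> equals \<open>H\<close>, so the weights add up to 1 there, and the
    remainder \<open>g0\<close> lives where \<open>H < d\<close>, away from the frontier.\<close>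
  define w where "w y = max (H y) d" for y
  have w: "w y > 0" "w y \<ge> d" for y using d(1) by (auto simp: w_def)
  have wc [continuous_intros]: "continuous_on A w" for A unfolding w_def by (intro continuous_intros)
  define g where "g p y = f y * (h p y / w y)" for p y
  define g0 where "g0 y = f y * (1 - H y / w y)" for y
  have gc: "continuous_on UNIV (g p)" for p
    unfolding g_def using w(1) by (intro continuous_intros f) (metis less_irrefl)
  have g0c: "continuous_on UNIV g0"
    unfolding g0_def using w(1) by (intro continuous_intros f) (metis less_irrefl)
  have split: "f y = (\<Sum>p\<in>F. g p y) + g0 y" for y
    by (simp add: g_def g0_def sum_distrib_left[symmetric] sum_divide_distrib[symmetric] H_def right_diff_distrib)
  have split_frontier: "f y = (\<Sum>p\<in>F. g p y)" if "y \<in> frontier \<Omega>" for y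
  proof -
    have "w y = H y" using d(2)[OF that] d(1) by (simp add: w_def)
    then have "g0 y = 0" using w(1)[of y] by (simp add: g0_def)
    then show ?thesis using split[of y] by simp
  qed
  have gz: "dist y p < r p" if "g p y \<noteq> 0" for p y using that by (auto simp: g_def h_def)
  have gm: "ball y (r p) \<subseteq> U p" if "p \<in> F" "g p y \<noteq> 0" for p y
  proof
    fix z assume "z \<in> ball y (r p)"
    then have "dist p z < 2 * r p" using gz[OF that(2)] dist_triangle[of p z y] by (simp add: dist_commute)
    then show "z \<in> U p" using U[of p] F(1) that(1) by (auto simp: subset_eq)
  qed
  have gb: "\<exists>K. \<forall>y. \<bar>g p y\<bar> \<le> K" for p
  proof -
    have "bounded (g p ` cball p (r p))"
      using gc by (intro compact_imp_bounded compact_continuous_image) (auto intro: continuous_on_subset)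
    then obtain K where K: "\<And>y. y \<in> cball p (r p) \<Longrightarrow> \<bar>g p y\<bar> \<le> K" unfolding bounded_real ball_simps by blast
    have "\<bar>g p y\<bar> \<le> max K 0" for y
      using K[of y] gz[of p y] by (cases "g p y = 0") (auto simp: dist_commute)
    then show ?thesis by blast
  qed
  have int: "integrable lborel (\<lambda>y. u y * image_diff n y)" if "continuous_on UNIV u" for u n
  proof -
    have "bounded (V n ` \<Omega>)"
    proof -
      obtain B where B: "\<And>x. x \<in> \<Omega> \<Longrightarrow> norm x \<le> B" using bounded_domain unfolding bounded_iff by blast
      have "norm (V n x) \<le> B + C * t n" if "x \<in> \<Omega>" for x
        using B[OF that] C_bound[OF that, of n] norm_triangle_ineq[of x "V n x - x"] by simp
      then show ?thesis unfolding bounded_iff by blast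
    qed
    then have "integrable lborel (\<lambda>y. indicator (V n ` \<Omega>) y * u y - indicator \<Omega> y * u y)"
      using open_V open_domain bounded_domain that
      by (intro Bochner_Integration.integrable_diff integrable_indicator_continuous) auto
    then show ?thesis by (simp add: image_diff_def algebra_simps)
  qed
  have lim: "(\<lambda>n. (\<integral>y. g p y * image_diff n y \<partial>lborel) / t n) \<longlonglongrightarrow>
      (\<integral>q. indicator (frontier \<Omega>) q * (g p q * (S q \<bullet> outer_normal \<Omega> q)) \<partial>surface_measure \<Omega>)
    \<and> integrable (surface_measure \<Omega>) (\<lambda>q. indicator (frontier \<Omega>) q * (g p q * (S q \<bullet> outer_normal \<Omega> q)))"
    if p: "p \<in> F" for p
  proof -
    have pf: "p \<in> frontier \<Omega>" using p F(1) by blast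
    obtain K where K: "\<And>y. \<bar>g p y\<bar> \<le> K" using gb by blast
    have gU: "y \<in> U p" if "g p y \<noteq> 0" for y using gm[OF p that] r[OF pf] by auto
    have m: "g p \<in> borel_measurable borel" using gc by (rule borel_measurable_continuous_onI)
    note fl = surface_flux[OF dom bounded_domain chart[OF pf] m K gU S]
    show ?thesis
      using boundary_layer[OF chart[OF pf] gc K r[OF pf] gm[OF p] S] fl by simp
  qed
  \<comment> \<open>The zone \<open>H \<le> d\<close> has positive distance \<gamma> from the
    frontier. Once \<open>C * t n < \<gamma>\<close>, the ball of radius \<open>C * t n\<close>
    about such a point is connected and misses the frontier, so it lies entirely inside or outside
    \<Omega> and meets no layer.\<close>
  have z: "\<forall>\<^sub>F n in sequentially. (\<integral>y. g0 y * image_diff n y \<partial>lborel) / t n = 0"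
  proof -
    have "closed {y. H y \<le> d}" by (intro closed_Collect_le continuous_intros)
    moreover have "frontier \<Omega> \<inter> {y. H y \<le> d} = {}" using d by force
    ultimately obtain \<gamma> where \<gamma>: "\<gamma> > 0" "\<And>x y. x \<in> frontier \<Omega> \<Longrightarrow> H y \<le> d \<Longrightarrow> \<gamma> \<le> dist x y"
      using separate_compact_closed[OF comp, of "{y. H y \<le> d}"] by auto
    have "(\<lambda>n. C * t n) \<longlonglongrightarrow> C * 0" by (intro tendsto_intros t_lim)
    then have "\<forall>\<^sub>F n in sequentially. C * t n < \<gamma>" using \<gamma>(1) by (intro order_tendstoD(2)) auto
    then show ?thesis
    proof eventually_elim
      case (elim n)
      have "g0 y * image_diff n y = 0" for y
      proof (cases "H y \<le> d")
        case True
        have "cball y (C * t n) \<inter> frontier \<Omega> = {}"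
          using \<gamma>(2)[OF _ True] elim by (force simp: dist_commute)
        then have "cball y (C * t n) \<subseteq> \<Omega> \<or> cball y (C * t n) \<inter> \<Omega> = {}"
          using connected_Int_frontier[OF connected_cball, of y "C * t n" \<Omega>] by blast
        then show ?thesis using image_diff_eq_0_interior image_diff_eq_0_exterior by auto
      next
        case False
        then have "w y = H y" by (simp add: w_def)
        then show ?thesis using w(1)[of y] by (simp add: g0_def)
      qed
      then have eq: "(\<lambda>y. g0 y * image_diff n y) = (\<lambda>_. 0)" by (rule ext)
      show ?case unfolding eq by simp
    qed
  qed
  have "(\<lambda>n. (\<Sum>p\<in>F. (\<integral>y. g p y * image_diff n y \<partial>lborel) / t n) + (\<integral>y. g0 y * image_diff n y \<partial>lborel) / t n) \<longlonglongrightarrow>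
      (\<Sum>p\<in>F. \<integral>q. indicator (frontier \<Omega>) q * (g p q * (S q \<bullet> outer_normal \<Omega> q)) \<partial>surface_measure \<Omega>) + 0"
    using lim by (intro tendsto_add tendsto_sum tendsto_eventually[OF z]) blast
  also have "(\<lambda>n. (\<Sum>p\<in>F. (\<integral>y. g p y * image_diff n y \<partial>lborel) / t n) + (\<integral>y. g0 y * image_diff n y \<partial>lborel) / t n)
      = (\<lambda>n. (\<integral>y. f y * image_diff n y \<partial>lborel) / t n)"
  proof
    fix n
    have "(\<integral>y. f y * image_diff n y \<partial>lborel) = (\<integral>y. (\<Sum>p\<in>F. g p y * image_diff n y) + g0 y * image_diff n y \<partial>lborel)"
      by (intro Bochner_Integration.integral_cong refl) (subst split, simp add: distrib_right sum_distrib_right)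
    also have "\<dots> = (\<Sum>p\<in>F. (\<integral>y. g p y * image_diff n y \<partial>lborel)) + (\<integral>y. g0 y * image_diff n y \<partial>lborel)"
      by (simp add: Bochner_Integration.integral_add Bochner_Integration.integral_sum int gc g0c)
    finally show "(\<Sum>p\<in>F. (\<integral>y. g p y * image_diff n y \<partial>lborel) / t n) + (\<integral>y. g0 y * image_diff n y \<partial>lborel) / t n
      = (\<integral>y. f y * image_diff n y \<partial>lborel) / t n"
      by (simp add: add_divide_distrib sum_divide_distrib)
  qed
  also have "(\<Sum>p\<in>F. \<integral>q. indicator (frontier \<Omega>) q * (g p q * (S q \<bullet> outer_normal \<Omega> q)) \<partial>surface_measure \<Omega>) + 0 =
      (\<integral>q. (\<Sum>p\<in>F. indicator (frontier \<Omega>) q * (g p q * (S q \<bullet> outer_normal \<Omega> q))) \<partial>surface_measure \<Omega>)"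
    using lim by (subst Bochner_Integration.integral_sum) auto
  also have "\<dots> = (\<integral>q. indicator (frontier \<Omega>) q * (f q * (S q \<bullet> outer_normal \<Omega> q)) \<partial>surface_measure \<Omega>)"
  proof (intro Bochner_Integration.integral_cong refl)
    fix q
    show "(\<Sum>p\<in>F. indicator (frontier \<Omega>) q * (g p q * (S q \<bullet> outer_normal \<Omega> q))) = indicator (frontier \<Omega>) q * (f q * (S q \<bullet> outer_normal \<Omega> q))"
      by (cases "q \<in> frontier \<Omega>") (simp_all add: split_frontier sum_distrib_right)
  qed
  finally show ?thesis .
qed

section \<open>Deformations as perturbations, and the derivative\<close>

text \<open>The sign \<open>s\<close> lets positive sequences describe times tending to 0 from
  either side, with velocity \<open>s\<close> times the field. The bi-Lipschitz bound gives
  injectivity, and invariance of domain then gives open images.\<close>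

lemma perturbation_deformation:
  assumes T: "differentiable_deformations \<Omega> \<epsilon> T" and dom: "lipschitz_domain \<Omega>" "bounded \<Omega>"
    and C: "C \<ge> 0" "\<delta> \<le> \<epsilon>" "\<And>t x. \<bar>t\<bar> < \<delta> \<Longrightarrow> x \<in> \<Omega> \<Longrightarrow> norm (T t x - x) \<le> C * \<bar>t\<bar>"
    and s: "\<bar>s\<bar> = 1" and t: "\<And>n. t n \<in> {0<..<\<delta>}" "t \<longlonglongrightarrow> 0"
  shows "perturbation \<Omega> (\<lambda>n. T (s * t n)) t (\<lambda>x. s *\<^sub>R deformation_field T x) C"
proof
  note TD = differentiable_deformationsD[OF T]
  show \<Omega>: "open \<Omega>" using dom by (simp add: lipschitz_domain_def)
  have abs_st: "\<bar>s * t n\<bar> = t n" for n using s t(1)[of n] by (simp add: abs_mult)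
  have st: "\<bar>s * t n\<bar> < \<epsilon>" for n using abs_st t(1)[of n] C(2) by simp
  show cont: "continuous_on \<Omega> (T (s * t n))" for n
    using TD(3)[OF st] closure_subset by (rule continuous_on_subset)
  show "open (T (s * t n) ` \<Omega>)" for n
  proof (rule invariance_of_domain[OF cont \<Omega>])
    obtain L where L: "L > 0" "\<And>x y. x \<in> \<Omega> \<Longrightarrow> y \<in> \<Omega> \<Longrightarrow> dist x y / L \<le> dist (T (s * t n) x) (T (s * t n) y)"
      using TD(2)[OF st[of n]] unfolding bi_lipschitz_on_def by blast
    show "inj_on (T (s * t n)) \<Omega>"
    proof (rule inj_onI)
      fix x y assume "x \<in> \<Omega>" "y \<in> \<Omega>" "T (s * t n) x = T (s * t n) y"
      then show "x = y" using L(1) L(2)[of x y] by (simp add: divide_le_0_iff)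
    qed
  qed
  show "norm (T (s * t n) x - x) \<le> C * t n" if "x \<in> \<Omega>" for n x
    using C(3)[of "s * t n" x] that abs_st[of n] t(1)[of n] by simp
  fix p and \<eta> :: real assume p: "p \<in> frontier \<Omega>" and \<eta>: "\<eta> > 0"
  then have "p \<in> closure \<Omega>" by (simp add: frontier_def)
  from deformation_expansion[OF T dom(1) this \<eta>] obtain \<rho> where \<rho>: "\<rho> > 0"
    "\<forall>\<^sub>F \<tau> in at 0. \<forall>x\<in>closure \<Omega> \<inter> ball p \<rho>. norm (T \<tau> x - x - \<tau> *\<^sub>R deformation_field T p) \<le> \<bar>\<tau>\<bar> * \<eta>"
    by blast
  have "(\<lambda>n. s * t n) \<longlonglongrightarrow> s * 0" by (intro tendsto_intros t(2))
  moreover have "s * t n \<noteq> 0" for n using abs_st[of n] t(1)[of n] by auto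
  ultimately have "filterlim (\<lambda>n. s * t n) (at 0) sequentially" by (simp add: filterlim_at)
  then have "\<forall>\<^sub>F n in sequentially. \<forall>x\<in>closure \<Omega> \<inter> ball p \<rho>.
      norm (T (s * t n) x - x - (s * t n) *\<^sub>R deformation_field T p) \<le> \<bar>s * t n\<bar> * \<eta>"
    using \<rho>(2) unfolding filterlim_iff by blast
  then have "\<forall>\<^sub>F n in sequentially. \<forall>x\<in>\<Omega> \<inter> ball p \<rho>.
      norm (T (s * t n) x - x - t n *\<^sub>R s *\<^sub>R deformation_field T p) \<le> t n * \<eta>"
    unfolding abs_st by eventually_elim (use closure_subset in \<open>fastforce simp: mult.commute\<close>)
  with \<rho>(1) show "\<exists>\<rho>>0. \<forall>\<^sub>F n in sequentially. \<forall>x\<in>\<Omega> \<inter> ball p \<rho>.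
      norm (T (s * t n) x - x - t n *\<^sub>R s *\<^sub>R deformation_field T p) \<le> t n * \<eta>" by blast
qed (use dom C t in auto)

theorem theorem7:
  fixes \<Omega> :: "(real^'n) set"
    and \<epsilon> :: real
    and T :: "real \<Rightarrow> real^'n \<Rightarrow> real^'n"
    and c c\<^sub>t :: "(real^'n) \<times> real \<Rightarrow> real"
  assumes "CARD('n) \<ge> 2"
    and "lipschitz_domain \<Omega>" and "bounded \<Omega>"
    and "differentiable_deformations \<Omega> \<epsilon> T"
    and "\<exists>L. L-lipschitz_on (closure (deformation_tube \<Omega> \<epsilon> T)) c"
    and "continuous_on (closure (deformation_tube \<Omega> \<epsilon> T)) c\<^sub>t"
    and "\<And>x t. (x, t) \<in> deformation_tube \<Omega> \<epsilon> T \<Longrightarrow>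
           ((\<lambda>s. c (x, s)) has_real_derivative c\<^sub>t (x, t)) (at t)"
  shows "((\<lambda>t. LINT x : T t ` \<Omega> | lebesgue. c (x, t)) has_real_derivative
            (LINT x : \<Omega> | lebesgue. c\<^sub>t (x, 0))
              + boundary_inner \<Omega> (\<lambda>x. c (x, 0)) (normal_displacement \<Omega> T)) (at 0)"
proof -
  note dom = assms(2,3) and T = assms(4)
  note TD = differentiable_deformationsD[OF T]
  let ?Q = "deformation_tube \<Omega> \<epsilon> T" and ?S = "deformation_field T"
  have \<Omega>: "open \<Omega>" using dom by (simp add: lipschitz_domain_def)
  have Q: "(T t x, t) \<in> ?Q" if "x \<in> \<Omega>" "\<bar>t\<bar> < \<epsilon>" for x t
    using that by (auto simp: deformation_tube_def abs_less_iff)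
  have Q0: "(x, 0) \<in> ?Q" if "x \<in> \<Omega>" for x using Q[OF that, of 0] TD(1,4) that by auto
  \<comment> \<open>At time 0 the closed tube contains the closure of \<Omega>, so that the
    extension \<open>c'\<close> agrees with \<open>c\<close> in the boundary integral.\<close>
  have Q0c: "(x, 0) \<in> closure ?Q" if "x \<in> closure \<Omega>" for x
  proof -
    have "(\<lambda>x. (x, 0::real)) ` closure \<Omega> \<subseteq> closure ?Q"
      by (rule image_closure_subset) (use Q0 closure_subset in \<open>auto intro!: continuous_intros\<close>)
    then show ?thesis using that by blast
  qed
  obtain L where "L-lipschitz_on (closure ?Q) c" using assms(5) by blast
  then obtain c' where c': "L-lipschitz_on UNIV c'" "\<And>z. z \<in> closure ?Q \<Longrightarrow> c' z = c z"
    by (rule lipschitz_extension_real) blast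
  have L: "L \<ge> 0" using c'(1) lipschitz_on_nonneg by blast
  have c'Q: "c' z = c z" if "z \<in> ?Q" for z using c'(2) that closure_subset by blast
  have c'c: "continuous_on UNIV (\<lambda>x. c' (x, \<tau>))" for \<tau>
    by (intro continuous_on_compose2[OF lipschitz_on_continuous_on[OF c'(1)]] continuous_intros) auto
  have [measurable]: "(\<lambda>x. c' (x, \<tau>)) \<in> borel_measurable borel" for \<tau>
    using c'c by (rule borel_measurable_continuous_onI)
  obtain C \<delta> where C: "C \<ge> 0" "0 < \<delta>" "\<delta> \<le> \<epsilon>"
    "\<And>t x. \<bar>t\<bar> < \<delta> \<Longrightarrow> x \<in> \<Omega> \<Longrightarrow> norm (T t x - x) \<le> C * \<bar>t\<bar>"
    by (rule deformation_uniform_bound[OF T dom]) blast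
  define \<Phi> where "\<Phi> t = (LINT x : T t ` \<Omega> | lebesgue. c (x, t))" for t
  define D where "D = (LINT x : \<Omega> | lebesgue. c\<^sub>t (x, 0)) + boundary_inner \<Omega> (\<lambda>x. c (x, 0)) (normal_displacement \<Omega> T)"
  have T0: "T 0 ` \<Omega> = \<Omega>" using TD(4) by force
  have ct: "(\<lambda>x. indicator \<Omega> x *\<^sub>R c\<^sub>t (x, 0)) \<in> borel_measurable borel"
  proof (rule borel_measurable_continuous_on_indicator)
    show "continuous_on \<Omega> (\<lambda>x. c\<^sub>t (x, 0))"
      using Q0c closure_subset by (intro continuous_on_compose2[OF assms(6)] continuous_intros) auto
  qed (use \<Omega> in simp)
  \<comment> \<open>The derivative is tested along sequences of times, with \<open>s\<close> the
    sign and \<open>t n\<close> the modulus of the time.\<close>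
  have main: "(\<lambda>n. (\<Phi> (s * t n) - \<Phi> 0) / (s * t n)) \<longlonglongrightarrow> D"
    if s: "\<bar>s\<bar> = 1" and t: "\<And>n. t n \<in> {0<..<\<delta>}" "t \<longlonglongrightarrow> 0" for s and t :: "nat \<Rightarrow> real"
  proof -
    interpret perturbation \<Omega> "\<lambda>n. T (s * t n)" t "\<lambda>x. s *\<^sub>R ?S x" C
      by (rule perturbation_deformation[OF T dom C(1,3,4) s t])
    let ?V = "\<lambda>n. T (s * t n) ` \<Omega>"
    have abs_st: "\<bar>s * t n\<bar> = t n" for n using s t(1)[of n] by (simp add: abs_mult)
    have st: "\<bar>s * t n\<bar> < \<epsilon>" for n using abs_st t(1)[of n] C(3) by simp
    have st0: "s * t n \<noteq> 0" for n using abs_st[of n] t(1)[of n] by auto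
    have ss: "s * s = 1" using s by (metis abs_mult_self_eq mult_1)
    have [measurable]: "\<Omega> \<in> sets borel" "?V n \<in> sets borel" for n using \<Omega> open_V by auto
    obtain B where B: "\<And>x. x \<in> \<Omega> \<Longrightarrow> norm x \<le> B" using dom(2) unfolding bounded_iff by blast
    define R where "R = B + C * \<delta>"
    have VR: "?V n \<subseteq> cball 0 R" for n
    proof
      fix y assume "y \<in> ?V n"
      then obtain x where x: "x \<in> \<Omega>" "y = T (s * t n) x" by blast
      have "norm y \<le> norm x + norm (T (s * t n) x - x)" using norm_triangle_ineq[of x "y - x"] x(2) by simp
      also have "\<dots> \<le> B + C * t n" using B[OF x(1)] C_bound[OF x(1), of n] by simp
      also have "\<dots> \<le> R" using t(1)[of n] C(1) by (simp add: R_def mult_left_mono)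
      finally show "y \<in> cball 0 R" by simp
    qed
    have Vb: "bounded (?V n)" for n by (rule bounded_subset[OF bounded_cball VR])
    have leb: "(LINT x : A | lebesgue. f x) = (\<integral>x. indicator A x * g x \<partial>lborel)"
      if "\<And>x. x \<in> A \<Longrightarrow> f x = g x" and [measurable]: "A \<in> sets borel" "g \<in> borel_measurable borel"
      for A :: "(real^'n) set" and f g :: "real^'n \<Rightarrow> real"
    proof -
      have "(LINT x : A | lebesgue. f x) = (\<integral>x. indicator A x * g x \<partial>lebesgue)"
        unfolding set_lebesgue_integral_def
        by (intro Bochner_Integration.integral_cong) (auto simp: that(1) indicator_def)
      also have "\<dots> = (\<integral>x. indicator A x * g x \<partial>lborel)" by (rule integral_completion) measurable
      finally show ?thesis .
    qed
    have \<Phi>n: "\<Phi> (s * t n) = (\<integral>x. indicator (?V n) x * c' (x, s * t n) \<partial>lborel)" for n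
      unfolding \<Phi>_def using Q[OF _ st[of n]] by (intro leb) (auto simp: c'Q)
    have \<Phi>0: "\<Phi> 0 = (\<integral>x. indicator \<Omega> x * c' (x, 0) \<partial>lborel)"
      unfolding \<Phi>_def T0 using Q0 by (intro leb) (auto simp: c'Q)
    define A where "A n x = indicator (?V n) x * ((c' (x, s * t n) - c' (x, 0)) / (s * t n))" for n x
    \<comment> \<open>Adding and subtracting the integral of \<open>c' (x, 0)\<close> over the moved
      domain separates the change of the integrand from that of the domain. As \<open>s\<close> is
      its own inverse, it passes to the numerator.\<close>
    have eq: "(\<Phi> (s * t n) - \<Phi> 0) / (s * t n) = (\<integral>x. A n x \<partial>lborel) + s * ((\<integral>x. c' (x, 0) * image_diff n x \<partial>lborel) / t n)" for n
    proof -
      note i = integrable_indicator_continuous[OF c'c]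
      have "\<Phi> (s * t n) - \<Phi> 0 = (\<integral>x. (indicator (?V n) x * c' (x, s * t n) - indicator (?V n) x * c' (x, 0)) +
          (indicator (?V n) x * c' (x, 0) - indicator \<Omega> x * c' (x, 0)) \<partial>lborel)"
        unfolding \<Phi>n \<Phi>0 using Vb dom(2)
        by (subst Bochner_Integration.integral_diff[symmetric]) (auto intro!: i)
      also have "\<dots> = (\<integral>x. indicator (?V n) x * c' (x, s * t n) - indicator (?V n) x * c' (x, 0) \<partial>lborel) +
          (\<integral>x. indicator (?V n) x * c' (x, 0) - indicator \<Omega> x * c' (x, 0) \<partial>lborel)"
        using Vb dom(2) by (intro Bochner_Integration.integral_add Bochner_Integration.integrable_diff i) auto
      also have "(\<integral>x. indicator (?V n) x * c' (x, s * t n) - indicator (?V n) x * c' (x, 0) \<partial>lborel) = (s * t n) * (\<integral>x. A n x \<partial>lborel)"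
        unfolding integral_mult_right_zero[symmetric] using st0[of n]
        by (intro Bochner_Integration.integral_cong) (auto simp: A_def right_diff_distrib[symmetric])
      also have "(\<integral>x. indicator (?V n) x * c' (x, 0) - indicator \<Omega> x * c' (x, 0) \<partial>lborel) = (\<integral>x. c' (x, 0) * image_diff n x \<partial>lborel)"
        by (intro Bochner_Integration.integral_cong) (auto simp: image_diff_def algebra_simps)
      finally have "(\<Phi> (s * t n) - \<Phi> 0) / (s * t n) = (\<integral>x. A n x \<partial>lborel) + (\<integral>x. c' (x, 0) * image_diff n x \<partial>lborel) / (s * t n)"
        using st0[of n] by (simp add: add_divide_distrib)
      also have "(\<integral>x. c' (x, 0) * image_diff n x \<partial>lborel) / (s * t n) = s * ((\<integral>x. c' (x, 0) * image_diff n x \<partial>lborel) / t n)"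
        using inverse_unique[OF ss] by (simp add: divide_inverse mult_ac)
      finally show ?thesis .
    qed
    have st_lim: "(\<lambda>n. s * t n) \<longlonglongrightarrow> 0"
      using tendsto_mult_left[OF t(2), of s] by simp
    then have st_at: "filterlim (\<lambda>n. s * t n) (at 0) sequentially" using st0 by (simp add: filterlim_at)
    have Ct_lim: "(\<lambda>n. C * t n) \<longlonglongrightarrow> 0"
      using tendsto_mult_left[OF t(2), of C] by simp
    have "(\<lambda>n. \<integral>x. A n x \<partial>lborel) \<longlonglongrightarrow> (\<integral>x. indicator \<Omega> x *\<^sub>R c\<^sub>t (x, 0) \<partial>lborel)"
    proof (rule integral_dominated_convergence)
      show "integrable lborel (\<lambda>x. L * indicator (cball (0::real^'n) R) x)"
        by (intro integrable_mult_right integrable_real_indicator emeasure_bounded_finite) auto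
      show "A n \<in> borel_measurable lborel" for n unfolding A_def by measurable
      show "AE x in lborel. norm (A n x) \<le> L * indicator (cball 0 R) x" for n
      proof (rule AE_I2)
        fix x
        have "\<bar>c' (x, s * t n) - c' (x, 0)\<bar> \<le> L * \<bar>s * t n\<bar>"
          using lipschitz_onD[OF c'(1), of "(x, s * t n)" "(x, 0)"] by (simp add: dist_Pair_Pair dist_real_def)
        then have "\<bar>(c' (x, s * t n) - c' (x, 0)) / (s * t n)\<bar> \<le> L"
          using st0[of n] by (simp add: divide_le_eq)
        then show "norm (A n x) \<le> L * indicator (cball 0 R) x"
          using VR[of n] L by (cases "x \<in> ?V n") (auto simp: A_def indicator_def)
      qed
      show "(\<lambda>x. indicator \<Omega> x *\<^sub>R c\<^sub>t (x, 0)) \<in> borel_measurable lborel" using ct by simp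
      \<comment> \<open>A point off the frontier belongs to \<open>?V n\<close> for all large
        \<open>n\<close> or to none of these, according to whether it lies in \<Omega>.\<close>
      have "AE x in lborel. x \<notin> frontier \<Omega>" using null_sets_lipschitz_frontier[OF dom] by (rule AE_not_in)
      then show "AE x in lborel. (\<lambda>n. A n x) \<longlonglongrightarrow> indicator \<Omega> x *\<^sub>R c\<^sub>t (x, 0)"
      proof eventually_elim
        case (elim x)
        show ?case
        proof (cases "x \<in> \<Omega>")
          case True
          then obtain \<rho> where \<rho>: "\<rho> > 0" "cball x \<rho> \<subseteq> \<Omega>" using \<Omega> open_contains_cball by blast
          have "\<forall>\<^sub>F n in sequentially. C * t n < \<rho>" using Ct_lim \<rho>(1) by (rule order_tendstoD(2))
          then have "\<forall>\<^sub>F n in sequentially. (c (x, s * t n) - c (x, 0)) / (s * t n) = A n x"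
          proof eventually_elim
            case (elim n)
            have "cball x (C * t n) \<subseteq> \<Omega>" using \<rho>(2) elim by auto
            then have "image_diff n x = 0" by (rule image_diff_eq_0_interior)
            then have xV: "x \<in> ?V n" using True by (auto simp: image_diff_def indicator_def split: if_splits)
            then have "(x, s * t n) \<in> ?Q" using Q[OF _ st[of n]] by auto
            then show ?case using xV Q0[OF True] by (simp add: A_def c'Q)
          qed
          moreover have "(\<lambda>n. (c (x, s * t n) - c (x, 0)) / (s * t n)) \<longlonglongrightarrow> c\<^sub>t (x, 0)"
          proof -
            have "((\<lambda>h. (c (x, h) - c (x, 0)) / h) \<longlongrightarrow> c\<^sub>t (x, 0)) (at 0)"
              using assms(7)[OF Q0[OF True]] by (simp add: DERIV_def)
            from filterlim_compose[OF this st_at] show ?thesis .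
          qed
          ultimately have "(\<lambda>n. A n x) \<longlonglongrightarrow> c\<^sub>t (x, 0)" by (rule Lim_transform_eventually[rotated])
          then show ?thesis using True by simp
        next
          case False
          then have "x \<in> - closure \<Omega>" using elim \<Omega> by (simp add: frontier_def interior_open)
          then obtain \<rho> where \<rho>: "\<rho> > 0" "cball x \<rho> \<subseteq> - closure \<Omega>"
            using open_contains_cball[of "- closure \<Omega>"] by auto
          have "\<forall>\<^sub>F n in sequentially. C * t n < \<rho>" using Ct_lim \<rho>(1) by (rule order_tendstoD(2))
          then have "\<forall>\<^sub>F n in sequentially. A n x = 0"
          proof eventually_elim
            case (elim n)
            have "cball x (C * t n) \<subseteq> cball x \<rho>" using elim by (intro subset_cball) simp
            then have "cball x (C * t n) \<inter> \<Omega> = {}" using \<rho>(2) closure_subset[of \<Omega>] by blast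
            then have "image_diff n x = 0" by (rule image_diff_eq_0_exterior)
            then show ?case using False by (simp add: image_diff_def A_def)
          qed
          then show ?thesis using False by (simp add: tendsto_eventually)
        qed
      qed
    qed
    moreover have "(\<integral>x. indicator \<Omega> x *\<^sub>R c\<^sub>t (x, 0) \<partial>lborel) = (LINT x : \<Omega> | lebesgue. c\<^sub>t (x, 0))"
      unfolding set_lebesgue_integral_def by (rule integral_completion[symmetric]) (use ct in simp)
    moreover have "(\<lambda>n. s * ((\<integral>x. c' (x, 0) * image_diff n x \<partial>lborel) / t n)) \<longlonglongrightarrow>
        s * (\<integral>q. indicator (frontier \<Omega>) q * (c' (q, 0) * ((s *\<^sub>R ?S q) \<bullet> outer_normal \<Omega> q)) \<partial>surface_measure \<Omega>)"
    proof (intro tendsto_mult_left integral_image_diff_tendsto[OF dom(1) c'c])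
      have "continuous_on (frontier \<Omega>) ?S"
        using continuous_on_deformation_field[OF T dom(1)] by (rule continuous_on_subset) (simp add: frontier_def)
      then show "continuous_on (frontier \<Omega>) (\<lambda>x. s *\<^sub>R ?S x)" by (intro continuous_intros)
    qed
    \<comment> \<open>The sign enters once through the quotient and once through the velocity, and
      cancels.\<close>
    moreover have "s * (\<integral>q. indicator (frontier \<Omega>) q * (c' (q, 0) * ((s *\<^sub>R ?S q) \<bullet> outer_normal \<Omega> q)) \<partial>surface_measure \<Omega>)
      = boundary_inner \<Omega> (\<lambda>x. c (x, 0)) (normal_displacement \<Omega> T)"
    proof -
      have eq: "indicator (frontier \<Omega>) q * (c' (q, 0) * ((s *\<^sub>R ?S q) \<bullet> outer_normal \<Omega> q)) =
          s * (indicator (frontier \<Omega>) q *\<^sub>R (c (q, 0) * normal_displacement \<Omega> T q))" for q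
        using c'(2)[OF Q0c, of q] by (cases "q \<in> frontier \<Omega>") (auto simp: normal_displacement_def frontier_def)
      then show ?thesis
        unfolding boundary_inner_def set_lebesgue_integral_def eq integral_mult_right_zero
        by (simp only: mult.assoc[symmetric] ss mult_1)
    qed
    ultimately show ?thesis unfolding eq D_def by (simp add: tendsto_add)
  qed
  have right: "((\<lambda>h. (\<Phi> h - \<Phi> 0) / h) \<longlongrightarrow> D) (at_right 0)"
  proof -
    \<comment> \<open>Halving \<delta> keeps every term of the sequence strictly below \<delta>, as
      \<open>main\<close> requires.\<close>
    have "((\<lambda>h. (\<Phi> h - \<Phi> 0) / h) \<longlongrightarrow> D) (at 0 within {0..\<delta> / 2})"
      unfolding tendsto_at_iff_sequentially
    proof (intro allI impI)
      fix X :: "nat \<Rightarrow> real" assume X: "\<forall>i. X i \<in> {0..\<delta> / 2} - {0}" "X \<longlonglongrightarrow> 0"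
      have pos: "X i \<in> {0<..<\<delta>}" for i using X(1)[rule_format, of i] C(2) by auto
      show "((\<lambda>h. (\<Phi> h - \<Phi> 0) / h) \<circ> X) \<longlonglongrightarrow> D"
        using main[of 1 X] X(2) pos by (simp add: o_def)
    qed
    then show ?thesis using C(2) by (simp add: at_within_Icc_at_right)
  qed
  have left: "((\<lambda>h. (\<Phi> h - \<Phi> 0) / h) \<longlongrightarrow> D) (at_left 0)"
  proof -
    have "((\<lambda>h. (\<Phi> h - \<Phi> 0) / h) \<longlongrightarrow> D) (at 0 within {- (\<delta> / 2)..0})"
      unfolding tendsto_at_iff_sequentially
    proof (intro allI impI)
      fix X :: "nat \<Rightarrow> real" assume X: "\<forall>i. X i \<in> {- (\<delta> / 2)..0} - {0}" "X \<longlonglongrightarrow> 0"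
      have "- X i \<in> {0<..<\<delta>}" for i using X(1)[rule_format, of i] C(2) by auto
      moreover have "(\<lambda>i. - X i) \<longlonglongrightarrow> 0" using tendsto_minus[OF X(2)] by simp
      ultimately show "((\<lambda>h. (\<Phi> h - \<Phi> 0) / h) \<circ> X) \<longlonglongrightarrow> D"
        using main[of "- 1" "\<lambda>i. - X i"] by (simp add: o_def)
    qed
    then show ?thesis using C(2) by (simp add: at_within_Icc_at_left)
  qed
  have "((\<lambda>h. (\<Phi> h - \<Phi> 0) / h) \<longlongrightarrow> D) (at 0)"
    using left right by (simp add: filterlim_split_at)
  then have "(\<Phi> has_real_derivative D) (at 0)" by (simp add: DERIV_def)
  then show ?thesis unfolding D_def \<Phi>_def .
qed

end
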